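(* Let $q>1$, $0<p\le q<\infty$, $\alpha>p-1$, and let $\mu$ be a positive Borel measure on $[0,1)$ satisfying condition $(W_{p,\alpha})$. Then $\mathcal{H}_{\mu,\alpha+1-p}$ is a bounded operator from $\mathcal{D}^p_\alpha$ into $\mathcal{D}^q_{\alpha-p}$ if and only if $\mu$ is a $\left(\frac{\alpha+2-p}{p}+\frac{\alpha+2-p}{q'}\right)$-Carleson measure.
   Context: $\mathbb{D}$ is the open unit disc, $dA=\frac1\pi dx\,dy$. For $0<p<\infty$, $\alpha>-1$, $A^p_\alpha$ is the space of analytic $f$ on $\mathbb{D}$ with $\|f\|_{A^p_\alpha}=\left((\alpha+1)\int_{\mathbb{D}}|f|^p(1-|z|^2)^\alpha dA\right)^{1/p}<\infty$, and $\mathcal{D}^p_\alpha$ consists of analytic $f$ with $f'\in A^p_\alpha$, normed by $|f(0)|+\|f'\|_{A^p_\alpha}$. $1/q+1/q'=1$. For a positive Borel measure $\mu$ on $[0,1)$ and $\beta>0$, $\mu_{n,k,\beta}=\frac{\Gamma(n+\beta)}{n!\Gamma(\beta)}\int_{[0,1)}t^{n+k}d\mu(t)$ and for $f(z)=\sum_k a_kz^k$ analytic, $\mathcal{H}_{\mu,\beta}(f)(z)=\sum_n\left(\sum_k\mu_{n,k,\beta}a_k\right)z^n$. Boundedness from $X$ into $Y$ means $\mathcal{H}_{\mu,\beta}(f)$ is defined and lies in $Y$ for all $f\in X$ with $\|\mathcal{H}_{\mu,\beta}(f)\|_Y\le C\|f\|_X$. For $s>0$, $\mu$ is an $s$-Carleson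 measure if $\mu([t,1))\le C(1-t)^s$ for $0\le t<1$. Condition $(W_{p,\alpha})$: if $0<p\le1$, $\mu$ is a $\frac{\alpha+2}{p}$-Carleson measure; if $1\le p\le 2$, $\mu$ is a $\frac{\alpha+2-(p-1)^2}{p}$-Carleson measure; if $2\le p<\infty$, $\mu$ is a $\frac{\alpha+1}{p}$-Carleson measure. *)

theory Defs
  imports "HOL-Complex_Analysis.Complex_Analysis"
begin

definition taylor_coeff :: "(complex \<Rightarrow> complex) \<Rightarrow> nat \<Rightarrow> complex" where
  "taylor_coeff f k = (deriv ^^ k) f 0 / of_nat (fact k)"

text \<open>The integral  \<integral>_D |f|^p (1-|z|^2)^alpha dA  with dA = dx dy / pi (possibly infinite).\<close>
definition bergman_integral :: "real \<Rightarrow> real \<Rightarrow> (complex \<Rightarrow> complex) \<Rightarrow> ennreal" where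
  "bergman_integral p \<alpha> f =
     (\<integral>\<^sup>+ z. ennreal (indicator (ball 0 1) z * (norm (f z) powr p * (1 - (norm z)\<^sup>2) powr \<alpha> / pi)) \<partial>lborel)"

definition bergman_space :: "real \<Rightarrow> real \<Rightarrow> (complex \<Rightarrow> complex) set" where
  "bergman_space p \<alpha> = {f. f holomorphic_on ball 0 1 \<and> bergman_integral p \<alpha> f < \<infinity>}"

definition bergman_norm :: "real \<Rightarrow> real \<Rightarrow> (complex \<Rightarrow> complex) \<Rightarrow> real" where
  "bergman_norm p \<alpha> f = ((\<alpha> + 1) * enn2real (bergman_integral p \<alpha> f)) powr (1 / p)"

definition dirichlet_space :: "real \<Rightarrow> real \<Rightarrow> (complex \<Rightarrow> complex) set" where
  "dirichlet_space p \<alpha> = {f. f holomorphic_on ball 0 1 \<and> deriv f \<in> bergman_space p \<alpha>}"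

definition dirichlet_norm :: "real \<Rightarrow> real \<Rightarrow> (complex \<Rightarrow> complex) \<Rightarrow> real" where
  "dirichlet_norm p \<alpha> f = norm (f 0) + bergman_norm p \<alpha> (deriv f)"

definition borel_measure_on_01 :: "real measure \<Rightarrow> bool" where
  "borel_measure_on_01 \<mu> \<longleftrightarrow> sets \<mu> = sets borel \<and> emeasure \<mu> (- {0..<1}) = 0"

definition carleson :: "real measure \<Rightarrow> real \<Rightarrow> bool" where
  "carleson \<mu> s \<longleftrightarrow> (\<exists>C. \<forall>t. 0 \<le> t \<and> t < 1 \<longrightarrow> emeasure \<mu> {t..<1} \<le> ennreal (C * (1 - t) powr s))"

definition cond_W :: "real \<Rightarrow> real \<Rightarrow> real measure \<Rightarrow> bool" where
  "cond_W p \<alpha> \<mu> \<longleftrightarrow>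
     (0 < p \<and> p \<le> 1 \<longrightarrow> carleson \<mu> ((\<alpha> + 2) / p)) \<and>
     (1 \<le> p \<and> p \<le> 2 \<longrightarrow> carleson \<mu> ((\<alpha> + 2 - (p - 1)\<^sup>2) / p)) \<and>
     (2 \<le> p \<longrightarrow> carleson \<mu> ((\<alpha> + 1) / p))"

definition mu_coeff :: "real measure \<Rightarrow> real \<Rightarrow> nat \<Rightarrow> nat \<Rightarrow> real" where
  "mu_coeff \<mu> \<beta> n k = Gamma (real n + \<beta>) / (fact n * Gamma \<beta>) * (\<integral>t. t ^ (n + k) \<partial>\<mu>)"

definition hilbert_coeff :: "real measure \<Rightarrow> real \<Rightarrow> (complex \<Rightarrow> complex) \<Rightarrow> nat \<Rightarrow> complex" where
  "hilbert_coeff \<mu> \<beta> f n = (\<Sum>k. complex_of_real (mu_coeff \<mu> \<beta> n k) * taylor_coeff f k)"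

definition hilbert_op :: "real measure \<Rightarrow> real \<Rightarrow> (complex \<Rightarrow> complex) \<Rightarrow> complex \<Rightarrow> complex" where
  "hilbert_op \<mu> \<beta> f z = (\<Sum>n. hilbert_coeff \<mu> \<beta> f n * z ^ n)"

definition hilbert_defined :: "real measure \<Rightarrow> real \<Rightarrow> (complex \<Rightarrow> complex) \<Rightarrow> bool" where
  "hilbert_defined \<mu> \<beta> f \<longleftrightarrow>
     (\<forall>n. summable (\<lambda>k. complex_of_real (mu_coeff \<mu> \<beta> n k) * taylor_coeff f k)) \<and>
     (\<forall>z \<in> ball 0 1. summable (\<lambda>n. hilbert_coeff \<mu> \<beta> f n * z ^ n))"

definition hilbert_bounded_DD ::
  "real measure \<Rightarrow> real \<Rightarrow> real \<Rightarrow> real \<Rightarrow> real \<Rightarrow> real \<Rightarrow> bool" where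
  "hilbert_bounded_DD \<mu> \<beta> p \<alpha> q \<gamma> \<longleftrightarrow>
     (\<exists>C. \<forall>f \<in> dirichlet_space p \<alpha>.
        hilbert_defined \<mu> \<beta> f \<and>
        hilbert_op \<mu> \<beta> f \<in> dirichlet_space q \<gamma> \<and>
        dirichlet_norm q \<gamma> (hilbert_op \<mu> \<beta> f) \<le> C * dirichlet_norm p \<alpha> f)"

end

theory Submission
  imports Defs
begin

text \<open>
  Write \<open>G = \<alpha> + 2 - p\<close>. Whenever the absolute Taylor series of \<open>f\<close> is \<open>\<mu>\<close>-integrable, the derivative of
  \<open>H f\<close> at \<open>z\<close> is \<open>(G - 1) \<integral> t f(t) (1 - t z)\<^bsup>-G\<^esup> d\<mu>(t)\<close>.

  Sufficiency is a discrete Hardy inequality. Sub-mean-value estimates for \<open>|f'|\<^sup>p\<close> on balls centred on the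
  radius show that \<open>|f(t)| \<le> 2\<^bsup>jG/p\<^esup> V\<^sub>j\<close> for \<open>1 - t \<approx> 2\<^bsup>-j\<^esup>\<close>, with \<open>V\<close> in \<open>\<ell>\<^sup>q\<close>. Where \<open>|1 - z| \<approx> 2\<^bsup>-m\<^esup>\<close>, the kernel
  is at most \<open>2\<^bsup>min(j,m) G\<^esup>\<close> up to a constant, so the Carleson condition bounds \<open>|(H f)'(z)|\<close> by \<open>2\<^bsup>mG/q\<^esup>\<close> times the
  convolution of \<open>V\<close> with a geometrically decaying kernel in \<open>|m - j|\<close>. As \<open>|1 - z| \<approx> 2\<^bsup>-m\<^esup>\<close> has weighted area of
  order \<open>2\<^bsup>-mG\<^esup>\<close>, Young's inequality in \<open>\<ell>\<^sup>q\<close> concludes. The integrability of the Taylor series follows from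
  the Hardy--Littlewood coefficient bounds, which need less than the Carleson condition.

  For necessity, test on \<open>(1 - a z)\<^bsup>-N\<^esup>\<close> with large \<open>N\<close> and evaluate \<open>(H f)'\<close> at the point \<open>a\<close>.
\<close>

section \<open>Rotation invariance and circle means\<close>

text \<open>The exponents fit as follows. With \<open>s = G/p + G (1 - 1/q)\<close>, block
  \<open>j\<close> of the radius contributes to \<open>(H f)'\<close> at distance
  \<open>2^(-m)\<close> from 1 a term \<open>V_j\<close> times 2 to the power
  \<open>min(j,m) G - j G (1 - 1/q)\<close>. Relative to \<open>m G/q\<close> this loses
  \<open>(m - j) G/q\<close> for \<open>j <= m\<close> and \<open>(j - m) G (1 - 1/q)\<close> for
  \<open>j > m\<close>; \<open>q > 1\<close> makes the second rate positive, and
  \<open>p <= q\<close> puts the \<open>l^p\<close> data of \<open>f'\<close> into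
  \<open>l^q\<close>. Conversely, the power \<open>N\<close> of the test function cancels and
  exactly \<open>(1 - a)^s\<close> is left.

  The obstacle is that \<open>H f\<close> is defined by sums over Taylor coefficients. A radial
  bound on \<open>f\<close> does not control the absolute Taylor series, so a majorant has to come
  from coefficient bounds. Its room is \<open>coeff_exponent < s\<close>: for \<open>p >= 1\<close>
  this reduces to \<open>1 - 1/p <= 1 - 1/q < G (1 - 1/q)\<close>, where \<open>G > 1\<close> is
  \<open>\<alpha> > p - 1\<close>.

  Polar coordinates are replaced by averaging circle means over rotation-invariant sets. The range
  \<open>p < 1\<close> has its own arguments for mean values and for coefficients, since
  \<open>|h|\<close> must then be bounded pointwise before passing to \<open>|h|^p\<close>.\<close>

lemma nn_integral_lborel_translate:
  fixes F :: "complex \<Rightarrow> ennreal"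
  assumes [measurable]: "F \<in> borel_measurable borel"
  shows "(\<integral>\<^sup>+z. F (c + z) \<partial>lborel) = (\<integral>\<^sup>+z. F z \<partial>lborel)"
  by (subst (2) lborel_distr_plus[of c, symmetric]) (simp add: nn_integral_distr)

text \<open>The proof is the usual uniqueness argument for Haar measure, tested against the
  rotation-invariant unit ball.\<close>

lemma nn_integral_lborel_rotate:
  fixes F :: "complex \<Rightarrow> ennreal"
  assumes [measurable]: "F \<in> borel_measurable borel" and u: "norm u = 1"
  shows "(\<integral>\<^sup>+z. F (u * z) \<partial>lborel) = (\<integral>\<^sup>+z. F z \<partial>lborel)"
proof -
  define I :: "complex \<Rightarrow> ennreal" where "I = indicator (ball 0 1)"
  have [measurable]: "I \<in> borel_measurable borel" unfolding I_def by (intro borel_measurable_indicator) simp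
  have I_rot: "I (- (u * x)) = I x" for x
    using u by (auto simp: I_def indicator_def norm_mult)
  have u0: "u \<noteq> 0" using u by auto
  have tr: "(\<integral>\<^sup>+y. I (y - c) \<partial>lborel) = (\<integral>\<^sup>+y. I y \<partial>lborel)" for c
    using nn_integral_lborel_translate[of I "- c"] by simp
  have I: "(\<integral>\<^sup>+y. I y \<partial>lborel) = emeasure lborel (ball 0 1 :: complex set)"
    by (simp add: I_def)
  have "(\<integral>\<^sup>+x. F (u * x) \<partial>lborel) * (\<integral>\<^sup>+y. I y \<partial>lborel)
      = (\<integral>\<^sup>+x. (\<integral>\<^sup>+y. F (u * x) * I (- (u * x) + y) \<partial>lborel) \<partial>lborel)"
    by (simp add: nn_integral_multc nn_integral_cmult tr)
  also have "\<dots> = (\<integral>\<^sup>+y. (\<integral>\<^sup>+x. F (u * x) * I (- (u * x) + y) \<partial>lborel) \<partial>lborel)"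
    by (rule lborel_pair.Fubini'[symmetric]) simp
  also have "\<dots> = (\<integral>\<^sup>+y. (\<integral>\<^sup>+x. F (y + u * x) * I x \<partial>lborel) \<partial>lborel)"
  proof (rule nn_integral_cong)
    \<comment> \<open>Substituting \<open>y / u + x\<close> for \<open>x\<close> is a translation,
      so only translation invariance is used. The rotation survives inside \<open>I\<close>, where
      \<open>I_rot\<close> removes it.\<close>
    fix y :: complex
    have "(\<integral>\<^sup>+x. F (u * x) * I (- (u * x) + y) \<partial>lborel)
      = (\<integral>\<^sup>+x. F (u * (y / u + x)) * I (- (u * (y / u + x)) + y) \<partial>lborel)"
      by (rule nn_integral_lborel_translate[symmetric]) simp
    also have "\<dots> = (\<integral>\<^sup>+x. F (y + u * x) * I (- (u * x)) \<partial>lborel)"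
      using u0 by (simp add: algebra_simps)
    finally show "(\<integral>\<^sup>+x. F (u * x) * I (- (u * x) + y) \<partial>lborel) = (\<integral>\<^sup>+x. F (y + u * x) * I x \<partial>lborel)"
      by (simp add: I_rot)
  qed
  also have "\<dots> = (\<integral>\<^sup>+x. (\<integral>\<^sup>+y. F (y + u * x) * I x \<partial>lborel) \<partial>lborel)"
    by (rule lborel_pair.Fubini') simp
  also have "\<dots> = (\<integral>\<^sup>+x. (\<integral>\<^sup>+y. F (u * x + y) \<partial>lborel) * I x \<partial>lborel)"
    by (simp add: nn_integral_multc add.commute)
  also have "\<dots> = (\<integral>\<^sup>+z. F z \<partial>lborel) * (\<integral>\<^sup>+y. I y \<partial>lborel)"
    by (simp add: nn_integral_lborel_translate nn_integral_cmult)
  finally have eq: "(\<integral>\<^sup>+x. F (u * x) \<partial>lborel) * emeasure lborel (ball 0 1 :: complex set)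
      = (\<integral>\<^sup>+z. F z \<partial>lborel) * emeasure lborel (ball 0 1 :: complex set)"
    by (simp only: I)
  have "emeasure lborel (ball 0 1 :: complex set) \<noteq> 0"
    by (simp add: emeasure_ball eval_unit_ball_vol)
  moreover have "emeasure lborel (ball 0 1 :: complex set) \<noteq> top"
    using emeasure_lborel_ball_finite[of "0::complex" 1] by auto
  ultimately show ?thesis using eq by (auto simp: ennreal_mult_cancel_left mult.commute[of _ "emeasure _ _"])
qed

text \<open>This is Cauchy's formula on the circle through \<open>z\<close>. The circle is
  parametrised by rotates of \<open>z\<close> itself, so that the right-hand side can later be
  integrated over \<open>z\<close> and simplified by rotation invariance.\<close>

lemma taylor_coeff_norm_le_circle_mean:
  assumes h: "h holomorphic_on ball 0 R" and z: "norm z < R"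
  shows "ennreal (norm (taylor_coeff h k) * norm z ^ k)
     \<le> (\<integral>\<^sup>+x. ennreal (norm (h (cis (2*pi*x) * z))) * indicator {0..1} x \<partial>lborel)"
proof (cases "z = 0")
  case True
  have "taylor_coeff h 0 = h 0" by (simp add: taylor_coeff_def)
  then show ?thesis using True by (cases k) (auto simp: nn_integral_cmult)
next
  case False
  define \<rho> where "\<rho> = norm z"
  \<comment> \<open>Turning by \<open>u\<close> moves \<open>z\<close> to the positive real axis,
    where \<open>circlepath\<close> starts; the \<open>k\<close>-th coefficient only picks up the
    unimodular factor \<open>u ^ k\<close>.\<close>
  define u where "u = z / of_real \<rho>"
  have \<rho>: "\<rho> > 0" "\<rho> < R" using False z by (auto simp: \<rho>_def)
  have u: "norm u = 1" "u * of_real \<rho> = z"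
    using \<rho> by (auto simp: u_def norm_divide \<rho>_def)
  define f where "f = (\<lambda>w. h (u * w))"
  have sub: "u * w \<in> ball 0 R \<longleftrightarrow> w \<in> ball 0 R" for w by (simp add: norm_mult u)
  have f: "f holomorphic_on ball 0 R"
    unfolding f_def
    by (rule holomorphic_on_compose_gen[OF _ h, unfolded o_def]) (auto intro!: holomorphic_intros simp: norm_mult u)
  have fc: "continuous_on (cball 0 \<rho>) f" "f holomorphic_on ball 0 \<rho>"
    using f \<rho> by (auto intro!: holomorphic_on_imp_continuous_on intro: holomorphic_on_subset)
  have df: "(deriv ^^ k) f 0 = u ^ k * (deriv ^^ k) h 0"
    unfolding f_def
    using higher_deriv_compose_linear[OF h, of "ball 0 R" 0 u k] \<rho> sub by auto
  let ?F = "\<lambda>x. f (circlepath 0 \<rho> x) / (circlepath 0 \<rho> x - 0) ^ Suc k *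
      vector_derivative (circlepath 0 \<rho>) (at x within {0..1})"
  have "((\<lambda>w. f w / (w - 0) ^ Suc k) has_contour_integral (2*pi*\<i> / fact k * (deriv ^^ k) f 0)) (circlepath 0 \<rho>)"
    using Cauchy_has_contour_integral_higher_derivative_circlepath[OF fc, of 0 k] \<rho> by simp
  then have int: "(?F has_integral (2*pi*\<i> / fact k * (deriv ^^ k) f 0)) {0..1}"
    by (simp add: has_contour_integral_def)
  define g where "g = (\<lambda>x::real. norm (h (cis (2*pi*x) * z)))"
  have nF: "norm (?F x) = 2*pi / \<rho>^k * g x" if "x \<in> {0..1}" for x
  proof -
    have "norm (vector_derivative (circlepath 0 \<rho>) (at x within {0..1})) = 2 * pi * \<rho>"
      using that \<rho> by (subst vector_derivative_circlepath01) (auto simp: norm_mult)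
    moreover have "circlepath 0 \<rho> x = of_real \<rho> * cis (2*pi*x)"
      by (simp add: circlepath cis_conv_exp mult_ac)
    moreover have "f (of_real \<rho> * cis (2*pi*x)) = h (cis (2*pi*x) * z)"
      unfolding f_def u(2)[symmetric] by (simp add: mult_ac)
    ultimately show ?thesis using \<rho>
      by (simp add: norm_mult norm_divide norm_power g_def field_simps)
  qed
  have inb: "cis (2*pi*x) * z \<in> ball 0 R" for x using z by (simp add: norm_mult)
  have gc: "continuous_on UNIV g"
    unfolding g_def
    by (intro continuous_on_norm continuous_on_compose2[OF holomorphic_on_imp_continuous_on[OF h]])
       (use inb in \<open>auto intro!: continuous_intros simp: cis_conv_exp\<close>)
  have gi: "g integrable_on {0..1}" by (rule integrable_continuous_real) (rule continuous_on_subset[OF gc], simp)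
  have "norm (2*pi*\<i> / fact k * (deriv ^^ k) f 0) \<le> integral {0..1} (\<lambda>x. 2*pi / \<rho>^k * g x)"
    unfolding integral_unique[OF int, symmetric]
    using int nF by (intro integral_norm_bound_integral integrable_on_mult_right gi)
      (auto simp del: power_Suc)
  also have "\<dots> = 2*pi / \<rho>^k * integral {0..1} g" by simp
  finally have "norm (taylor_coeff h k) * \<rho> ^ k \<le> integral {0..1} g"
    using \<rho> by (simp add: df norm_mult norm_divide norm_power u taylor_coeff_def field_simps)
  then have "ennreal (norm (taylor_coeff h k) * norm z ^ k) \<le> ennreal (integral {0..1} g)"
    by (simp add: \<rho>_def ennreal_leI)
  also have "\<dots> = (\<integral>\<^sup>+x. ennreal (g x) * indicator {0..1} x \<partial>lborel)"
    using nn_integral_has_integral_lebesgue[OF _ integrable_integral[OF gi]]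
    by (simp add: g_def ennreal_mult' ennreal_indicator mult.commute)
  finally show ?thesis by (simp add: g_def)
qed

section \<open>Sub-mean-value inequalities\<close>

lemma borel_measurable_norm_powr_indicator:
  assumes "h holomorphic_on A" "A \<in> sets borel"
  shows "(\<lambda>z. ennreal (indicator A z * norm (h z) powr p)) \<in> borel_measurable borel"
proof -
  have "(\<lambda>z. indicator A z *\<^sub>R norm (h z)) \<in> borel_measurable borel"
    using assms by (intro borel_measurable_continuous_on_indicator)
      (auto intro!: continuous_intros holomorphic_on_imp_continuous_on)
  then have [measurable]: "(\<lambda>z. indicator A z * norm (h z)) \<in> borel_measurable borel" by simp
  have "indicator A z * norm (h z) powr p = (indicator A z * norm (h z)) powr p" for z
    by (auto simp: indicator_def)
  then show ?thesis by simp
qed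

lemma borel_measurable_norm_indicator:
  assumes "h holomorphic_on A" "A \<in> sets borel"
  shows "(\<lambda>z. ennreal (indicator A z * norm (h z))) \<in> borel_measurable borel"
  using borel_measurable_norm_powr_indicator[OF assms, of 1] by simp

text \<open>Integrate the circle mean over \<open>A\<close> and exchange the integrals: every
  rotation contributes the same amount. The result serves twice, with a disc and
  \<open>k = 0\<close> for mean values, and with a thin annulus for coefficient bounds.\<close>

lemma taylor_coeff_area_le:
  assumes h: "h holomorphic_on ball 0 R" and A [measurable]: "A \<in> sets borel" and AR: "A \<subseteq> ball 0 R"
    and rot: "\<And>u z. norm u = 1 \<Longrightarrow> u * z \<in> A \<longleftrightarrow> z \<in> A"
  shows "(\<integral>\<^sup>+z. ennreal (indicator A z * (norm (taylor_coeff h k) * norm z ^ k)) \<partial>lborel)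
     \<le> (\<integral>\<^sup>+z. ennreal (indicator A z * norm (h z)) \<partial>lborel)"
proof -
  define F where "F = (\<lambda>z. ennreal (indicator A z * norm (h z)))"
  have [measurable]: "F \<in> borel_measurable borel"
    unfolding F_def by (rule borel_measurable_norm_indicator[OF holomorphic_on_subset[OF h AR] A])
  have [measurable]: "(\<lambda>x. cis (2*pi*x)) \<in> borel_measurable borel"
    by (intro borel_measurable_continuous_onI) (auto intro!: continuous_intros simp: cis_conv_exp)
  have "(\<integral>\<^sup>+z. ennreal (indicator A z * (norm (taylor_coeff h k) * norm z ^ k)) \<partial>lborel)
      \<le> (\<integral>\<^sup>+z. (\<integral>\<^sup>+x. F (cis (2*pi*x) * z) * indicator {0..1} x \<partial>lborel) \<partial>lborel)"
  proof (intro nn_integral_mono)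
    fix z
    show "ennreal (indicator A z * (norm (taylor_coeff h k) * norm z ^ k))
        \<le> (\<integral>\<^sup>+x. F (cis (2*pi*x) * z) * indicator {0..1} x \<partial>lborel)"
    proof (cases "z \<in> A")
      case True
      then have "norm z < R" using AR by auto
      from taylor_coeff_norm_le_circle_mean[OF h this, of k] True
      show ?thesis by (simp add: F_def rot)
    qed auto
  qed
  also have "\<dots> = (\<integral>\<^sup>+x. (\<integral>\<^sup>+z. F (cis (2*pi*x) * z) * indicator {0..1} x \<partial>lborel) \<partial>lborel)"
    by (rule lborel_pair.Fubini') simp
  also have "\<dots> = (\<integral>\<^sup>+x. (\<integral>\<^sup>+z. F z \<partial>lborel) * indicator {0..1::real} x \<partial>lborel)"
    by (simp add: nn_integral_multc nn_integral_lborel_rotate)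
  also have "\<dots> = (\<integral>\<^sup>+z. F z \<partial>lborel)" by (simp add: nn_integral_cmult_indicator)
  finally show ?thesis by (simp add: F_def)
qed

lemma emeasure_lborel_ball_complex:
  "r \<ge> 0 \<Longrightarrow> emeasure lborel (ball (c::complex) r) = ennreal (pi * r\<^sup>2)"
  by (simp add: emeasure_ball eval_unit_ball_vol)

lemma norm_le_ball_mean:
  assumes h: "h holomorphic_on ball a r" and r: "r > 0"
  shows "ennreal (norm (h a) * (pi * r\<^sup>2)) \<le> (\<integral>\<^sup>+z. ennreal (indicator (ball a r) z * norm (h z)) \<partial>lborel)"
proof -
  define g where "g = (\<lambda>z. h (a + z))"
  have g: "g holomorphic_on ball 0 r"
    unfolding g_def by (rule holomorphic_on_compose_gen[OF _ h, unfolded o_def]) (auto intro!: holomorphic_intros simp: dist_norm)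
  have "ennreal (norm (h a) * (pi * r\<^sup>2)) = (\<integral>\<^sup>+z. ennreal (norm (h a)) * indicator (ball 0 r) (z::complex) \<partial>lborel)"
    using r by (simp add: nn_integral_cmult_indicator emeasure_lborel_ball_complex ennreal_mult')
  also have "\<dots> = (\<integral>\<^sup>+z. ennreal (indicator (ball 0 r) (z::complex) * (norm (taylor_coeff g 0) * norm z ^ 0)) \<partial>lborel)"
    by (intro nn_integral_cong) (auto simp: g_def taylor_coeff_def indicator_def)
  also have "\<dots> \<le> (\<integral>\<^sup>+z. ennreal (indicator (ball 0 r) z * norm (g z)) \<partial>lborel)"
    by (rule taylor_coeff_area_le[OF g]) (auto simp: norm_mult)
  also have "\<dots> = (\<integral>\<^sup>+z. ennreal (indicator (ball a r) (a + z) * norm (h (a + z))) \<partial>lborel)"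
    by (intro nn_integral_cong) (auto simp: g_def indicator_def dist_norm)
  also have "\<dots> = (\<integral>\<^sup>+z. ennreal (indicator (ball a r) z * norm (h z)) \<partial>lborel)"
    by (rule nn_integral_lborel_translate[OF borel_measurable_norm_indicator[OF h]]) auto
  finally show ?thesis .
qed

text \<open>A substitute for Hoelder's inequality: the optimal choice of \<open>l\<close> is made afterwards.\<close>

lemma le_add_powr:
  fixes x p l :: real
  assumes "p \<ge> 1" "l > 0" "x \<ge> 0"
  shows "x \<le> l + l powr (1 - p) * x powr p"
proof (cases "x \<le> l")
  case True
  then show ?thesis by (smt (verit) mult_nonneg_nonneg powr_ge_zero)
next
  case False
  then have x: "x > 0" using assms by auto
  have "x powr (1 - p) \<le> l powr (1 - p)"
    using False assms by (intro powr_mono2') auto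
  then have "x powr (1 - p) * x powr p \<le> l powr (1 - p) * x powr p"
    by (intro mult_right_mono) auto
  moreover have "x powr (1 - p) * x powr p = x" using x by (simp flip: powr_add)
  ultimately show ?thesis using assms by linarith
qed

lemma powr_norm_le_ball_mean_ge1:
  assumes p: "p \<ge> 1" and h: "h holomorphic_on ball a r" and r: "r > 0"
  shows "ennreal (norm (h a) powr p * r\<^sup>2)
    \<le> ennreal (2 powr p / pi) * (\<integral>\<^sup>+z. ennreal (indicator (ball a r) z * norm (h z) powr p) \<partial>lborel)"
    (is "_ \<le> _ * ?J")
proof (cases "?J = top \<or> h a = 0")
  case True
  then show ?thesis by (auto simp: ennreal_mult_top)
next
  case False
  then obtain J where J: "?J = ennreal J" "J \<ge> 0" by (cases ?J) auto
  define x where "x = norm (h a)"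
  \<comment> \<open>With this \<open>l\<close> the first term of \<open>le_add_powr\<close> is
    exactly half of the left-hand side and is absorbed there; the \<open>2 powr p\<close> of the
    constant is \<open>(x / l) powr p\<close>.\<close>
  define l where "l = x / 2"
  have x: "x > 0" using False by (simp add: x_def)
  then have l: "l > 0" by (simp add: l_def)
  have meas: "(\<lambda>z. ennreal (indicator (ball a r) z * norm (h z) powr p)) \<in> borel_measurable borel"
    by (rule borel_measurable_norm_powr_indicator[OF h]) auto
  have affine: "(\<integral>\<^sup>+z. ennreal l * indicator (ball a r) z + c * F z \<partial>lborel)
      = ennreal l * ennreal (pi * r\<^sup>2) + c * (\<integral>\<^sup>+z. F z \<partial>lborel)"
    if [measurable]: "F \<in> borel_measurable borel" for F :: "complex \<Rightarrow> ennreal" and c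
  proof -
    have [measurable]: "ball a r \<in> sets borel" by simp
    show ?thesis
      using r by (subst nn_integral_add) (simp_all add: nn_integral_cmult nn_integral_cmult_indicator
        emeasure_lborel_ball_complex)
  qed
  have "ennreal (x * (pi * r\<^sup>2)) \<le> (\<integral>\<^sup>+z. ennreal (indicator (ball a r) z * norm (h z)) \<partial>lborel)"
    unfolding x_def by (rule norm_le_ball_mean[OF h r])
  also have "\<dots> \<le> (\<integral>\<^sup>+z. ennreal l * indicator (ball a r) z
      + ennreal (l powr (1 - p)) * ennreal (indicator (ball a r) z * norm (h z) powr p) \<partial>lborel)"
    using le_add_powr[OF p l] l
    by (intro nn_integral_mono) (auto simp: indicator_def simp flip: ennreal_mult ennreal_plus intro!: ennreal_leI)
  also have "\<dots> = ennreal l * ennreal (pi * r\<^sup>2) + ennreal (l powr (1 - p)) * ?J"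
    using affine[OF meas] .
  also have "\<dots> = ennreal (l * (pi * r\<^sup>2) + l powr (1 - p) * J)"
    using J l by (simp add: ennreal_mult' ennreal_plus)
  finally have "x * (pi * r\<^sup>2) \<le> l * (pi * r\<^sup>2) + l powr (1 - p) * J"
    using J l by (subst (asm) ennreal_le_iff) (auto intro!: add_nonneg_nonneg)
  then have "l * (pi * r\<^sup>2) \<le> l powr (1 - p) * J" by (simp add: l_def field_simps)
  then have "l powr (p - 1) * (l * (pi * r\<^sup>2)) \<le> l powr (p - 1) * (l powr (1 - p) * J)"
    by (intro mult_left_mono) auto
  also have "l powr (p - 1) * (l powr (1 - p) * J) = J" using l by (simp flip: powr_add mult.assoc)
  also have "l powr (p - 1) * (l * (pi * r\<^sup>2)) = l powr p * (pi * r\<^sup>2)"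
    using l powr_add[of l "p-1" 1] by simp
  also have "l powr p = x powr p / 2 powr p" using x by (simp add: l_def powr_divide)
  finally have "x powr p * r\<^sup>2 \<le> 2 powr p / pi * J" by (simp add: field_simps)
  then show ?thesis unfolding J x_def using J by (simp flip: ennreal_mult add: ennreal_leI)
qed

text \<open>For \<open>p < 1\<close> the maximum of \<open>|h(z)| (\<rho> - |z - a|)\<^bsup>2/p\<^esup>\<close> over the ball of half the
  radius bounds itself through the mean value inequality with exponent 1.\<close>

lemma powr_norm_le_ball_mean_less1:
  assumes p: "0 < p" "p < 1" and h: "h holomorphic_on ball a r" and r: "r > 0"
  shows "ennreal (norm (h a) powr p * r\<^sup>2)
    \<le> ennreal (16 / pi * 4 powr ((1 - p) / p)) * (\<integral>\<^sup>+z. ennreal (indicator (ball a r) z * norm (h z) powr p) \<partial>lborel)"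
    (is "_ \<le> _ * ?J")
proof (cases "?J = top \<or> h a = 0")
  case True
  then show ?thesis by (auto simp: ennreal_mult_top)
next
  case False
  then obtain J where J: "?J = ennreal J" "J \<ge> 0" by (cases ?J) auto
  \<comment> \<open>Halving the radius makes \<open>h\<close> continuous on a closed ball, so that
    the maximum of \<open>\<phi>\<close> is attained.\<close>
  define \<rho> where "\<rho> = r / 2"
  have \<rho>: "\<rho> > 0" "\<rho> < r" using r by (auto simp: \<rho>_def)
  define \<phi> where "\<phi> = (\<lambda>z. norm (h z) * (\<rho> - dist z a) powr (2/p))"
  have "continuous_on (cball a \<rho>) h"
    using \<rho> by (intro holomorphic_on_imp_continuous_on holomorphic_on_subset[OF h]) auto
  then have "continuous_on (cball a \<rho>) \<phi>"
    unfolding \<phi>_def using p by (intro continuous_intros continuous_on_powr') (auto simp: dist_commute)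
  then obtain z0 where z0: "z0 \<in> cball a \<rho>" "\<And>z. z \<in> cball a \<rho> \<Longrightarrow> \<phi> z \<le> \<phi> z0"
    using continuous_attains_sup[of "cball a \<rho>" \<phi>] \<rho> by auto
  define S where "S = \<phi> z0"
  have Sa: "norm (h a) * \<rho> powr (2/p) \<le> S" using z0(2)[of a] \<rho> by (simp add: \<phi>_def S_def)
  then have S: "S > 0" using False \<rho> by (smt (verit) mult_pos_pos powr_gt_zero zero_less_norm_iff)
  define d where "d = \<rho> - dist z0 a"
  have d: "d > 0" using S z0(1) p by (cases "d = 0") (auto simp: d_def S_def \<phi>_def dist_commute)
  have Sd: "norm (h z0) = S * d powr (-2/p)"
    using d by (simp add: S_def \<phi>_def d_def[symmetric] mult.assoc flip: powr_add)
  \<comment> \<open>Points of \<open>ball z0 (d/2)\<close> keep at least distance \<open>d/2\<close>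
    from the sphere of radius \<open>\<rho>\<close>, so maximality of \<open>\<phi>\<close> at
    \<open>z0\<close> bounds \<open>|h|\<close> there by \<open>M\<close>. Then
    \<open>|h| \<le> M powr (1 - p) * |h| powr p\<close> trades exponent 1 for
    \<open>p\<close>.\<close>
  define M where "M = S * (d/2) powr (-2/p)"
  have M: "M > 0" using S d by (simp add: M_def)
  have sub: "ball z0 (d/2) \<subseteq> ball a r"
  proof
    fix z assume "z \<in> ball z0 (d/2)"
    then have "dist z a < r" using dist_triangle[of z a z0] d \<rho> by (auto simp: d_def dist_commute)
    then show "z \<in> ball a r" by (simp add: dist_commute)
  qed
  have hM: "norm (h z) \<le> M powr (1 - p) * norm (h z) powr p" if z: "z \<in> ball z0 (d/2)" for z
  proof (cases "h z = 0")
    case False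
    have dz: "\<rho> - dist z a \<ge> d/2"
      using z dist_triangle[of z a z0] by (auto simp: d_def dist_commute field_simps)
    have "norm (h z) * (d/2) powr (2/p) \<le> \<phi> z"
      unfolding \<phi>_def using dz d p by (intro mult_left_mono powr_mono2) auto
    also have "\<dots> \<le> S" using z0(2)[of z] dz d unfolding S_def by (simp add: dist_commute)
    finally have "norm (h z) * (d/2) powr (2/p) * (d/2) powr (-2/p) \<le> M"
      unfolding M_def by (intro mult_right_mono) auto
    then have "norm (h z) \<le> M" using d by (simp add: mult.assoc flip: powr_add)
    then have "norm (h z) powr (1 - p) * norm (h z) powr p \<le> M powr (1 - p) * norm (h z) powr p"
      using p by (intro mult_right_mono powr_mono2) auto
    then show ?thesis using False by (simp flip: powr_add)
  qed auto
  have meas: "(\<lambda>z. ennreal (indicator (ball a r) z * norm (h z) powr p)) \<in> borel_measurable borel"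
    by (rule borel_measurable_norm_powr_indicator[OF h]) auto
  have "ennreal (norm (h z0) * (pi * (d/2)\<^sup>2)) \<le> (\<integral>\<^sup>+z. ennreal (indicator (ball z0 (d/2)) z * norm (h z)) \<partial>lborel)"
    using d by (intro norm_le_ball_mean holomorphic_on_subset[OF h sub]) auto
  also have "\<dots> \<le> (\<integral>\<^sup>+z. ennreal (M powr (1 - p)) * ennreal (indicator (ball a r) z * norm (h z) powr p) \<partial>lborel)"
    using hM sub by (intro nn_integral_mono) (auto simp: indicator_def simp flip: ennreal_mult intro!: ennreal_leI)
  also have "\<dots> = ennreal (M powr (1 - p) * J)"
    using meas J by (simp add: nn_integral_cmult ennreal_mult')
  finally have "norm (h z0) * (pi * (d/2)\<^sup>2) \<le> M powr (1 - p) * J"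
    using J by (subst (asm) ennreal_le_iff) auto
  \<comment> \<open>The powers of \<open>d\<close> agree on both sides, as
    \<open>(-2/p) (1 - p) = -2/p + 2\<close>; this is what the exponent \<open>2/p\<close> in
    \<open>\<phi>\<close> is for. What remains is \<open>S\<close> against
    \<open>S powr (1 - p)\<close>, hence a bound on \<open>S powr p\<close>.\<close>
  then have *: "S * d powr (-2/p) * (pi * (d/2)\<^sup>2) \<le> (S * (d/2) powr (-2/p)) powr (1 - p) * J"
    by (simp add: Sd M_def)
  have e1: "(S * (d/2) powr (-2/p)) powr (1 - p) = S powr (1 - p) * (d/2) powr (-2/p + 2)"
  proof -
    have "-2/p * (1 - p) = -2/p + 2" using p by (simp add: field_simps)
    then show ?thesis using S d p by (simp only: powr_mult powr_powr)
  qed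
  have e2: "(d/2) powr (-2/p + 2) = (d/2) powr (-2/p) * (d/2)\<^sup>2"
    using d by (subst powr_add) simp
  have e3: "(d/2) powr (-2/p) = d powr (-2/p) * 2 powr (2/p)"
    using d by (simp add: powr_divide powr_minus field_simps)
  have e4: "2 powr (2/p) = 4 * 4 powr ((1 - p) / p)"
  proof -
    have "(4::real) powr ((1 - p) / p) * 4 powr 1 = 4 powr (1/p)"
      using p by (subst powr_add[symmetric]) (simp add: field_simps)
    also have "\<dots> = (2 powr 2) powr (1/p)" by simp
    also have "\<dots> = 2 powr (2/p)" by (simp only: powr_powr) simp
    finally show ?thesis by simp
  qed
  have "(d powr (-2/p) * (d/2)\<^sup>2) * (S * pi) \<le> (d powr (-2/p) * (d/2)\<^sup>2) * (S powr (1 - p) * 2 powr (2/p) * J)"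
    using * unfolding e1 e2 unfolding e3 by (simp add: mult_ac)
  then have "S * pi \<le> S powr (1 - p) * 2 powr (2/p) * J"
    using d by (subst (asm) mult_le_cancel_left_pos) auto
  then have "S powr (p - 1) * (S * pi) \<le> S powr (p - 1) * (S powr (1 - p) * (2 powr (2/p) * J))"
    by (intro mult_left_mono) (auto simp: mult_ac)
  also have "S powr (p - 1) * (S powr (1 - p) * (2 powr (2/p) * J)) = 2 powr (2/p) * J"
    using S by (simp flip: powr_add mult.assoc)
  also have "S powr (p - 1) * (S * pi) = S powr p * pi"
    using S powr_add[of S "p-1" 1] by simp
  finally have Sp: "S powr p \<le> 2 powr (2/p) / pi * J" by (simp add: field_simps)
  have "norm (h a) powr p * \<rho>\<^sup>2 = (norm (h a) * \<rho> powr (2/p)) powr p"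
    using p \<rho> by (simp add: powr_mult powr_powr)
  also have "\<dots> \<le> S powr p" using Sa p by (intro powr_mono2) auto
  finally have "norm (h a) powr p * r\<^sup>2 \<le> 4 * S powr p" by (simp add: \<rho>_def field_simps)
  also have "\<dots> \<le> 4 * (2 powr (2/p) / pi * J)" using Sp by simp
  also have "\<dots> = 16 / pi * 4 powr ((1 - p) / p) * J" unfolding e4 by simp
  finally have "norm (h a) powr p * r\<^sup>2 \<le> 16 / pi * 4 powr ((1 - p) / p) * J" .
  then show ?thesis unfolding J using J by (simp flip: ennreal_mult add: ennreal_leI)
qed

lemma powr_norm_le_ball_mean:
  assumes "p > 0"
  obtains C where "C > 0" "\<And>h a r. h holomorphic_on ball a r \<Longrightarrow> r > 0 \<Longrightarrow>
    ennreal (norm (h a) powr p * r\<^sup>2)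
    \<le> ennreal C * (\<integral>\<^sup>+z. ennreal (indicator (ball a r) z * norm (h z) powr p) \<partial>lborel)"
proof (cases "p \<ge> 1")
  case True
  show ?thesis using that[OF _ powr_norm_le_ball_mean_ge1[OF True]] by simp
next
  case False
  then show ?thesis using that[OF _ powr_norm_le_ball_mean_less1[OF assms]] by simp
qed

section \<open>Weighted area near the boundary\<close>

lemma ex_dyadic:
  fixes x :: real
  assumes "0 < x" "x \<le> 1"
  shows "\<exists>j::nat. 2 powr (- real j - 1) < x \<and> x \<le> 2 powr (- real j)"
proof -
  have "\<exists>j::nat. (1/2) ^ Suc j < x"
  proof -
    obtain n where "(1/2::real) ^ n < x" using real_arch_pow_inv[of x "1/2"] assms by auto
    moreover have "(1/2::real) ^ Suc n \<le> (1/2) ^ n" by simp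
    ultimately show ?thesis by (meson order_le_less_trans)
  qed
  define j where "j = (LEAST j. (1/2) ^ Suc j < x)"
  have j1: "(1/2) ^ Suc j < x" unfolding j_def by (rule LeastI_ex) fact
  have j2: "x \<le> (1/2) ^ j"
  proof (cases j)
    case (Suc i)
    then have "\<not> (1/2) ^ Suc i < x" using not_less_Least[of i "\<lambda>j. (1/2) ^ Suc j < x"] by (simp add: j_def)
    then show ?thesis using Suc by simp
  qed (use assms in simp)
  have "(1/2::real) ^ n = 2 powr (- real n)" for n
    by (simp add: powr_minus powr_realpow power_one_over field_simps)
  from this[of j] this[of "Suc j"] j1 j2 have "2 powr (- real (Suc j)) < x" "x \<le> 2 powr (- real j)"
    by (simp_all only:)
  moreover have "- real (Suc j) = - real j - 1" by simp
  ultimately show ?thesis by (intro exI[of _ j]) (simp only: simp_thms)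
qed

text \<open>Weights occur with exponents of either sign, hence the absolute value in the constant
  and comparability in both directions.\<close>

lemma powr_le_of_ratio:
  fixes x y K \<gamma> :: real
  assumes "x > 0" "y > 0" "K \<ge> 1" "y \<le> K * x" "x \<le> K * y"
  shows "x powr \<gamma> \<le> K powr \<bar>\<gamma>\<bar> * y powr \<gamma>"
proof (cases "\<gamma> \<ge> 0")
  case True
  then have "x powr \<gamma> \<le> (K * y) powr \<gamma>" using assms by (intro powr_mono2) auto
  then show ?thesis using True assms by (simp add: powr_mult)
next
  case False
  then have "x powr \<gamma> \<le> (y / K) powr \<gamma>" using assms by (intro powr_mono2') (auto simp: field_simps)
  then show ?thesis using False assms by (simp add: powr_divide powr_minus field_simps)
qed

text \<open>Each point only has to be covered by one piece, so the pieces of a dyadic decomposition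
  may overlap, as the tails and balls used below do.\<close>

lemma nn_integral_le_suminf:
  assumes "\<And>j::nat. G j \<in> borel_measurable M" "\<And>z. z \<in> space M \<Longrightarrow> \<exists>j. F z \<le> G j z"
  shows "(\<integral>\<^sup>+z. F z \<partial>M) \<le> (\<Sum>j. (\<integral>\<^sup>+z. G j z \<partial>M))"
proof -
  have "(\<integral>\<^sup>+z. F z \<partial>M) \<le> (\<integral>\<^sup>+z. (\<Sum>j. G j z) \<partial>M)"
  proof (intro nn_integral_mono)
    fix z assume "z \<in> space M"
    then obtain j where "F z \<le> G j z" using assms by blast
    also have "\<dots> \<le> (\<Sum>j. G j z)" using sum_le_suminf[of "\<lambda>j. G j z" "{j}"] by simp
    finally show "F z \<le> (\<Sum>j. G j z)" .
  qed
  also have "\<dots> = (\<Sum>j. (\<integral>\<^sup>+z. G j z \<partial>M))" using assms by (intro nn_integral_suminf)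
  finally show ?thesis .
qed

lemma emeasure_annulus:
  assumes "0 \<le> a" "a \<le> b"
  shows "emeasure lborel {z::complex. a \<le> norm z \<and> norm z < b} = ennreal (pi * (b\<^sup>2 - a\<^sup>2))"
proof -
  have "{z::complex. a \<le> norm z \<and> norm z < b} = ball 0 b - ball 0 a" by auto
  then have "emeasure lborel {z::complex. a \<le> norm z \<and> norm z < b} = emeasure lborel (ball (0::complex) b) - emeasure lborel (ball (0::complex) a)"
    using assms emeasure_lborel_ball_finite[of "0::complex" a] by (simp add: emeasure_Diff subset_ball less_top)
  also have "\<dots> = ennreal (pi * b\<^sup>2 - pi * a\<^sup>2)"
    using assms by (simp add: emeasure_lborel_ball_complex ennreal_minus)
  finally show ?thesis by (simp add: right_diff_distrib)
qed

lemma emeasure_annulus_le: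
  assumes "0 \<le> a" "a \<le> b" "b \<le> 1"
  shows "emeasure lborel {z::complex. a \<le> norm z \<and> norm z < b} \<le> ennreal (2 * pi * (b - a))"
proof -
  have "pi * ((b - a) * (b + a)) \<le> pi * ((b - a) * 2)" using assms by (intro mult_left_mono) auto
  then show ?thesis using assms by (auto simp: emeasure_annulus power2_eq_square algebra_simps intro!: ennreal_leI)
qed

lemma one_minus_norm_sq_bounds:
  fixes z :: complex
  assumes "norm z < 1"
  shows "1 - norm z \<le> 1 - (norm z)\<^sup>2" "1 - (norm z)\<^sup>2 \<le> 2 * (1 - norm z)" "0 < 1 - (norm z)\<^sup>2"
proof -
  have eq: "1 - (norm z)\<^sup>2 = (1 - norm z) * (1 + norm z)" by (simp add: power2_eq_square algebra_simps)
  show "1 - norm z \<le> 1 - (norm z)\<^sup>2" "1 - (norm z)\<^sup>2 \<le> 2 * (1 - norm z)" "0 < 1 - (norm z)\<^sup>2"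
    unfolding eq using assms mult_left_mono[of 1 "1 + norm z" "1 - norm z"] mult_left_mono[of "1 + norm z" 2 "1 - norm z"]
    by (auto intro!: mult_pos_pos simp: add_pos_nonneg)
qed

lemma two_powr_neg_mult: "(2::real) powr (- real j * c) = (2 powr (- c)) ^ j"
  by (simp add: powr_powr mult.commute flip: powr_realpow)

lemma borel_measurable_weight [measurable]:
  "(\<lambda>z::complex. (1 - (norm z)\<^sup>2) powr \<gamma>) \<in> borel_measurable borel"
  by simp

text \<open>Where \<open>1 - |z|\<close> is about \<open>r 2^(-j)\<close>, the weight is about
  \<open>(r 2^(-j)) powr \<gamma>\<close> and the area about \<open>r 2^(-j)\<close>. The resulting
  geometric series converges because \<open>\<gamma> + 1 > 0\<close>.\<close>

lemma weight_annulus_le: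
  assumes \<gamma>: "\<gamma> > -1"
  obtains C where "C > 0" "\<And>r. 0 < r \<Longrightarrow> r \<le> 1 \<Longrightarrow>
    (\<integral>\<^sup>+z. ennreal (indicator {z. 1 - r \<le> norm z \<and> norm z < 1} (z::complex) * (1 - (norm z)\<^sup>2) powr \<gamma>) \<partial>lborel)
     \<le> ennreal (C * r powr (\<gamma> + 1))"
proof
  define b where "b = (2::real) powr (- (\<gamma> + 1))"
  have b: "0 < b" "b < 1" using \<gamma> by (auto simp: b_def powr_less_one)
  define C where "C = 2 powr \<bar>\<gamma>\<bar> * pi * (1 / (1 - b))"
  show "C > 0" using b by (simp add: C_def)
  fix r :: real assume r: "0 < r" "r \<le> 1"
  define x where "x = (\<lambda>j. r * 2 powr (- real j))"
  have x: "x j > 0" "x j \<le> 1" "x (Suc j) = x j / 2" for j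
  proof -
    have "(2::real) powr (- real j) \<le> 2 powr 0" by (intro powr_mono) auto
    then show "x j > 0" "x j \<le> 1" using r by (auto simp: x_def intro: mult_le_one)
    have "- real j = - real (Suc j) + 1" by simp
    then have "(2::real) powr (- real j) = 2 powr (- real (Suc j)) * 2 powr 1"
      by (simp only: powr_add)
    then show "x (Suc j) = x j / 2" by (simp add: x_def)
  qed
  define A where "A = (\<lambda>j. {z::complex. 1 - x j \<le> norm z \<and> norm z < 1 - x j / 2})"
  have A: "A j \<in> sets borel" for j unfolding A_def by measurable
  define c where "c = (\<lambda>j. 2 powr \<bar>\<gamma>\<bar> * x j powr \<gamma>)"
  have "(\<integral>\<^sup>+z. ennreal (indicator {z. 1 - r \<le> norm z \<and> norm z < 1} (z::complex) * (1 - (norm z)\<^sup>2) powr \<gamma>) \<partial>lborel)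
    \<le> (\<Sum>j. (\<integral>\<^sup>+z. ennreal (c j) * indicator (A j) z \<partial>lborel))"
  proof (intro nn_integral_le_suminf)
    fix z :: complex
    show "\<exists>j. ennreal (indicator {z. 1 - r \<le> norm z \<and> norm z < 1} z * (1 - (norm z)\<^sup>2) powr \<gamma>)
      \<le> ennreal (c j) * indicator (A j) z"
    proof (cases "1 - r \<le> norm z \<and> norm z < 1")
      case True
      then have "0 < (1 - norm z) / r" "(1 - norm z) / r \<le> 1" using r by (auto simp: field_simps)
      from ex_dyadic[OF this] obtain j where j: "2 powr (- real j - 1) < (1 - norm z) / r"
        "(1 - norm z) / r \<le> 2 powr (- real j)" by blast
      then have j': "x j / 2 < 1 - norm z" "1 - norm z \<le> x j"
        using r by (auto simp: x_def field_simps powr_diff)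
      have "(1 - (norm z)\<^sup>2) powr \<gamma> \<le> c j"
        unfolding c_def using one_minus_norm_sq_bounds[of z] True j' x(1)[of j]
        by (intro powr_le_of_ratio) auto
      moreover have "z \<in> A j" using j' by (auto simp: A_def)
      ultimately show ?thesis using True by (intro exI[of _ j]) (auto intro: ennreal_leI)
    qed auto
  qed (use A in simp)
  also have "\<dots> = (\<Sum>j. ennreal (c j) * emeasure lborel (A j))"
    using A by (simp add: nn_integral_cmult_indicator)
  also have "\<dots> \<le> (\<Sum>j. ennreal (2 powr \<bar>\<gamma>\<bar> * pi * r powr (\<gamma> + 1) * b ^ j))"
  proof (intro suminf_le)
    fix j
    have "emeasure lborel (A j) \<le> ennreal (2 * pi * ((1 - x j / 2) - (1 - x j)))"
      unfolding A_def using x[of j] by (intro emeasure_annulus_le) auto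
    then have "ennreal (c j) * emeasure lborel (A j) \<le> ennreal (c j) * ennreal (pi * x j)"
      by (intro mult_left_mono) auto
    also have "\<dots> = ennreal (2 powr \<bar>\<gamma>\<bar> * pi * x j powr (\<gamma> + 1))"
      using x(1)[of j] by (simp add: c_def powr_add mult_ac flip: ennreal_mult)
    also have "x j powr (\<gamma> + 1) = r powr (\<gamma> + 1) * b ^ j"
      unfolding b_def two_powr_neg_mult[symmetric] x_def using r by (simp add: powr_mult powr_powr)
    finally show "ennreal (c j) * emeasure lborel (A j) \<le> ennreal (2 powr \<bar>\<gamma>\<bar> * pi * r powr (\<gamma> + 1) * b ^ j)"
      by (simp add: mult_ac)
  qed auto
  also have "\<dots> = ennreal (\<Sum>j. 2 powr \<bar>\<gamma>\<bar> * pi * r powr (\<gamma> + 1) * b ^ j)"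
    using b by (intro suminf_ennreal2) (auto intro!: summable_mult)
  also have "\<dots> = ennreal (C * r powr (\<gamma> + 1))"
    using b by (subst suminf_mult) (auto simp: suminf_geometric C_def mult_ac)
  finally show "(\<integral>\<^sup>+z. ennreal (indicator {z. 1 - r \<le> norm z \<and> norm z < 1} (z::complex) * (1 - (norm z)\<^sup>2) powr \<gamma>) \<partial>lborel)
     \<le> ennreal (C * r powr (\<gamma> + 1))" .
qed

text \<open>The angles lie in \<open>[0, 1]\<close>, inside \<open>[0, pi/3]\<close>, where the
  cosine is at least 1/2. The imaginary parts alone then separate the two points.\<close>

lemma norm_cis_diff_ge:
  assumes "a \<in> {0..1}" "b \<in> {0..1}"
  shows "norm (cis a - cis b) \<ge> \<bar>a - b\<bar> / 2"
proof -
  have *: "sin y - sin x \<ge> (y - x) / 2" if xy: "0 \<le> x" "x < y" "y \<le> 1" for x y :: real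
  proof -
    obtain z where z: "x < z" "z < y" "sin y - sin x = (y - x) * cos z"
      using MVT2[OF xy(2), of sin cos] DERIV_sin by blast
    have "cos z \<ge> cos (pi / 3)" using z xy pi_gt3 by (intro cos_monotone_0_pi_le) auto
    then show ?thesis using z xy mult_left_mono[of "1/2" "cos z" "y - x"] by (simp add: cos_60)
  qed
  have "\<bar>sin a - sin b\<bar> \<ge> \<bar>a - b\<bar> / 2"
    using *[of a b] *[of b a] assms by (cases a b rule: linorder_cases) auto
  moreover have "\<bar>Im (cis a - cis b)\<bar> \<le> norm (cis a - cis b)" by (rule abs_Im_le_cmod)
  ultimately show ?thesis by simp
qed

text \<open>About \<open>1/r\<close> disjoint rotates of the region near 1 fit into the annulus of width \<open>r\<close>.\<close>

lemma weight_near_one_le: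
  assumes \<gamma>: "\<gamma> > -1"
  obtains C where "C > 0" "\<And>r. 0 < r \<Longrightarrow>
    (\<integral>\<^sup>+z. ennreal (indicator (ball 0 1 \<inter> ball 1 r) (z::complex) * (1 - (norm z)\<^sup>2) powr \<gamma>) \<partial>lborel)
     \<le> ennreal (C * r powr (\<gamma> + 2))"
proof -
  obtain C where C: "C > 0" "\<And>r. 0 < r \<Longrightarrow> r \<le> 1 \<Longrightarrow>
    (\<integral>\<^sup>+z. ennreal (indicator {z. 1 - r \<le> norm z \<and> norm z < 1} (z::complex) * (1 - (norm z)\<^sup>2) powr \<gamma>) \<partial>lborel)
     \<le> ennreal (C * r powr (\<gamma> + 1))" using weight_annulus_le[OF \<gamma>] by blast
  define C' where "C' = max (8 powr (\<gamma> + 2) * C) (8 * C)"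
  define W where "W = (\<lambda>z::complex. (1 - (norm z)\<^sup>2) powr \<gamma>)"
  have [measurable]: "W \<in> borel_measurable borel" by (simp add: W_def)
  have W: "W z \<ge> 0" for z by (simp add: W_def)
  have main: "(\<integral>\<^sup>+z. ennreal (indicator (ball 0 1 \<inter> ball 1 r) z * W z) \<partial>lborel)
     \<le> ennreal (C' * r powr (\<gamma> + 2))" if r: "r > 0" for r
  \<comment> \<open>For \<open>r \<ge> 1/8\<close> the mass of the whole disc is an admissible
    bound, since \<open>(8 * r) powr (\<gamma> + 2)\<close> is then at least 1.\<close>
  proof (cases "r < 1/8")
    case False
    have "(\<integral>\<^sup>+z. ennreal (indicator (ball 0 1 \<inter> ball 1 r) z * W z) \<partial>lborel)
      \<le> (\<integral>\<^sup>+z. ennreal (indicator {z. 1 - 1 \<le> norm z \<and> norm z < 1} z * W z) \<partial>lborel)"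
      using W by (intro nn_integral_mono ennreal_leI) (auto simp: indicator_def)
    also have "\<dots> \<le> ennreal C" using C(2)[of 1] by (simp add: W_def)
    also have "C \<le> C' * r powr (\<gamma> + 2)"
    proof -
      have "1 \<le> (8 * r) powr (\<gamma> + 2)" using False \<gamma> by (intro ge_one_powr_ge_zero) auto
      then have "C * 1 \<le> C * (8 * r) powr (\<gamma> + 2)" using C(1) by (intro mult_left_mono) auto
      also have "\<dots> = (8 powr (\<gamma> + 2) * C) * r powr (\<gamma> + 2)" using r by (simp add: powr_mult)
      also have "\<dots> \<le> C' * r powr (\<gamma> + 2)" by (intro mult_right_mono) (auto simp: C'_def)
      finally show ?thesis by simp
    qed
    finally show ?thesis by (simp add: ennreal_leI)
  next
    case True
    \<comment> \<open>Angles are spaced by \<open>4 * r\<close>: distinct centres are then at least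
      \<open>2 * r\<close> apart by \<open>norm_cis_diff_ge\<close>, so their balls of radius
      \<open>r\<close> are disjoint, and \<open>N\<close> of them keep the angle within
      \<open>[0, 1]\<close>. As \<open>1 / (4 * r) \<ge> 2\<close>, the floor loses at most a factor
      2.\<close>
    define N where "N = nat \<lfloor>1 / (4 * r)\<rfloor>"
    have t: "1 / (4 * r) \<ge> 2" using True r by (simp add: field_simps)
    have N: "real N \<le> 1 / (4 * r)" "real N \<ge> 1 / (8 * r)"
    proof -
      have "real N = real_of_int \<lfloor>1 / (4 * r)\<rfloor>"
        using t unfolding N_def by (intro of_nat_nat) linarith
      then show "real N \<le> 1 / (4 * r)" "real N \<ge> 1 / (8 * r)" using t by linarith+
    qed
    define u where "u = (\<lambda>k::nat. cis (4 * r * real k))"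
    define D where "D = (\<lambda>v. ball 0 1 \<inter> ball v r :: complex set)"
    have [measurable]: "D v \<in> sets borel" for v by (auto simp: D_def)
    define X where "X = (\<integral>\<^sup>+z. ennreal (indicator (D 1) z * W z) \<partial>lborel)"
    have rot: "(\<integral>\<^sup>+z. ennreal (indicator (D (u k)) z * W z) \<partial>lborel) = X" for k
    proof -
      have "norm (u k) = 1" by (simp add: u_def)
      then have "(\<integral>\<^sup>+z. ennreal (indicator (D (u k)) z * W z) \<partial>lborel) = (\<integral>\<^sup>+z. ennreal (indicator (D (u k)) (u k * z) * W (u k * z)) \<partial>lborel)"
        by (intro nn_integral_lborel_rotate[symmetric]) auto
      moreover have "indicator (D (u k)) (u k * z) * W (u k * z) = indicator (D 1) z * W z" for z
      proof -
        have "dist (u k) (u k * z) = norm (u k * (1 - z))" by (simp add: dist_norm algebra_simps)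
        also have "\<dots> = dist 1 z" using \<open>norm (u k) = 1\<close> by (simp add: norm_mult dist_norm)
        finally show ?thesis using \<open>norm (u k) = 1\<close> by (auto simp: indicator_def D_def W_def norm_mult)
      qed
      ultimately show ?thesis by (simp add: X_def)
    qed
    have ang: "4 * r * real k \<in> {0..1}" if "k < N" for k
    proof -
      have "real k \<le> 1 / (4 * r)" using that N(1) by linarith
      then show ?thesis using r by (simp add: field_simps)
    qed
    have disj: "k = l" if kl: "k < N" "l < N" "z \<in> D (u k)" "z \<in> D (u l)" for k l z
    proof (rule ccontr)
      assume "k \<noteq> l"
      have "norm (u k - u l) \<ge> \<bar>4 * r * real k - 4 * r * real l\<bar> / 2"
        unfolding u_def using kl ang by (intro norm_cis_diff_ge) auto
      moreover have "\<bar>4 * r * real k - 4 * r * real l\<bar> = 4 * r * \<bar>real k - real l\<bar>"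
        using r by (simp add: abs_mult flip: right_diff_distrib)
      moreover have "\<bar>real k - real l\<bar> \<ge> 1" using \<open>k \<noteq> l\<close> by linarith
      then have "4 * r * 1 \<le> 4 * r * \<bar>real k - real l\<bar>" using r by (intro mult_left_mono) auto
      ultimately have "norm (u k - u l) \<ge> 2 * r" by simp
      moreover have "norm (u k - u l) < 2 * r"
        using kl dist_triangle2[of "u k" "u l" z] by (auto simp: D_def dist_norm)
      ultimately show False by simp
    qed
    have "of_nat N * X = (\<Sum>k<N. (\<integral>\<^sup>+z. ennreal (indicator (D (u k)) z * W z) \<partial>lborel))"
      by (simp add: rot)
    also have "\<dots> = (\<integral>\<^sup>+z. (\<Sum>k<N. ennreal (indicator (D (u k)) z * W z)) \<partial>lborel)"
      by (intro nn_integral_sum[symmetric]) simp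
    also have "\<dots> \<le> (\<integral>\<^sup>+z. ennreal (indicator {z. 1 - r \<le> norm z \<and> norm z < 1} z * W z) \<partial>lborel)"
    proof (intro nn_integral_mono)
      fix z
      show "(\<Sum>k<N. ennreal (indicator (D (u k)) z * W z)) \<le> ennreal (indicator {z. 1 - r \<le> norm z \<and> norm z < 1} z * W z)"
      proof (cases "\<exists>k<N. z \<in> D (u k)")
        case True
        then obtain k where k: "k < N" "z \<in> D (u k)" by blast
        have "(\<Sum>i<N. ennreal (indicator (D (u i)) z * W z)) = (\<Sum>i<N. if i = k then ennreal (W z) else 0)"
          using disj k by (intro sum.cong) (auto simp: indicator_def)
        also have "\<dots> = ennreal (W z)" using k by simp
        finally show ?thesis using k norm_triangle_ineq2[of "u k" z]
          by (auto simp: D_def dist_norm u_def)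
      qed (auto simp: indicator_def)
    qed
    also have "\<dots> \<le> ennreal (C * r powr (\<gamma> + 1))" unfolding W_def using C(2)[of r] True r by auto
    finally have NX: "of_nat N * X \<le> ennreal (C * r powr (\<gamma> + 1))" .
    have Npos: "N > 0" using N(2) r by (cases N) (auto simp: field_simps)
    \<comment> \<open>Finiteness has to precede the division by \<open>N\<close>: with
      \<open>N > 0\<close> an infinite \<open>X\<close> would contradict \<open>NX\<close>.\<close>
    have "X \<noteq> top"
    proof
      assume "X = top"
      then show False using NX Npos by (auto simp: ennreal_mult_top top_unique)
    qed
    then obtain x where x: "X = ennreal x" "x \<ge> 0" by (cases X) auto
    have "real N * x \<le> C * r powr (\<gamma> + 1)"
      using NX x C(1) by (simp add: ennreal_of_nat_eq_real_of_nat flip: ennreal_mult)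
    moreover have "1 / (8 * r) * x \<le> real N * x" using N x by (intro mult_right_mono)
    ultimately have "1 / (8 * r) * x \<le> C * r powr (\<gamma> + 1)" by linarith
    then have "x \<le> 8 * C * (r powr (\<gamma> + 1) * r)" using r by (simp add: field_simps)
    also have "r powr (\<gamma> + 1) * r = r powr (\<gamma> + 2)" using r powr_add[of r "\<gamma> + 1" 1] by (simp add: add.commute)
    also have "8 * C * r powr (\<gamma> + 2) \<le> C' * r powr (\<gamma> + 2)" by (intro mult_right_mono) (auto simp: C'_def)
    finally show ?thesis using x by (simp add: X_def D_def ennreal_leI)
  qed
  have "C' > 0" using C(1) by (simp add: C'_def less_max_iff_disj)
  then show ?thesis using that[of C'] main by (simp add: W_def)
qed

section \<open>Convolution on the natural numbers\<close>

text \<open>On \<open>nat\<close>, \<open>(m - j) + (j - m)\<close> is the distance \<open>|m - j|\<close>.\<close>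

definition dist_kernel :: "real \<Rightarrow> nat \<Rightarrow> nat \<Rightarrow> real" where
  "dist_kernel b m j = b ^ ((m - j) + (j - m))"

lemma dist_kernel_commute: "dist_kernel b m j = dist_kernel b j m"
  by (simp add: dist_kernel_def add.commute)

lemma dist_kernel_pos: "b > 0 \<Longrightarrow> dist_kernel b m j > 0"
  by (simp add: dist_kernel_def)

lemma sum_dist_kernel_le:
  assumes b: "0 < b" "b < 1"
  shows "(\<Sum>j<n. dist_kernel b m j) \<le> 2 / (1 - b)"
proof -
  have geo: "(\<Sum>i<k. b ^ i) \<le> 1 / (1 - b)" for k
    using b by (simp add: sum_gp_strict divide_right_mono)
  have "(\<Sum>j<n. dist_kernel b m j) \<le> (\<Sum>j<n. (if j < m then b ^ (m - j) else 0) + (if m \<le> j then b ^ (j - m) else 0))"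
    by (intro sum_mono) (auto simp: dist_kernel_def)
  also have "\<dots> = (\<Sum>j\<in>{..<n} \<inter> {..<m}. b ^ (m - j)) + (\<Sum>j\<in>{..<n} \<inter> {m..}. b ^ (j - m))"
    by (simp add: sum.distrib sum.inter_restrict)
  also have "\<dots> \<le> 1 / (1 - b) + 1 / (1 - b)"
  proof (rule add_mono)
    have "(\<Sum>j\<in>{..<n} \<inter> {..<m}. b ^ (m - j)) \<le> (\<Sum>j<m. b ^ (m - j))"
      using b by (intro sum_mono2) auto
    also have "(\<Sum>j<m. b ^ (m - j)) = (\<Sum>i<m. b ^ Suc i)"
      by (subst sum.nat_diff_reindex[symmetric]) (auto intro!: sum.cong)
    also have "\<dots> \<le> (\<Sum>i<m. b ^ i)" using b by (intro sum_mono) (auto simp: mult_left_le_one_le)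
    also have "\<dots> \<le> 1 / (1 - b)" by (rule geo)
    finally show "(\<Sum>j\<in>{..<n} \<inter> {..<m}. b ^ (m - j)) \<le> 1 / (1 - b)" .
    have "(\<Sum>j\<in>{..<n} \<inter> {m..}. b ^ (j - m)) \<le> (\<Sum>j\<in>{m..<m+n}. b ^ (j - m))"
      using b by (intro sum_mono2) auto
    also have "\<dots> = (\<Sum>i<n. b ^ i)"
      using sum.shift_bounds_nat_ivl[of "\<lambda>j. b ^ (j - m)" 0 m n] by (simp add: atLeast0LessThan add.commute)
    also have "\<dots> \<le> 1 / (1 - b)" by (rule geo)
    finally show "(\<Sum>j\<in>{..<n} \<inter> {m..}. b ^ (j - m)) \<le> 1 / (1 - b)" .
  qed
  finally show ?thesis by simp
qed

lemma summable_powr_imp_bounded: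
  fixes v :: "nat \<Rightarrow> real"
  assumes "q > 0" "\<And>j. v j \<ge> 0" "summable (\<lambda>j. v j powr q)"
  shows "v j \<le> (\<Sum>j. v j powr q) powr (1 / q)"
proof -
  have "v j powr q \<le> (\<Sum>j. v j powr q)"
    using sum_le_suminf[OF assms(3), of "{j}"] by simp
  then have "(v j powr q) powr (1 / q) \<le> (\<Sum>j. v j powr q) powr (1 / q)"
    using assms by (intro powr_mono2) auto
  then show ?thesis using assms by (simp add: powr_powr)
qed

lemma summable_dist_kernel:
  assumes b: "0 < b" "b < 1"
  shows "summable (dist_kernel b m)" "(\<Sum>j. dist_kernel b m j) \<le> 2 / (1 - b)"
proof -
  show s: "summable (dist_kernel b m)"
    using summableI_nonneg_bounded[of "dist_kernel b m" "2 / (1 - b)"] sum_dist_kernel_le[OF b]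
      dist_kernel_pos[OF b(1)] by (auto simp: less_imp_le)
  show "(\<Sum>j. dist_kernel b m j) \<le> 2 / (1 - b)"
    using sum_dist_kernel_le[OF b] by (intro suminf_le_const s) auto
qed

text \<open>Young's inequality for a summable kernel, with \<open>le_add_powr\<close> in the place
  of Jensen. First \<open>S m powr q\<close> is bounded by the kernel average \<open>W m\<close> of
  \<open>v powr q\<close>; then the sum over \<open>m\<close> is taken inside, where symmetry of the
  kernel gives the bound \<open>K\<close> again.\<close>

lemma dist_kernel_convolution:
  fixes v :: "nat \<Rightarrow> real"
  assumes b: "0 < b" "b < 1" and q: "q \<ge> 1" and v: "\<And>j. v j \<ge> 0" and sv: "summable (\<lambda>j. v j powr q)"
  defines "S \<equiv> \<lambda>m. \<Sum>j. dist_kernel b m j * v j"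
  shows "summable (\<lambda>j. dist_kernel b m j * v j)"
    and "summable (\<lambda>m. S m powr q)"
    and "(\<Sum>m. S m powr q) \<le> (4 / (1 - b)) powr q * (\<Sum>j. v j powr q)"
proof -
  define K where "K = 2 / (1 - b)"
  have K: "K > 0" using b by (simp add: K_def)
  note pos = dist_kernel_pos[OF b(1)]
  have bdd: "summable (\<lambda>j. dist_kernel b m j * w j)" if "\<And>j. 0 \<le> w j" "\<And>j. w j \<le> B" for m B and w :: "nat \<Rightarrow> real"
  proof (rule summable_comparison_test')
    show "summable (\<lambda>j. dist_kernel b m j * B)" by (intro summable_mult2 summable_dist_kernel b)
    show "norm (dist_kernel b m j * w j) \<le> dist_kernel b m j * B" if "j \<ge> 0" for j
      using that \<open>\<And>j. 0 \<le> w j\<close> \<open>\<And>j. w j \<le> B\<close> pos[of m j] by (simp add: abs_mult)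
  qed
  show s1: "summable (\<lambda>j. dist_kernel b m j * v j)" for m
    using summable_powr_imp_bounded[OF _ v sv] q v by (intro bdd) auto
  define W where "W = (\<lambda>m. \<Sum>j. dist_kernel b m j * v j powr q)"
  have s2: "summable (\<lambda>j. dist_kernel b m j * v j powr q)" for m
    using sum_le_suminf[OF sv, of "{_}"] by (intro bdd[where B = "\<Sum>j. v j powr q"]) auto
  have S0: "S m \<ge> 0" for m unfolding S_def using s1 pos v by (intro suminf_nonneg) (auto simp: less_imp_le)
  have S: "S m powr q \<le> (2 * K) powr q / K * W m" for m
  proof (cases "S m = 0")
    case True
    have "W m \<ge> 0" unfolding W_def using s2 pos by (intro suminf_nonneg) (auto simp: less_imp_le)
    then show ?thesis using True K by simp
  next
    case False
    \<comment> \<open>The total kernel mass is at most \<open>K\<close>, so this \<open>l\<close>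
      makes the constant term \<open>K * l\<close> equal to half of \<open>S m\<close>, which is
      absorbed.\<close>
    define l where "l = S m / (2 * K)"
    have l: "l > 0" using False S0[of m] K by (simp add: l_def)
    have s3: "summable (\<lambda>j. dist_kernel b m j * l + l powr (1 - q) * (dist_kernel b m j * v j powr q))"
      by (intro summable_add summable_mult summable_mult2 s2 summable_dist_kernel[OF b])
    have "S m \<le> (\<Sum>j. dist_kernel b m j * l + l powr (1 - q) * (dist_kernel b m j * v j powr q))"
      unfolding S_def
    proof (intro suminf_le s1 s3)
      fix j
      have "dist_kernel b m j * v j \<le> dist_kernel b m j * (l + l powr (1 - q) * v j powr q)"
        using le_add_powr[OF q l v] pos[of m j] by (intro mult_left_mono) auto
      then show "dist_kernel b m j * v j \<le> dist_kernel b m j * l + l powr (1 - q) * (dist_kernel b m j * v j powr q)"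
        by (simp add: algebra_simps)
    qed
    also have "\<dots> = (\<Sum>j. dist_kernel b m j) * l + l powr (1 - q) * W m"
      unfolding W_def using summable_dist_kernel[OF b] s2
      by (subst suminf_add[symmetric]) (auto intro!: summable_mult summable_mult2 simp: suminf_mult suminf_mult2)
    also have "\<dots> \<le> K * l + l powr (1 - q) * W m"
      using mult_right_mono[OF summable_dist_kernel(2)[OF b, of m], of l] l by (simp add: K_def)
    also have "K * l = S m / 2" using K by (simp add: l_def)
    finally have "K * l \<le> l powr (1 - q) * W m" using K by (simp add: l_def)
    then have "l powr (q - 1) * (K * l) \<le> l powr (q - 1) * (l powr (1 - q) * W m)"
      by (intro mult_left_mono) auto
    also have "l powr (q - 1) * (l powr (1 - q) * W m) = W m" using l by (simp flip: powr_add mult.assoc)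
    also have "l powr (q - 1) * (K * l) = K * l powr q" using l powr_add[of l "q - 1" 1] by simp
    also have "l powr q = S m powr q / (2 * K) powr q" using S0 K by (simp add: l_def powr_divide)
    finally show ?thesis using K by (simp add: field_simps)
  qed
  \<comment> \<open>Partial sums over \<open>m\<close> reduce the exchange to a finite sum of
    series; summability in \<open>m\<close> then follows from the uniform bound.\<close>
  have bound: "(\<Sum>m<M. S m powr q) \<le> (4 / (1 - b)) powr q * (\<Sum>j. v j powr q)" for M
  proof -
    have "(\<Sum>m<M. S m powr q) \<le> (\<Sum>m<M. (2 * K) powr q / K * W m)" by (intro sum_mono S)
    also have "\<dots> = (2 * K) powr q / K * (\<Sum>m<M. W m)" by (simp add: sum_distrib_left)
    also have "\<dots> \<le> (2 * K) powr q / K * (K * (\<Sum>j. v j powr q))"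
    proof (intro mult_left_mono)
      have "(\<Sum>m<M. W m) = (\<Sum>j. (\<Sum>m<M. dist_kernel b m j * v j powr q))"
        unfolding W_def by (rule suminf_sum[symmetric]) (rule s2)
      also have "\<dots> \<le> (\<Sum>j. K * v j powr q)"
      proof (intro suminf_le summable_mult sv summable_sum s2)
        fix j
        have "(\<Sum>m<M. dist_kernel b m j * v j powr q) = (\<Sum>m<M. dist_kernel b j m) * v j powr q"
          by (simp add: sum_distrib_right dist_kernel_commute[of b _ j])
        also have "\<dots> \<le> K * v j powr q"
          unfolding K_def by (intro mult_right_mono sum_dist_kernel_le[OF b]) auto
        finally show "(\<Sum>m<M. dist_kernel b m j * v j powr q) \<le> K * v j powr q" .
      qed
      also have "\<dots> = K * (\<Sum>j. v j powr q)" using sv by (rule suminf_mult)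
      finally show "(\<Sum>m<M. W m) \<le> K * (\<Sum>j. v j powr q)" .
    qed (use K in simp)
    also have "\<dots> = (4 / (1 - b)) powr q * (\<Sum>j. v j powr q)" using K by (simp add: K_def)
    finally show ?thesis .
  qed
  show s4: "summable (\<lambda>m. S m powr q)" using bound by (intro summableI_nonneg_bounded) auto
  show "(\<Sum>m. S m powr q) \<le> (4 / (1 - b)) powr q * (\<Sum>j. v j powr q)"
    using bound by (intro suminf_le_const s4)
qed

section \<open>Dyadic estimates in Bergman and Dirichlet spaces\<close>

lemma borel_measurable_bergman:
  assumes "h holomorphic_on ball 0 1" "A \<subseteq> ball 0 1" "A \<in> sets borel"
  shows "(\<lambda>z. ennreal (indicator A z * (norm (h z) powr p * (1 - (norm z)\<^sup>2) powr \<alpha> / pi))) \<in> borel_measurable borel"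
proof -
  have [measurable]: "(\<lambda>z. ennreal (indicator A z * norm (h z) powr p)) \<in> borel_measurable borel"
    by (intro borel_measurable_norm_powr_indicator holomorphic_on_subset[OF assms(1)] assms)
  have "(\<lambda>z. ennreal (indicator A z * (norm (h z) powr p * (1 - (norm z)\<^sup>2) powr \<alpha> / pi)))
    = (\<lambda>z. ennreal (indicator A z * norm (h z) powr p) * ennreal ((1 - (norm z)\<^sup>2) powr \<alpha> / pi))"
    by (simp add: fun_eq_iff flip: ennreal_mult)
  then show ?thesis by simp
qed

text \<open>The weight is nearly constant on this ball: with \<open>y = 1 - |a|\<close>, the
  quantity \<open>1 - |z|^2\<close> lies between \<open>y/2\<close> and \<open>3 y\<close>. The
  unweighted inequality may therefore be multiplied by \<open>y powr \<alpha>\<close>.\<close>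

lemma weighted_ball_mean:
  assumes p: "p > 0"
  obtains C where "C > 0" "\<And>h a. h holomorphic_on ball 0 1 \<Longrightarrow> norm a < 1 \<Longrightarrow>
    ennreal (norm (h a) powr p * (1 - norm a) powr (\<alpha> + 2))
    \<le> ennreal C * (\<integral>\<^sup>+z. ennreal (indicator (ball a ((1 - norm a) / 2)) z * (norm (h z) powr p * (1 - (norm z)\<^sup>2) powr \<alpha> / pi)) \<partial>lborel)"
proof -
  obtain C0 where C0: "C0 > 0" "\<And>h a r. h holomorphic_on ball a r \<Longrightarrow> r > 0 \<Longrightarrow>
    ennreal (norm (h a) powr p * r\<^sup>2)
    \<le> ennreal C0 * (\<integral>\<^sup>+z. ennreal (indicator (ball a r) z * norm (h z) powr p) \<partial>lborel)"
    using powr_norm_le_ball_mean[OF p] by blast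
  \<comment> \<open>The 4 comes from \<open>y^2 = 4 (y/2)^2\<close>, \<open>pi\<close> from the
    normalisation of area, and 6 is a safe ratio between \<open>1 - |z|^2\<close> and
    \<open>y\<close>.\<close>
  define C where "C = C0 * (4 * 6 powr \<bar>\<alpha>\<bar> * pi)"
  have "C > 0" using C0 by (simp add: C_def)
  moreover have "ennreal (norm (h a) powr p * (1 - norm a) powr (\<alpha> + 2))
    \<le> ennreal C * (\<integral>\<^sup>+z. ennreal (indicator (ball a ((1 - norm a) / 2)) z * (norm (h z) powr p * (1 - (norm z)\<^sup>2) powr \<alpha> / pi)) \<partial>lborel)"
    if h: "h holomorphic_on ball 0 1" and a: "norm a < 1" for h a
  proof -
    define y where "y = 1 - norm a"
    have y: "y > 0" using a by (simp add: y_def)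
    have nz: "y / 2 < 1 - norm z \<and> 1 - norm z < 3 * y / 2" if "z \<in> ball a (y / 2)" for z
      using that norm_triangle_ineq2[of z a] norm_triangle_ineq2[of a z]
      by (auto simp: y_def dist_norm norm_minus_commute field_simps)
    have sub: "ball a (y / 2) \<subseteq> ball 0 1" using nz y by force
    note meas = borel_measurable_bergman[OF h sub, of p \<alpha>] borel_measurable_norm_powr_indicator[OF holomorphic_on_subset[OF h sub], of p]
    have ya: "y powr (\<alpha> + 2) = 4 * y powr \<alpha> * (y/2)\<^sup>2" using y by (simp add: powr_add power2_eq_square)
    have "ennreal (norm (h a) powr p * y powr (\<alpha> + 2)) = ennreal (4 * y powr \<alpha>) * ennreal (norm (h a) powr p * (y/2)\<^sup>2)"
      unfolding ya by (simp add: mult_ac flip: ennreal_mult)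
    also have "\<dots> \<le> ennreal (4 * y powr \<alpha>) * (ennreal C0 * (\<integral>\<^sup>+z. ennreal (indicator (ball a (y/2)) z * norm (h z) powr p) \<partial>lborel))"
      using y by (intro mult_left_mono C0(2) holomorphic_on_subset[OF h sub]) auto
    also have "\<dots> = ennreal C0 * (\<integral>\<^sup>+z. ennreal (4 * y powr \<alpha>) * ennreal (indicator (ball a (y/2)) z * norm (h z) powr p) \<partial>lborel)"
      using meas by (subst nn_integral_cmult) (auto simp: mult_ac)
    also have "\<dots> \<le> ennreal C0 * (\<integral>\<^sup>+z. ennreal (4 * 6 powr \<bar>\<alpha>\<bar> * pi) * ennreal (indicator (ball a (y/2)) z * (norm (h z) powr p * (1 - (norm z)\<^sup>2) powr \<alpha> / pi)) \<partial>lborel)"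
    proof (intro mult_left_mono nn_integral_mono)
      fix z
      show "ennreal (4 * y powr \<alpha>) * ennreal (indicator (ball a (y/2)) z * norm (h z) powr p)
         \<le> ennreal (4 * 6 powr \<bar>\<alpha>\<bar> * pi) * ennreal (indicator (ball a (y/2)) z * (norm (h z) powr p * (1 - (norm z)\<^sup>2) powr \<alpha> / pi))"
      proof (cases "z \<in> ball a (y/2)")
        case True
        have z1: "norm z < 1" using nz[OF True] y by linarith
        have "y powr \<alpha> \<le> 6 powr \<bar>\<alpha>\<bar> * (1 - (norm z)\<^sup>2) powr \<alpha>"
          using nz[OF True] one_minus_norm_sq_bounds[OF z1] y by (intro powr_le_of_ratio) auto
        then have "4 * y powr \<alpha> * norm (h z) powr p \<le> 4 * (6 powr \<bar>\<alpha>\<bar> * (1 - (norm z)\<^sup>2) powr \<alpha>) * norm (h z) powr p"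
          by (intro mult_right_mono mult_left_mono) auto
        then show ?thesis using True by (simp add: mult_ac flip: ennreal_mult)
      qed auto
    qed auto
    also have "\<dots> = ennreal C * (\<integral>\<^sup>+z. ennreal (indicator (ball a (y/2)) z * (norm (h z) powr p * (1 - (norm z)\<^sup>2) powr \<alpha> / pi)) \<partial>lborel)"
      using meas C0(1) by (subst nn_integral_cmult) (auto simp: C_def ennreal_mult' mult.assoc)
    finally show ?thesis by (simp add: y_def)
  qed
  ultimately show ?thesis using that by blast
qed

lemma bergman_growth:
  assumes p: "p > 0"
  obtains C where "C > 0" "\<And>h a. h holomorphic_on ball 0 1 \<Longrightarrow> norm a < 1 \<Longrightarrow>
    ennreal (norm (h a) powr p * (1 - norm a) powr (\<alpha> + 2)) \<le> ennreal C * bergman_integral p \<alpha> h"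
proof -
  obtain C where C: "C > 0" "\<And>h a. h holomorphic_on ball 0 1 \<Longrightarrow> norm a < 1 \<Longrightarrow>
    ennreal (norm (h a) powr p * (1 - norm a) powr (\<alpha> + 2))
    \<le> ennreal C * (\<integral>\<^sup>+z. ennreal (indicator (ball a ((1 - norm a) / 2)) z * (norm (h z) powr p * (1 - (norm z)\<^sup>2) powr \<alpha> / pi)) \<partial>lborel)"
    using weighted_ball_mean[OF p, of \<alpha>] by blast
  have "ennreal (norm (h a) powr p * (1 - norm a) powr (\<alpha> + 2)) \<le> ennreal C * bergman_integral p \<alpha> h"
    if "h holomorphic_on ball 0 1" "norm a < 1" for h a
  proof -
    have "z \<in> ball 0 1" if "z \<in> ball a ((1 - norm a) / 2)" for z
    proof -
      have "norm z \<le> norm a + dist a z" using norm_triangle_ineq[of a "z - a"] by (simp add: dist_norm norm_minus_commute)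
      then show ?thesis using that \<open>norm a < 1\<close> by (simp add: field_simps)
    qed
    then have "(\<integral>\<^sup>+z. ennreal (indicator (ball a ((1 - norm a) / 2)) z * (norm (h z) powr p * (1 - (norm z)\<^sup>2) powr \<alpha> / pi)) \<partial>lborel)
      \<le> bergman_integral p \<alpha> h" unfolding bergman_integral_def
      by (intro nn_integral_mono ennreal_leI) (auto simp: indicator_def)
    then show ?thesis by (rule order_trans[OF C(2)[OF that] mult_left_mono]) simp
  qed
  with C(1) show ?thesis using that by blast
qed

text \<open>Growth of order \<open>g\<close> along the radius, refined by a sequence
  \<open>c\<close> that records the gain on each dyadic block. Both ends of a block are included, so
  that \<open>1 - 2^(-j)\<close> can close one segment and open the next.\<close>

definition dyadic_bound :: "(complex \<Rightarrow> complex) \<Rightarrow> real \<Rightarrow> (nat \<Rightarrow> real) \<Rightarrow> bool" where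
  "dyadic_bound h g c \<longleftrightarrow> (\<forall>j t. 2 powr (- real j - 1) \<le> 1 - t \<longrightarrow> 1 - t \<le> 2 powr (- real j) \<longrightarrow>
     norm (h (of_real t)) \<le> 2 powr (real j * g) * c j)"

text \<open>The ball around \<open>t\<close> in the mean value inequality stays in an annulus of the
  same dyadic size. These annuli overlap at most three times, so their integrals add up to at most
  three times the full one; this improves the pointwise growth bound to an \<open>l^p\<close>
  sequence.\<close>

lemma bergman_dyadic:
  fixes \<alpha> :: real
  assumes p: "p > 0" and \<alpha>: "\<alpha> > -2"
  shows "\<exists>C>0. \<forall>h\<in>bergman_space p \<alpha>. \<exists>c::nat \<Rightarrow> real. (\<forall>j. 0 \<le> c j) \<and>
    summable (\<lambda>j. c j powr p) \<and> (\<Sum>j. c j powr p) \<le> C * enn2real (bergman_integral p \<alpha> h) \<and>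
    dyadic_bound h ((\<alpha> + 2) / p) c"
proof -
  obtain C0 where C0: "C0 > 0" "\<And>h a. h holomorphic_on ball 0 1 \<Longrightarrow> norm a < 1 \<Longrightarrow>
    ennreal (norm (h a) powr p * (1 - norm a) powr (\<alpha> + 2))
    \<le> ennreal C0 * (\<integral>\<^sup>+z. ennreal (indicator (ball a ((1 - norm a) / 2)) z * (norm (h z) powr p * (1 - (norm z)\<^sup>2) powr \<alpha> / pi)) \<partial>lborel)"
    using weighted_ball_mean[OF p, of \<alpha>] by blast
  define C1 where "C1 = 2 powr (\<alpha> + 2) * C0"
  have C1: "C1 > 0" using C0 by (simp add: C1_def)
  show ?thesis
  proof (intro exI[of _ "C1 * 3"] conjI ballI)
    show "C1 * 3 > 0" using C1 by simp
    fix h assume "h \<in> bergman_space p \<alpha>"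
    then have h: "h holomorphic_on ball 0 1" and fin: "bergman_integral p \<alpha> h < \<infinity>"
      by (auto simp: bergman_space_def)
    \<comment> \<open>For \<open>1 - t\<close> in block \<open>j\<close>, points of the ball have
      \<open>1 - |z|\<close> strictly between \<open>(1 - t)/2\<close> and
      \<open>3 (1 - t)/2\<close>; so the block is widened by a factor 2 on either side.\<close>
    define R where "R = (\<lambda>j::nat. {z::complex. 2 powr (- real j - 2) < 1 - norm z \<and> 1 - norm z < 2 powr (- real j + 1)})"
    define \<Psi> where "\<Psi> = (\<lambda>z. norm (h z) powr p * (1 - (norm z)\<^sup>2) powr \<alpha> / pi)"
    define e where "e = (\<lambda>j. (\<integral>\<^sup>+z. ennreal (indicator (R j) z * \<Psi> z) \<partial>lborel))"
    have \<Psi>0: "\<Psi> z \<ge> 0" for z by (simp add: \<Psi>_def)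
    have R1: "norm z < 1" if "z \<in> R j" for z j
    proof -
      have "0 < (2::real) powr (- real j - 2)" by simp
      then show ?thesis using that by (simp only: R_def mem_Collect_eq) linarith
    qed
    have R_borel: "R j \<in> sets borel" for j unfolding R_def by measurable
    have meas: "(\<lambda>z. ennreal (indicator (R j) z * \<Psi> z)) \<in> borel_measurable borel" for j
      unfolding \<Psi>_def using R1 by (intro borel_measurable_bergman h R_borel) auto
    have sum_e: "(\<Sum>j<n. e j) \<le> 3 * bergman_integral p \<alpha> h" for n
    proof -
      have "(\<Sum>j<n. e j) = (\<integral>\<^sup>+z. (\<Sum>j<n. ennreal (indicator (R j) z * \<Psi> z)) \<partial>lborel)"
        unfolding e_def using meas by (intro nn_integral_sum[symmetric]) simp
      also have "\<dots> \<le> (\<integral>\<^sup>+z. 3 * ennreal (indicator (ball 0 1) z * \<Psi> z) \<partial>lborel)"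
      proof (intro nn_integral_mono)
        fix z :: complex
        show "(\<Sum>j<n. ennreal (indicator (R j) z * \<Psi> z)) \<le> 3 * ennreal (indicator (ball 0 1) z * \<Psi> z)"
        proof (cases "norm z < 1")
          case True
          then obtain i :: nat where i: "2 powr (- real i - 1) < 1 - norm z" "1 - norm z \<le> 2 powr (- real i)"
            using ex_dyadic[of "1 - norm z"] by auto
          \<comment> \<open>A point of block \<open>i\<close> meets only the annuli
            \<open>i - 1\<close>, \<open>i\<close> and \<open>i + 1\<close>; truncated subtraction
            is harmless at \<open>i = 0\<close>.\<close>
          have "{j. z \<in> R j} \<subseteq> {i - 1..i + 1}"
          proof
            fix j assume "j \<in> {j. z \<in> R j}"
            then have "(2::real) powr (- real j - 2) < 2 powr (- real i)" "(2::real) powr (- real i - 1) < 2 powr (- real j + 1)"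
              using i unfolding R_def by (auto simp only: mem_Collect_eq) 
            then have "real i < real j + 2" "real j < real i + 2" by simp_all
            then show "j \<in> {i - 1..i + 1}" by auto
          qed
          then have "card ({..<n} \<inter> {j. z \<in> R j}) \<le> card {i - 1..i + 1}" by (intro card_mono) auto
          also have "\<dots> \<le> 3" by simp
          finally have c3: "card ({..<n} \<inter> {j. z \<in> R j}) \<le> 3" .
          have "(\<Sum>j<n. ennreal (indicator (R j) z * \<Psi> z)) = (\<Sum>j<n. if z \<in> R j then ennreal (\<Psi> z) else 0)"
            by (intro sum.cong) auto
          also have "\<dots> = (\<Sum>j\<in>{..<n} \<inter> {j. z \<in> R j}. ennreal (\<Psi> z))"
            by (subst sum.inter_restrict) auto
          also have "\<dots> = of_nat (card ({..<n} \<inter> {j. z \<in> R j})) * ennreal (\<Psi> z)" by simp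
          also have "\<dots> \<le> of_nat 3 * ennreal (\<Psi> z)" by (intro mult_right_mono of_nat_mono c3) auto
          finally show ?thesis using True by simp
        next
          case False
          then have "indicator (R j) z = (0::real)" for j using R1[of z j] by (auto simp: indicator_def)
          then show ?thesis by simp
        qed
      qed
      also have "\<dots> = 3 * bergman_integral p \<alpha> h"
        using borel_measurable_bergman[OF h subset_refl, of p \<alpha>] unfolding bergman_integral_def \<Psi>_def
        by (intro nn_integral_cmult) auto
      finally show ?thesis .
    qed
    define I where "I = enn2real (bergman_integral p \<alpha> h)"
    have I: "bergman_integral p \<alpha> h = ennreal I" "I \<ge> 0" using fin by (auto simp: I_def less_top)
    have e_fin: "e j < top" for j
    proof -
      have "e j \<le> (\<Sum>j<Suc j. e j)" by (intro member_le_sum) auto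
      also have "\<dots> \<le> ennreal (3 * I)" using sum_e[of "Suc j"] I by (simp add: ennreal_mult')
      finally show ?thesis by (auto simp: less_top[symmetric] top_unique)
    qed
    define E where "E = (\<lambda>j. enn2real (e j))"
    have E: "e j = ennreal (E j)" "E j \<ge> 0" for j using e_fin by (auto simp: E_def)
    have sum_E: "(\<Sum>j<n. E j) \<le> 3 * I" for n
    proof -
      have "ennreal (\<Sum>j<n. E j) \<le> ennreal (3 * I)" using sum_e[of n] I E by (simp add: ennreal_mult')
      then show ?thesis using I by (subst (asm) ennreal_le_iff) auto
    qed
    define c where "c = (\<lambda>j. (C1 * E j) powr (1 / p))"
    have cp: "c j powr p = C1 * E j" for j using p C1 E(2)[of j] by (simp add: c_def powr_powr)
    have sum_c: "(\<Sum>j<n. c j powr p) \<le> C1 * 3 * I" for n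
      unfolding cp using mult_left_mono[OF sum_E[of n], of C1] C1 by (simp add: sum_distrib_left)
    have summ: "summable (\<lambda>j. c j powr p)" using sum_c by (intro summableI_nonneg_bounded) auto
    have "norm (h (of_real t)) \<le> 2 powr (real j * ((\<alpha> + 2) / p)) * c j"
      if t: "2 powr (- real j - 1) \<le> 1 - t" "1 - t \<le> 2 powr (- real j)" for j t
    proof -
      have pos: "0 < (2::real) powr (- real j - 1)" by simp
      have le1: "(2::real) powr (- real j) \<le> 2 powr 0" by (intro powr_mono) auto
      have t01: "0 \<le> t" using le1 t(2) by simp
      moreover have "t < 1" using pos t(1) by linarith
      ultimately have t01: "0 \<le> t" "t < 1" .
      then have nt: "norm (complex_of_real t) = t" by simp
      have sub: "z \<in> R j" if "z \<in> ball (of_real t) ((1 - t) / 2)" for z :: complex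
      proof -
        have 1: "(1 - t) / 2 < 1 - norm z" "1 - norm z < 3 * (1 - t) / 2"
          using that nt norm_triangle_ineq2[of z "of_real t"] norm_triangle_ineq2[of "of_real t" z]
          by (auto simp: dist_norm norm_minus_commute field_simps)
        have 2: "(2::real) powr (- real j - 2) = 2 powr (- real j - 1) / 2"
          by (simp add: powr_diff)
        have 3: "(2::real) powr (- real j + 1) = 2 powr (- real j) * 2"
          by (subst powr_add) simp
        have "2 powr (- real j - 2) < 1 - norm z" unfolding 2 using 1(1) t(1) by argo
        moreover have "1 - norm z < 2 powr (- real j + 1)" unfolding 3 using 1(2) t(2) t01 by argo
        ultimately show ?thesis by (simp only: R_def mem_Collect_eq simp_thms)
      qed
      have "ennreal (norm (h (of_real t)) powr p * (1 - t) powr (\<alpha> + 2))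
        \<le> ennreal C0 * (\<integral>\<^sup>+z. ennreal (indicator (ball (of_real t) ((1 - t) / 2)) z * \<Psi> z) \<partial>lborel)"
        using C0(2)[OF h, of "of_real t"] t01 by (simp add: \<Psi>_def)
      also have "\<dots> \<le> ennreal C0 * e j" unfolding e_def
        using sub \<Psi>0 by (intro mult_left_mono nn_integral_mono ennreal_leI) (auto simp: indicator_def)
      also have "\<dots> = ennreal (C0 * E j)" using C0(1) by (simp add: E ennreal_mult')
      finally have 1: "norm (h (of_real t)) powr p * (1 - t) powr (\<alpha> + 2) \<le> C0 * E j"
        using C0(1) E(2)[of j] by (subst (asm) ennreal_le_iff) auto
      have "(2 powr (- real j - 1)) powr (\<alpha> + 2) \<le> (1 - t) powr (\<alpha> + 2)"
        using t \<alpha> by (intro powr_mono2) auto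
      then have "norm (h (of_real t)) powr p * (2 powr (- real j - 1)) powr (\<alpha> + 2) \<le> C0 * E j"
        using 1 by (meson mult_left_mono order_trans powr_ge_zero)
      moreover have "((2::real) powr (- real j - 1)) powr (\<alpha> + 2) = 2 powr (- (real j * (\<alpha> + 2))) / 2 powr (\<alpha> + 2)"
        by (simp add: powr_powr algebra_simps flip: powr_diff)
      ultimately have "norm (h (of_real t)) powr p * 2 powr (- (real j * (\<alpha> + 2))) \<le> C1 * E j"
        by (simp add: C1_def field_simps)
      then have "norm (h (of_real t)) powr p \<le> 2 powr (real j * (\<alpha> + 2)) * (C1 * E j)"
        unfolding powr_minus_divide by (simp add: pos_divide_le_eq mult.commute)
      then have "(norm (h (of_real t)) powr p) powr (1 / p) \<le> (2 powr (real j * (\<alpha> + 2)) * (C1 * E j)) powr (1 / p)"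
        using p by (intro powr_mono2) auto
      then show ?thesis using p C1 E(2)[of j] by (simp add: c_def powr_powr powr_mult)
    qed
    moreover have "(\<Sum>j. c j powr p) \<le> C1 * 3 * I" using sum_c by (intro suminf_le_const summ)
    ultimately show "\<exists>c::nat \<Rightarrow> real. (\<forall>j. 0 \<le> c j) \<and>
      summable (\<lambda>j. c j powr p) \<and> (\<Sum>j. c j powr p) \<le> C1 * 3 * enn2real (bergman_integral p \<alpha> h) \<and>
      dyadic_bound h ((\<alpha> + 2) / p) c"
      unfolding dyadic_bound_def using summ by (intro exI[of _ c]) (auto simp: I_def c_def)
  qed
qed

text \<open>The inclusion of \<open>l^p\<close> in \<open>l^q\<close>: every term is at most the
  \<open>l^p\<close> norm, which therefore estimates the surplus power \<open>q - p\<close>.\<close>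

lemma summable_powr_mono:
  fixes c :: "nat \<Rightarrow> real"
  assumes p: "0 < p" "p \<le> q" and c: "\<And>j. c j \<ge> 0" and s: "summable (\<lambda>j. c j powr p)"
  shows "summable (\<lambda>j. c j powr q)" "(\<Sum>j. c j powr q) \<le> (\<Sum>j. c j powr p) powr (q / p)"
proof -
  define S where "S = (\<Sum>j. c j powr p)"
  have S: "S \<ge> 0" unfolding S_def using s by (intro suminf_nonneg) auto
  have le: "c j powr q \<le> S powr ((q - p) / p) * c j powr p" for j
  proof -
    have "c j powr (q - p) \<le> (S powr (1 / p)) powr (q - p)"
      unfolding S_def using p summable_powr_imp_bounded[OF p(1) c s] c by (intro powr_mono2) auto
    then have "c j powr (q - p) * c j powr p \<le> S powr ((q - p) / p) * c j powr p"
      by (intro mult_right_mono) (auto simp: powr_powr)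
    then show ?thesis by (simp flip: powr_add)
  qed
  show s': "summable (\<lambda>j. c j powr q)"
    by (rule summable_comparison_test'[OF summable_mult[OF s, of "S powr ((q - p) / p)"]]) (use le in auto)
  have "(\<Sum>j. c j powr q) \<le> (\<Sum>j. S powr ((q - p) / p) * c j powr p)"
    by (intro suminf_le le s' summable_mult s)
  also have "\<dots> = S powr ((q - p) / p) * S" unfolding S_def using s by (rule suminf_mult)
  also have "\<dots> = S powr (q / p)"
  proof (cases "S = 0")
    case False
    have "S powr ((q - p) / p) * S powr 1 = S powr ((q - p) / p + 1)" by (rule powr_add[symmetric])
    also have "(q - p) / p + 1 = q / p" using p by (simp add: field_simps)
    finally show ?thesis using S by simp
  qed auto
  finally show "(\<Sum>j. c j powr q) \<le> (\<Sum>j. c j powr p) powr (q / p)" by (simp add: S_def)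
qed

lemma powr_add_le:
  fixes x y q :: real
  assumes "x \<ge> 0" "y \<ge> 0" "q \<ge> 0"
  shows "(x + y) powr q \<le> 2 powr q * (x powr q + y powr q)"
proof -
  have "(x + y) powr q \<le> (2 * max x y) powr q" using assms by (intro powr_mono2) auto
  also have "\<dots> = 2 powr q * max x y powr q" using assms by (simp add: powr_mult)
  also have "\<dots> \<le> 2 powr q * (x powr q + y powr q)" by (intro mult_left_mono) (auto simp: max_def)
  finally show ?thesis .
qed

text \<open>The derivative is integrated along the radius. Block \<open>i\<close> contributes a
  segment of length at most \<open>2^(-i)\<close>, which turns the growth
  \<open>2^(i (g + 1))\<close> of the derivative into \<open>2^(i g)\<close>.\<close>

lemma radial_bound_of_deriv:
  fixes c :: "nat \<Rightarrow> real"
  assumes f: "f holomorphic_on ball 0 1"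
    and d: "dyadic_bound (deriv f) (g + 1) c"
    and t: "2 powr (- real j - 1) \<le> 1 - t" "1 - t \<le> 2 powr (- real j)"
  shows "norm (f (of_real t)) \<le> norm (f 0) + (\<Sum>i\<le>j. 2 powr (real i * g) * c i)"
proof -
  have seg: "norm (f (of_real y) - f (of_real x)) \<le> 2 powr (real j * g) * c j"
    if x: "x = 1 - 2 powr (- real j)" and y: "2 powr (- real j - 1) \<le> 1 - y" "1 - y \<le> 2 powr (- real j)" for x y j
  proof -
    define B where "B = 2 powr (real j * (g + 1)) * c j"
    have xy: "x \<le> y" using x y by simp
    have half: "(2::real) powr (- real j - 1) = 2 powr (- real j) / 2" by (simp add: powr_diff)
    have dB: "norm (deriv f w) \<le> B \<and> norm w < 1" if "w \<in> closed_segment (of_real x) (of_real y)" for w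
    proof -
      from that obtain s where s: "w = of_real s" "s \<in> closed_segment x y"
        by (auto simp: closed_segment_of_real)
      then have s': "x \<le> s" "s \<le> y" using xy by (auto simp: closed_segment_eq_real_ivl)
      have "(2::real) powr (- real j) \<le> 2 powr 0" by (intro powr_mono) auto
      then have "0 \<le> s" using s' x by simp
      moreover have "0 < (2::real) powr (- real j - 1)" by simp
      then have "s < 1" using s' y by linarith
      ultimately have "0 \<le> s" "s < 1" .
      then show ?thesis using d s' x y unfolding s B_def dyadic_bound_def by auto
    qed
    have "norm (f (of_real y) - f (of_real x)) \<le> B * norm (complex_of_real y - of_real x)"
    proof (rule field_differentiable_bound)
      show "convex (closed_segment (complex_of_real x) (of_real y))" by (rule convex_closed_segment)
      fix w assume "w \<in> closed_segment (complex_of_real x) (of_real y)"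
      from dB[OF this] show "norm (deriv f w) \<le> B"
        and "(f has_field_derivative deriv f w) (at w within closed_segment (complex_of_real x) (of_real y))"
        using holomorphic_derivI[OF f open_ball, of w] by (auto intro: has_field_derivative_at_within)
    qed auto
    also have "norm (complex_of_real y - of_real x) = y - x"
      using xy by (metis abs_of_nonneg diff_ge_0_iff_ge norm_of_real of_real_diff)
    also have "B * (y - x) \<le> B * 2 powr (- real j)"
    proof (rule mult_left_mono)
      have "0 < (2::real) powr (- real j - 1)" by simp
      then show "y - x \<le> 2 powr (- real j)" using x y by linarith
      \<comment> \<open>The sign of \<open>c\<close> is unknown here; \<open>B\<close> is
        nonnegative because it dominates a norm.\<close>
      show "0 \<le> B" using dB[of "of_real x"] norm_ge_zero order_trans by blast
    qed
    also have "\<dots> = (2 powr (real j * (g + 1)) * 2 powr (- real j)) * c j" by (simp add: B_def)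
    also have "2 powr (real j * (g + 1)) * 2 powr (- real j) = 2 powr (real j * g)"
      by (simp add: algebra_simps flip: powr_add)
    finally show ?thesis .
  qed
  define u where "u = (\<lambda>j::nat. 1 - 2 powr (- real j))"
  have step: "norm (f (of_real (u j))) \<le> norm (f 0) + (\<Sum>i<j. 2 powr (real i * g) * c i)" for j
  proof (induction j)
    case (Suc j)
    have "- real (Suc j) = - real j - 1" by simp
    then have "norm (f (of_real (u (Suc j))) - f (of_real (u j))) \<le> 2 powr (real j * g) * c j"
      by (intro seg) (simp_all add: u_def)
    then show ?case using Suc norm_triangle_ineq2[of "f (of_real (u (Suc j)))" "f (of_real (u j))"] by simp
  qed (simp add: u_def)
  show ?thesis using seg[OF refl t] step[of j] norm_triangle_ineq2[of "f (of_real t)" "f (of_real (u j))"]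
    by (simp add: u_def lessThan_Suc_atMost[symmetric])
qed

text \<open>After division by \<open>2^(j g)\<close> the radial sum over \<open>i \<le> j\<close> is
  a convolution with the kernel \<open>2^(-g (j - i))\<close>: this is the discrete Hardy
  inequality. The base \<open>b\<close> is left free so that one kernel can serve all decay rates of
  the application.\<close>

lemma dirichlet_radial_bound:
  assumes q: "q \<ge> 1" and p: "0 < p" "p \<le> q" and \<alpha>: "\<alpha> > -1"
    and b: "0 < b" "b < 1" "2 powr (- g) \<le> b" and g: "g = (\<alpha> + 2) / p - 1"
  shows "\<exists>C>0. \<forall>f\<in>dirichlet_space p \<alpha>. \<exists>V::nat \<Rightarrow> real. (\<forall>j. 0 \<le> V j) \<and>
    summable (\<lambda>j. V j powr q) \<and> (\<Sum>j. V j powr q) \<le> (C * dirichlet_norm p \<alpha> f) powr q \<and>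
    dyadic_bound f g V"
proof -
  have \<alpha>2: "\<alpha> > -2" using \<alpha> by simp
  obtain C0 where C0: "C0 > 0" "\<forall>h\<in>bergman_space p \<alpha>. \<exists>c::nat \<Rightarrow> real. (\<forall>j. 0 \<le> c j) \<and>
    summable (\<lambda>j. c j powr p) \<and> (\<Sum>j. c j powr p) \<le> C0 * enn2real (bergman_integral p \<alpha> h) \<and>
    dyadic_bound h ((\<alpha> + 2) / p) c"
    using bergman_dyadic[OF p(1) \<alpha>2] by (elim exE conjE)
  \<comment> \<open>Factor by factor: the convolution norm, the 2 of \<open>powr_add_le\<close>, and
    a bound that merges the contributions of the derivative and of \<open>f 0\<close> into one
    \<open>q\<close>-th power.\<close>
  define K where "K = (4 / (1 - b)) * 2 * (2 + 2 * (C0 / (\<alpha> + 1)) powr (1/p))"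
  have "K > 0" unfolding K_def using b by (intro mult_pos_pos add_pos_nonneg) simp_all
  moreover have "\<exists>V::nat \<Rightarrow> real. (\<forall>j. 0 \<le> V j) \<and>
    summable (\<lambda>j. V j powr q) \<and> (\<Sum>j. V j powr q) \<le> (K * dirichlet_norm p \<alpha> f) powr q \<and>
    dyadic_bound f g V"
    if f: "f \<in> dirichlet_space p \<alpha>" for f
  proof -
    have fh: "f holomorphic_on ball 0 1" and df: "deriv f \<in> bergman_space p \<alpha>"
      using f by (auto simp: dirichlet_space_def)
    define I where "I = enn2real (bergman_integral p \<alpha> (deriv f))"
    have I: "I \<ge> 0" by (simp add: I_def)
    from bspec[OF C0(2) df] obtain c where c: "\<And>j. 0 \<le> c j" "summable (\<lambda>j. c j powr p)"
      "(\<Sum>j. c j powr p) \<le> C0 * I"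
      "dyadic_bound (deriv f) (g + 1) c" unfolding I_def g by auto
    \<comment> \<open>The constant \<open>|f 0|\<close> is charged to the block
      \<open>j = 0\<close>, whose factor \<open>2^(j g)\<close> is 1.\<close>
    define c' where "c' = (\<lambda>j. c j + (if j = 0 then norm (f 0) else 0))"
    have c'0: "c' j \<ge> 0" for j using c(1) by (simp add: c'_def)
    have rad: "norm (f (of_real t)) \<le> (\<Sum>i\<le>j. 2 powr (real i * g) * c' i)"
      if "2 powr (- real j - 1) \<le> 1 - t" "1 - t \<le> 2 powr (- real j)" for j t
    proof -
      have "(\<Sum>i\<le>j. 2 powr (real i * g) * c' i) = norm (f 0) + (\<Sum>i\<le>j. 2 powr (real i * g) * c i)"
        by (simp add: c'_def distrib_left sum.distrib if_distrib[of "(*) _"] cong: if_cong)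
      then show ?thesis using radial_bound_of_deriv[OF fh c(4) that] by simp
    qed
    note cq = summable_powr_mono[OF p c(1,2)]
    have s0: "(\<lambda>j. (if j = 0 then norm (f 0) else 0) powr q) sums (norm (f 0) powr q)"
      using sums_single[of 0 "\<lambda>j. norm (f 0) powr q"] by (simp add: if_distrib[of "\<lambda>x. x powr q"] cong: if_cong)
    have le: "c' j powr q \<le> 2 powr q * (c j powr q + (if j = 0 then norm (f 0) else 0) powr q)" for j
      unfolding c'_def using q c(1) by (intro powr_add_le) auto
    have sr: "summable (\<lambda>j. 2 powr q * (c j powr q + (if j = 0 then norm (f 0) else 0) powr q))"
      using cq(1) s0 by (intro summable_mult summable_add) (auto simp: sums_iff)
    have c's: "summable (\<lambda>j. c' j powr q)"
      by (rule summable_comparison_test'[OF sr]) (use le in auto)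
    define D where "D = dirichlet_norm p \<alpha> f"
    have D: "D = norm (f 0) + ((\<alpha> + 1) * I) powr (1 / p)"
      by (simp add: D_def dirichlet_norm_def bergman_norm_def I_def)
    have D0: "D \<ge> 0" by (simp add: D)
    \<comment> \<open>\<open>M\<close> is the factor between \<open>(C0 * I) powr (1 / p)\<close>
      and the Bergman norm of the derivative, which contains \<open>\<alpha> + 1\<close>.\<close>
    define M where "M = (C0 / (\<alpha> + 1)) powr (1 / p)"
    have M: "M \<ge> 0" by (simp add: M_def)
    have "(\<Sum>j. c' j powr q) \<le> (\<Sum>j. 2 powr q * (c j powr q + (if j = 0 then norm (f 0) else 0) powr q))"
      by (intro suminf_le le c's sr)
    also have "\<dots> = 2 powr q * ((\<Sum>j. c j powr q) + norm (f 0) powr q)"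
      using cq(1) s0 by (simp add: suminf_mult suminf_add[symmetric] summable_add sums_iff)
    also have "\<dots> \<le> 2 powr q * ((M * D) powr q + D powr q)"
    proof (intro mult_left_mono add_mono)
      have "(\<Sum>j. c j powr q) \<le> (C0 * I) powr (q / p)"
        using cq(2) c(2,3) p by (elim order_trans) (auto intro!: powr_mono2 suminf_nonneg)
      also have "C0 * I = C0 / (\<alpha> + 1) * ((\<alpha> + 1) * I)" using \<alpha> by simp
      also have "\<dots> powr (q / p) = (M * ((\<alpha> + 1) * I) powr (1 / p)) powr q"
        using \<alpha> C0(1) I by (simp add: M_def powr_mult powr_powr powr_divide)
      also have "\<dots> \<le> (M * D) powr q"
        using q M by (intro powr_mono2 mult_left_mono) (auto simp: D)
      finally show "(\<Sum>j. c j powr q) \<le> (M * D) powr q" .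
      show "norm (f 0) powr q \<le> D powr q" using q by (intro powr_mono2) (auto simp: D)
    qed auto
    also have "\<dots> \<le> 2 powr q * ((2 + 2 * M) * D) powr q"
    proof (intro mult_left_mono)
      have "(M * D) powr q + D powr q = (M powr q + 1 powr q) * D powr q"
        using M D0 by (simp add: powr_mult algebra_simps)
      also have "\<dots> \<le> (2 + 2 * M) powr q * D powr q"
      proof (intro mult_right_mono)
        have "M powr q + 1 powr q \<le> (1 + M) powr q + (1 + M) powr q"
          using M q by (intro add_mono powr_mono2) auto
        also have "\<dots> = 2 powr 1 * (1 + M) powr q" by simp
        also have "\<dots> \<le> 2 powr q * (1 + M) powr q" using q by (intro mult_right_mono powr_mono) auto
        also have "\<dots> = (2 * (1 + M)) powr q" by (simp only: powr_mult)
        finally show "M powr q + 1 powr q \<le> (2 + 2 * M) powr q" by simp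
      qed auto
      also have "\<dots> = ((2 + 2 * M) * D) powr q" using M D0 by (simp add: powr_mult)
      finally show "(M * D) powr q + D powr q \<le> ((2 + 2 * M) * D) powr q" .
    qed auto
    finally have c'q: "(\<Sum>j. c' j powr q) \<le> 2 powr q * ((2 + 2 * M) * D) powr q" .
    define V where "V = (\<lambda>m. \<Sum>j. dist_kernel b m j * c' j)"
    have conv: "summable (\<lambda>j. dist_kernel b m j * c' j)" "summable (\<lambda>m. V m powr q)"
      "(\<Sum>m. V m powr q) \<le> (4 / (1 - b)) powr q * (\<Sum>j. c' j powr q)" for m
      unfolding V_def by (rule dist_kernel_convolution[OF b(1,2) q c'0 c's])+
    have V0: "V j \<ge> 0" for j unfolding V_def
      using conv(1) c'0 dist_kernel_pos[OF b(1)] by (intro suminf_nonneg) (auto simp: less_imp_le)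
    have "(\<Sum>j. V j powr q) \<le> (4 / (1 - b)) powr q * (2 powr q * ((2 + 2 * M) * D) powr q)"
      using conv(3) c'q by (meson mult_left_mono order_trans powr_ge_zero)
    also have "\<dots> = ((4 / (1 - b)) * (2 * ((2 + 2 * M) * D))) powr q" by (simp only: powr_mult)
    also have "(4 / (1 - b)) * (2 * ((2 + 2 * M) * D)) = K * D" by (simp add: K_def M_def)
    finally have Vq: "(\<Sum>j. V j powr q) \<le> (K * D) powr q" .
    have "norm (f (of_real t)) \<le> 2 powr (real j * g) * V j"
      if t: "2 powr (- real j - 1) \<le> 1 - t" "1 - t \<le> 2 powr (- real j)" for j t
    proof -
      have "norm (f (of_real t)) \<le> (\<Sum>i\<le>j. 2 powr (real i * g) * c' i)" by (rule rad[OF t])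
      also have "\<dots> \<le> (\<Sum>i\<le>j. 2 powr (real j * g) * (dist_kernel b j i * c' i))"
      proof (intro sum_mono)
        fix i assume i: "i \<in> {..j}"
        have "2 powr (real i * g) = 2 powr (real j * g) * (2 powr (- g)) ^ (j - i)"
          using i by (simp add: of_nat_diff algebra_simps flip: two_powr_neg_mult powr_add)
        also have "\<dots> \<le> 2 powr (real j * g) * b ^ (j - i)"
          using b by (intro mult_left_mono power_mono) auto
        also have "b ^ (j - i) = dist_kernel b j i" using i by (simp add: dist_kernel_def)
        finally have "2 powr (real i * g) * c' i \<le> 2 powr (real j * g) * dist_kernel b j i * c' i"
          using c'0 by (intro mult_right_mono) auto
        then show "2 powr (real i * g) * c' i \<le> 2 powr (real j * g) * (dist_kernel b j i * c' i)"
          by (simp add: mult.assoc)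
      qed
      also have "\<dots> = 2 powr (real j * g) * (\<Sum>i\<le>j. dist_kernel b j i * c' i)" by (simp add: sum_distrib_left)
      also have "\<dots> \<le> 2 powr (real j * g) * V j"
        unfolding V_def using conv(1) c'0 dist_kernel_pos[OF b(1)]
        by (intro mult_left_mono sum_le_suminf) (auto simp: less_imp_le)
      finally show ?thesis .
    qed
    then have "dyadic_bound f g V" by (simp add: dyadic_bound_def)
    then show ?thesis using V0 conv(2) Vq unfolding D_def by blast
  qed
  ultimately show ?thesis by (intro exI[of _ K] conjI ballI)
qed

section \<open>Carleson measures: dyadic tails, finiteness and integrability near 1\<close>

lemma carleson_dyadic:
  assumes "carleson \<mu> s"
  obtains C where "C > 0" "\<And>j::nat. emeasure \<mu> {1 - 2 powr (- real j)..<1} \<le> ennreal (C * 2 powr (- real j * s))"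
proof -
  obtain C where C: "\<And>t. 0 \<le> t \<Longrightarrow> t < 1 \<Longrightarrow> emeasure \<mu> {t..<1} \<le> ennreal (C * (1 - t) powr s)"
    using assms by (auto simp: carleson_def)
  \<comment> \<open>The constant in \<open>carleson\<close> may be negative, in which case
    \<open>ennreal\<close> cuts it off to 0; \<open>\<bar>C\<bar> + 1\<close> is positive and covers
    this case too.\<close>
  have "emeasure \<mu> {1 - 2 powr (- real j)..<1} \<le> ennreal ((\<bar>C\<bar> + 1) * 2 powr (- real j * s))" for j :: nat
  proof -
    have "(2::real) powr (- real j) \<le> 2 powr 0" by (intro powr_mono) auto
    then have "emeasure \<mu> {1 - 2 powr (- real j)..<1} \<le> ennreal (C * (2 powr (- real j)) powr s)"
      using C[of "1 - 2 powr (- real j)"] by simp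
    also have "\<dots> \<le> ennreal ((\<bar>C\<bar> + 1) * 2 powr (- real j * s))"
      by (intro ennreal_leI) (auto simp: powr_powr intro!: mult_right_mono)
    finally show ?thesis .
  qed
  then show ?thesis using that[of "\<bar>C\<bar> + 1"] by simp
qed

lemma carleson_finite:
  assumes "carleson \<mu> s"
  shows "emeasure \<mu> {0..<1} < \<infinity>"
proof -
  obtain C where "\<And>t. 0 \<le> t \<and> t < 1 \<Longrightarrow> emeasure \<mu> {t..<1} \<le> ennreal (C * (1 - t) powr s)"
    using assms unfolding carleson_def by blast
  from this[of 0] show ?thesis by (simp add: order_le_less_trans)
qed

text \<open>The tail of index \<open>j\<close> has mass of order \<open>2^(-j s)\<close> and the
  integrand is of order \<open>2^(j s')\<close> on its block, so the series is geometric with ratio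
  \<open>2^(-(s - s'))\<close>.\<close>

lemma carleson_integral_finite:
  assumes c: "carleson \<mu> s" and [measurable_cong]: "sets \<mu> = sets borel" and s': "0 \<le> s'" "s' < s"
  shows "(\<integral>\<^sup>+t. ennreal (indicator {0..<1} t * (1 - t) powr (- s')) \<partial>\<mu>) < \<infinity>"
proof -
  obtain C where C: "C > 0" "\<And>j::nat. emeasure \<mu> {1 - 2 powr (- real j)..<1} \<le> ennreal (C * 2 powr (- real j * s))"
    using carleson_dyadic[OF c] by blast
  define r where "r = (2::real) powr (- (s - s'))"
  have r: "0 < r" "r < 1" using s' by (auto simp: r_def powr_less_one)
  have "(\<integral>\<^sup>+t. ennreal (indicator {0..<1} t * (1 - t) powr (- s')) \<partial>\<mu>)
    \<le> (\<Sum>j. (\<integral>\<^sup>+t. ennreal ((2 powr (- real j - 1)) powr (- s')) * indicator {1 - 2 powr (- real j)..<1} t \<partial>\<mu>))"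
  proof (rule nn_integral_le_suminf)
    fix t :: real
    show "\<exists>j. ennreal (indicator {0..<1} t * (1 - t) powr (- s')) \<le> ennreal ((2 powr (- real j - 1)) powr (- s')) * indicator {1 - 2 powr (- real j)..<1} t"
    proof (cases "0 \<le> t \<and> t < 1")
      case True
      then obtain j :: nat where j: "2 powr (- real j - 1) < 1 - t" "1 - t \<le> 2 powr (- real j)"
        using ex_dyadic[of "1 - t"] by auto
      have "(1 - t) powr (- s') \<le> (2 powr (- real j - 1)) powr (- s')"
        using j s' by (intro powr_mono2') auto
      then show ?thesis using j True by (intro exI[of _ j]) (auto intro: ennreal_leI)
    qed auto
  qed measurable
  also have "\<dots> = (\<Sum>j. ennreal ((2 powr (- real j - 1)) powr (- s')) * emeasure \<mu> {1 - 2 powr (- real j)..<1})"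
    by (simp add: nn_integral_cmult_indicator assms(2))
  also have "\<dots> \<le> (\<Sum>j. ennreal (2 powr s' * C * r ^ j))"
  proof (intro suminf_le)
    fix j
    have "ennreal ((2 powr (- real j - 1)) powr (- s')) * emeasure \<mu> {1 - 2 powr (- real j)..<1}
      \<le> ennreal ((2 powr (- real j - 1)) powr (- s')) * ennreal (C * 2 powr (- real j * s))"
      by (intro mult_left_mono C) auto
    also have "\<dots> = ennreal (C * (2 powr (real j * s' + s') * 2 powr (- real j * s)))"
      using C(1) by (simp add: powr_powr algebra_simps flip: ennreal_mult)
    also have "2 powr (real j * s' + s') * 2 powr (- real j * s) = 2 powr s' * (2::real) powr (- real j * (s - s'))"
      by (simp add: algebra_simps flip: powr_add)
    finally show "ennreal ((2 powr (- real j - 1)) powr (- s')) * emeasure \<mu> {1 - 2 powr (- real j)..<1}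
      \<le> ennreal (2 powr s' * C * r ^ j)" by (simp add: two_powr_neg_mult[of j "s - s'", folded r_def, simplified] mult_ac r_def)
  qed auto
  also have "\<dots> = ennreal (\<Sum>j. 2 powr s' * C * r ^ j)"
    using r C(1) by (intro suminf_ennreal2) (auto intro!: summable_mult)
  finally show ?thesis by (simp add: order_le_less_trans)
qed

section \<open>The integral representation\<close>

text \<open>The coefficient of \<open>w ^ n\<close> in \<open>(1 - w) powr (- \<beta>)\<close>,
  which is the prefactor of \<open>mu_coeff\<close>.\<close>

definition binom_coeff :: "real \<Rightarrow> nat \<Rightarrow> real" where
  "binom_coeff \<beta> n = Gamma (real n + \<beta>) / (fact n * Gamma \<beta>)"

lemma norm_powr_of_real: "w \<noteq> 0 \<Longrightarrow> norm ((w::complex) powr of_real x) = norm w powr x"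
  by (simp add: powr_def)

context
  fixes \<beta> :: real
  assumes \<beta>: "\<beta> > 0"
begin

lemma binom_coeff_pos: "binom_coeff \<beta> n > 0"
  using \<beta> by (auto simp: binom_coeff_def intro!: divide_pos_pos mult_pos_pos Gamma_real_pos)

lemma binom_coeff_eq_gbinomial: "of_real (binom_coeff \<beta> n) = ((- of_real \<beta> :: complex) gchoose n) * (-1) ^ n"
proof -
  have "binom_coeff \<beta> n = pochhammer \<beta> n / fact n"
    using \<beta> by (subst pochhammer_Gamma) (auto simp: binom_coeff_def add.commute elim!: nonpos_Ints_cases)
  then have "of_real (binom_coeff \<beta> n) = pochhammer (of_real \<beta> :: complex) n / fact n"
    by (simp add: pochhammer_of_real)
  then show ?thesis by (simp add: gbinomial_pochhammer flip: power_mult_distrib)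
qed

lemma binom_coeff_sums:
  assumes "norm (w::complex) < 1"
  shows "(\<lambda>n. of_real (binom_coeff \<beta> n) * w ^ n) sums (1 - w) powr (- of_real \<beta>)"
proof -
  have "(\<lambda>n. ((- of_real \<beta> :: complex) gchoose n) * (- w) ^ n) sums (1 + - w) powr (- of_real \<beta>)"
    using assms by (intro gen_binomial_complex) simp
  moreover have "((- of_real \<beta> :: complex) gchoose n) * (- w) ^ n = of_real (binom_coeff \<beta> n) * w ^ n" for n
    unfolding binom_coeff_eq_gbinomial by (subst power_minus) simp
  ultimately show ?thesis by simp
qed

lemma summable_binom_coeff:
  assumes "0 \<le> x" "x < 1"
  shows "summable (\<lambda>n. binom_coeff \<beta> n * x ^ n)"
proof -
  have "summable (\<lambda>n. of_real (binom_coeff \<beta> n) * (of_real x :: complex) ^ n)"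
    using binom_coeff_sums[of "of_real x"] assms by (auto simp: sums_iff)
  then have "summable (\<lambda>n. of_real (binom_coeff \<beta> n * x ^ n) :: complex)" by simp
  then show ?thesis by (simp only: summable_of_real_iff)
qed

text \<open>Coefficientwise, the derivative of \<open>(1 - w) powr (- \<beta>)\<close> is
  \<open>\<beta> (1 - w) powr (- (\<beta> + 1))\<close>. Through this identity the exponent
  \<open>\<beta> + 1\<close> enters the kernel of the differentiated operator.\<close>

lemma Suc_binom_coeff: "real (Suc n) * binom_coeff \<beta> (Suc n) = \<beta> * binom_coeff (\<beta> + 1) n"
proof -
  have "Gamma (\<beta> + 1) = \<beta> * Gamma \<beta>" using \<beta> by (intro Gamma_plus1) (auto elim!: nonpos_Ints_cases)
  moreover have "Gamma \<beta> > 0" using \<beta> by (rule Gamma_real_pos)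
  ultimately show ?thesis using \<beta> by (simp add: binom_coeff_def field_simps del: of_nat_Suc) (simp add: algebra_simps)
qed

end

lemma holomorphic_taylor_sums:
  assumes "f holomorphic_on ball 0 R" "norm z < R"
  shows "(\<lambda>k. taylor_coeff f k * z ^ k) sums f z"
  using holomorphic_power_series[OF assms(1), of z] assms(2) by (simp add: taylor_coeff_def)

text \<open>The majorant \<open>\<Phi>\<close> of the absolute Taylor series justifies all interchanges of sums and
  integrals by dominated convergence.\<close>

locale hankel_setup =
  fixes \<mu> :: "real measure" and \<beta> :: real and f :: "complex \<Rightarrow> complex" and \<Phi> :: "real \<Rightarrow> real"
  assumes \<mu>: "borel_measure_on_01 \<mu>" and \<beta>: "\<beta> > 0"
    and fin: "emeasure \<mu> {0..<1} < \<infinity>"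
    and f: "f holomorphic_on ball 0 1"
    and \<Phi>: "integrable \<mu> \<Phi>"
    and le_\<Phi>: "\<And>t n. 0 \<le> t \<Longrightarrow> t < 1 \<Longrightarrow> (\<Sum>k<n. norm (taylor_coeff f k) * t ^ k) \<le> \<Phi> t"
begin

text \<open>The cut-off makes \<open>F\<close> a Borel function on the whole line, although
  \<open>f\<close> is controlled only in the disc; the complement of \<open>[0, 1)\<close> is a null
  set of \<open>\<mu>\<close>.\<close>

definition F :: "real \<Rightarrow> complex" where
  "F t = indicator {0..<1} t *\<^sub>R f (of_real t)"

lemma sets_\<mu> [measurable_cong]: "sets \<mu> = sets borel"
  using \<mu> by (simp add: borel_measure_on_01_def)

lemma AE_01: "AE t in \<mu>. 0 \<le> t \<and> t < 1"
proof (rule AE_I)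
  show "emeasure \<mu> (- {0..<1}) = 0" using \<mu> by (simp add: borel_measure_on_01_def)
qed (auto simp: sets_\<mu>)

lemma F_measurable [measurable]: "F \<in> borel_measurable borel"
proof -
  have "continuous_on {0..<1} (\<lambda>t. f (of_real t))"
    by (intro continuous_on_compose2[OF holomorphic_on_imp_continuous_on[OF f]])
      (auto intro!: continuous_intros)
  then show ?thesis unfolding F_def by (intro borel_measurable_continuous_on_indicator) auto
qed

lemma F_eq: "0 \<le> t \<Longrightarrow> t < 1 \<Longrightarrow> F t = f (of_real t)"
  by (simp add: F_def)

lemma F_sums: "0 \<le> t \<Longrightarrow> t < 1 \<Longrightarrow> (\<lambda>k. taylor_coeff f k * of_real t ^ k) sums F t"
  using holomorphic_taylor_sums[OF f, of "of_real t"] by (simp add: F_eq)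

lemma norm_F_le: assumes "0 \<le> t" "t < 1" shows "norm (F t) \<le> \<Phi> t"
proof (rule LIMSEQ_le_const2)
  show "(\<lambda>n. norm (\<Sum>k<n. taylor_coeff f k * of_real t ^ k)) \<longlonglongrightarrow> norm (F t)"
    using F_sums[OF assms] by (auto simp: sums_def intro: tendsto_norm)
  have "norm (\<Sum>k<n. taylor_coeff f k * of_real t ^ k) \<le> \<Phi> t" for n
    using norm_sum[of "\<lambda>k. taylor_coeff f k * of_real t ^ k" "{..<n}"] le_\<Phi>[OF assms, of n] assms
    by (simp add: norm_mult norm_power)
  then show "\<exists>N. \<forall>n\<ge>N. norm (\<Sum>k<n. taylor_coeff f k * of_real t ^ k) \<le> \<Phi> t" by blast
qed

lemma integrable_F: "integrable \<mu> F"
proof (rule Bochner_Integration.integrable_bound[OF \<Phi>])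
  show "AE t in \<mu>. norm (F t) \<le> norm (\<Phi> t)"
    using AE_01
  proof eventually_elim
    case (elim t)
    then show ?case using norm_F_le[of t] by simp
  qed
qed measurable

lemma integrable_power_F: "integrable \<mu> (\<lambda>t. of_real t ^ n * F t)"
proof (rule Bochner_Integration.integrable_bound[OF integrable_F])
  show "AE t in \<mu>. norm (of_real t ^ n * F t) \<le> norm (F t)"
    using AE_01 by eventually_elim (auto simp: norm_mult norm_power intro!: mult_left_le_one_le power_le_one)
qed measurable

lemma finite_\<mu>: "finite_measure \<mu>"
proof (rule finite_measureI)
  have sp: "space \<mu> = UNIV" using sets_eq_imp_space_eq[OF sets_\<mu>] by simp
  have "{0..<1} \<union> - {0..<1::real} = UNIV" by auto
  then have "emeasure \<mu> (space \<mu>) \<le> emeasure \<mu> {0..<1} + emeasure \<mu> (- {0..<1})"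
    using emeasure_subadditive[of "{0..<1}" \<mu> "- {0..<1}"] by (simp add: sp sets_\<mu>)
  then show "emeasure \<mu> (space \<mu>) \<noteq> \<infinity>"
    using fin \<mu> by (auto simp: borel_measure_on_01_def top_unique)
qed

lemma integrable_power: "integrable \<mu> (\<lambda>t. t ^ n)"
proof (rule finite_measure.integrable_const_bound[OF finite_\<mu>])
  show "AE t in \<mu>. norm (t ^ n) \<le> 1" using AE_01 by eventually_elim (auto simp: power_le_one)
qed measurable

text \<open>Since \<open>t ^ n\<close> is at most 1, the single majorant \<open>\<Phi>\<close>
  dominates the partial sums over \<open>k\<close> for every \<open>n\<close>.\<close>

lemma hilbert_coeff_sums:
  "(\<lambda>k. of_real (mu_coeff \<mu> \<beta> n k) * taylor_coeff f k)
     sums (of_real (binom_coeff \<beta> n) * (\<integral>t. of_real t ^ n * F t \<partial>\<mu>))"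
proof -
  have int: "integrable \<mu> (\<lambda>t. of_real (t ^ (n + k)) * taylor_coeff f k :: complex)" for k
    using integrable_power[of "n + k"] by (intro integrable_mult_left integrable_of_real)
  have trm: "of_real (mu_coeff \<mu> \<beta> n k) * taylor_coeff f k
     = of_real (binom_coeff \<beta> n) * (\<integral>t. of_real (t ^ (n + k)) * taylor_coeff f k \<partial>\<mu>)" for k
    by (simp add: mu_coeff_def binom_coeff_def del: of_real_power)
  have "(\<lambda>N. \<integral>t. (\<Sum>k<N. of_real (t ^ (n + k)) * taylor_coeff f k) \<partial>\<mu>) \<longlonglongrightarrow> (\<integral>t. of_real t ^ n * F t \<partial>\<mu>)"
  proof (rule integral_dominated_convergence[OF _ _ \<Phi>])
    show "AE t in \<mu>. (\<lambda>N. \<Sum>k<N. of_real (t ^ (n + k)) * taylor_coeff f k) \<longlonglongrightarrow> of_real t ^ n * F t"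
      using AE_01
    proof eventually_elim
      case (elim t)
      then have "(\<lambda>k. of_real t ^ n * (taylor_coeff f k * of_real t ^ k)) sums (of_real t ^ n * F t)"
        by (intro sums_mult F_sums) auto
      then show ?case by (simp add: sums_def power_add mult_ac)
    qed
    show "AE t in \<mu>. norm (\<Sum>k<N. of_real (t ^ (n + k)) * taylor_coeff f k) \<le> \<Phi> t" for N
      using AE_01
    proof eventually_elim
      case (elim t)
      have "norm (\<Sum>k<N. of_real (t ^ (n + k)) * taylor_coeff f k) \<le> (\<Sum>k<N. norm (taylor_coeff f k) * t ^ k)"
      proof (rule order_trans[OF norm_sum], intro sum_mono)
        fix k
        have "t ^ n * (norm (taylor_coeff f k) * t ^ k) \<le> 1 * (norm (taylor_coeff f k) * t ^ k)"
          using elim by (intro mult_right_mono power_le_one) auto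
        then show "norm (of_real (t ^ (n + k)) * taylor_coeff f k) \<le> norm (taylor_coeff f k) * t ^ k"
          using elim by (simp add: norm_mult norm_power power_add mult_ac)
      qed
      also have "\<dots> \<le> \<Phi> t" using elim by (intro le_\<Phi>) auto
      finally show ?case .
    qed
  qed measurable
  then have "(\<lambda>N. \<Sum>k<N. \<integral>t. of_real (t ^ (n + k)) * taylor_coeff f k \<partial>\<mu>) \<longlonglongrightarrow> (\<integral>t. of_real t ^ n * F t \<partial>\<mu>)"
    using int by (subst (asm) Bochner_Integration.integral_sum) auto
  then show ?thesis unfolding trm by (intro sums_mult) (simp add: sums_def)
qed

lemma hilbert_coeff_eq:
  "hilbert_coeff \<mu> \<beta> f n = of_real (binom_coeff \<beta> n) * (\<integral>t. of_real t ^ n * F t \<partial>\<mu>)"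
  unfolding hilbert_coeff_def using hilbert_coeff_sums by (rule sums_unique[symmetric])

lemma norm_integral_power_F_le: "norm (\<integral>t. of_real t ^ n * F t \<partial>\<mu>) \<le> (\<integral>t. norm (F t) \<partial>\<mu>)"
proof (rule order_trans[OF integral_norm_bound], rule integral_mono_AE)
  show "AE t in \<mu>. norm (of_real t ^ n * F t) \<le> norm (F t)"
    using AE_01 by eventually_elim (auto simp: norm_mult norm_power intro!: mult_left_le_one_le power_le_one)
qed (auto intro!: integrable_norm integrable_F integrable_power_F)

text \<open>The moments of \<open>F\<close> are bounded uniformly in \<open>n\<close>, so the power
  series is dominated by the binomial series at \<open>norm z\<close>.\<close>

lemma summable_hilbert_coeff:
  assumes "norm z < 1"
  shows "summable (\<lambda>n. hilbert_coeff \<mu> \<beta> f n * z ^ n)"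
proof (rule summable_comparison_test')
  show "summable (\<lambda>n. (\<integral>t. norm (F t) \<partial>\<mu>) * (binom_coeff \<beta> n * norm z ^ n))"
    using summable_binom_coeff[OF \<beta>, of "norm z"] assms by (intro summable_mult) auto
  fix n :: nat
  show "norm (hilbert_coeff \<mu> \<beta> f n * z ^ n) \<le> (\<integral>t. norm (F t) \<partial>\<mu>) * (binom_coeff \<beta> n * norm z ^ n)"
    using mult_right_mono[OF norm_integral_power_F_le[of n], of "binom_coeff \<beta> n * norm z ^ n"]
      binom_coeff_pos[OF \<beta>, of n]
    by (simp add: hilbert_coeff_eq norm_mult norm_power mult_ac)
qed

lemma hilbert_defined: "hilbert_defined \<mu> \<beta> f"
  using hilbert_coeff_sums summable_hilbert_coeff by (auto simp: hilbert_defined_def sums_iff)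

lemma hilbert_op_0: "hilbert_op \<mu> \<beta> f 0 = (\<integral>t. F t \<partial>\<mu>)"
proof -
  have "binom_coeff \<beta> 0 = 1" using Gamma_real_pos[OF \<beta>] by (simp add: binom_coeff_def)
  then have "hilbert_coeff \<mu> \<beta> f 0 = (\<integral>t. F t \<partial>\<mu>)" by (simp add: hilbert_coeff_eq)
  then show ?thesis unfolding hilbert_op_def using powser_zero[of "hilbert_coeff \<mu> \<beta> f"] by simp
qed

lemma has_deriv_hilbert_op:
  assumes "norm z < 1"
  shows "(hilbert_op \<mu> \<beta> f has_field_derivative (\<Sum>n. diffs (hilbert_coeff \<mu> \<beta> f) n * z ^ n)) (at z)"
  unfolding hilbert_op_def[abs_def]
  by (rule termdiffs_strong'[OF _ assms]) (rule summable_hilbert_coeff)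

lemma hilbert_op_holomorphic: "hilbert_op \<mu> \<beta> f holomorphic_on ball 0 1"
  unfolding holomorphic_on_open[OF open_ball] using has_deriv_hilbert_op by fastforce

lemma norm_of_real_mult_less_1: "0 \<le> t \<Longrightarrow> t < 1 \<Longrightarrow> norm z < 1 \<Longrightarrow> norm (of_real t * z :: complex) < 1"
  using mult_le_one[of t "norm z"] mult_left_le_one_le[of "norm z" t] by (simp add: norm_mult)

text \<open>Dominated convergence again, now with majorant \<open>D * norm (F t)\<close>: for fixed
  \<open>z\<close> the binomial series at \<open>norm z\<close> bounds all partial sums over
  \<open>n\<close> uniformly in \<open>t\<close>.\<close>

lemma deriv_hilbert_op_sums:
  assumes z: "norm z < 1"
  shows "(\<lambda>n. diffs (hilbert_coeff \<mu> \<beta> f) n * z ^ n) sums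
     (of_real \<beta> * (\<integral>t. of_real t * F t * (1 - of_real t * z) powr (- of_real (\<beta> + 1)) \<partial>\<mu>))"
proof -
  define d where "d = binom_coeff (\<beta> + 1)"
  have \<beta>1: "\<beta> + 1 > 0" using \<beta> by simp
  have d_pos: "d n > 0" for n unfolding d_def by (rule binom_coeff_pos[OF \<beta>1])
  have sd: "summable (\<lambda>n. d n * norm z ^ n)"
    unfolding d_def using z by (intro summable_binom_coeff[OF \<beta>1]) auto
  define D where "D = (\<Sum>n. d n * norm z ^ n)"
  have D: "(\<Sum>n<N. d n * norm z ^ n) \<le> D" for N
    unfolding D_def using d_pos by (intro sum_le_suminf sd) (auto simp: less_imp_le)
  have trm: "diffs (hilbert_coeff \<mu> \<beta> f) n * z ^ n
     = of_real \<beta> * (\<integral>t. of_real (d n) * z ^ n * (of_real t ^ Suc n * F t) \<partial>\<mu>)" for n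
  proof -
    have "complex_of_real (real (Suc n) * binom_coeff \<beta> (Suc n)) = of_real (\<beta> * d n)"
      unfolding d_def by (simp only: Suc_binom_coeff[OF \<beta>])
    then have "of_nat (Suc n) * complex_of_real (binom_coeff \<beta> (Suc n)) = of_real \<beta> * of_real (d n)"
      by (simp only: of_real_mult of_real_of_nat_eq)
    then show ?thesis
      unfolding diffs_def hilbert_coeff_eq Bochner_Integration.integral_mult_right_zero
      by (simp only: mult.assoc[symmetric]) (simp only: mult.assoc mult.commute[of "z ^ n"])
  qed
  have int: "integrable \<mu> (\<lambda>t. of_real (d n) * z ^ n * (of_real t ^ Suc n * F t))" for n
    by (intro integrable_mult_right integrable_power_F)
  have "(\<lambda>N. \<integral>t. (\<Sum>n<N. of_real (d n) * z ^ n * (of_real t ^ Suc n * F t)) \<partial>\<mu>)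
     \<longlonglongrightarrow> (\<integral>t. of_real t * F t * (1 - of_real t * z) powr (- of_real (\<beta> + 1)) \<partial>\<mu>)"
  proof (rule integral_dominated_convergence)
    show "integrable \<mu> (\<lambda>t. D * norm (F t))" by (intro integrable_mult_right integrable_norm integrable_F)
    show "AE t in \<mu>. (\<lambda>N. \<Sum>n<N. of_real (d n) * z ^ n * (of_real t ^ Suc n * F t))
       \<longlonglongrightarrow> of_real t * F t * (1 - of_real t * z) powr (- of_real (\<beta> + 1))"
      using AE_01
    proof eventually_elim
      case (elim t)
      then have "(\<lambda>n. of_real t * F t * (of_real (d n) * (of_real t * z) ^ n))
        sums (of_real t * F t * (1 - of_real t * z) powr (- of_real (\<beta> + 1)))"
        unfolding d_def using z by (intro sums_mult binom_coeff_sums[OF \<beta>1] norm_of_real_mult_less_1) auto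
      then show ?case by (simp add: sums_def power_mult_distrib mult_ac)
    qed
    show "AE t in \<mu>. norm (\<Sum>n<N. of_real (d n) * z ^ n * (of_real t ^ Suc n * F t)) \<le> D * norm (F t)" for N
      using AE_01
    proof eventually_elim
      case (elim t)
      have "norm (\<Sum>n<N. of_real (d n) * z ^ n * (of_real t ^ Suc n * F t)) \<le> (\<Sum>n<N. d n * norm z ^ n * norm (F t))"
      proof (rule order_trans[OF norm_sum], intro sum_mono)
        fix n
        have "(d n * norm z ^ n * norm (F t)) * t ^ Suc n \<le> (d n * norm z ^ n * norm (F t)) * 1"
          using elim d_pos[of n] by (intro mult_left_mono power_le_one) auto
        then show "norm (of_real (d n) * z ^ n * (of_real t ^ Suc n * F t)) \<le> d n * norm z ^ n * norm (F t)"
          using elim d_pos[of n] by (simp add: norm_mult norm_power mult_ac)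
      qed
      also have "\<dots> \<le> D * norm (F t)" unfolding sum_distrib_right[symmetric] by (intro mult_right_mono D) auto
      finally show ?case .
    qed
  qed measurable
  then have "(\<lambda>N. \<Sum>n<N. \<integral>t. of_real (d n) * z ^ n * (of_real t ^ Suc n * F t) \<partial>\<mu>)
     \<longlonglongrightarrow> (\<integral>t. of_real t * F t * (1 - of_real t * z) powr (- of_real (\<beta> + 1)) \<partial>\<mu>)"
    using int by (subst (asm) Bochner_Integration.integral_sum) auto
  then show ?thesis unfolding trm by (intro sums_mult) (simp add: sums_def)
qed

lemma deriv_hilbert_op:
  assumes "norm z < 1"
  shows "deriv (hilbert_op \<mu> \<beta> f) z
    = of_real \<beta> * (\<integral>t. of_real t * F t * (1 - of_real t * z) powr (- of_real (\<beta> + 1)) \<partial>\<mu>)"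
  using DERIV_imp_deriv[OF has_deriv_hilbert_op[OF assms]] sums_unique[OF deriv_hilbert_op_sums[OF assms]]
  by simp

lemma norm_deriv_hilbert_op_le:
  assumes z: "norm z < 1"
  shows "ennreal (norm (deriv (hilbert_op \<mu> \<beta> f) z))
    \<le> ennreal \<beta> * (\<integral>\<^sup>+t. ennreal (norm (F t) * norm (1 - of_real t * z) powr (- (\<beta> + 1))) \<partial>\<mu>)"
proof -
  let ?K = "\<lambda>t. of_real t * F t * (1 - of_real t * z) powr (- of_real (\<beta> + 1))"
  \<comment> \<open>A non-integrable \<open>?K\<close> has Bochner integral 0, so the bound holds in
    either case.\<close>
  have "ennreal (norm (\<integral>t. ?K t \<partial>\<mu>)) \<le> (\<integral>\<^sup>+t. ennreal (norm (?K t)) \<partial>\<mu>)"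
    by (cases "integrable \<mu> ?K") (auto intro: integral_norm_bound_ennreal simp: not_integrable_integral_eq)
  also have "\<dots> \<le> (\<integral>\<^sup>+t. ennreal (norm (F t) * norm (1 - of_real t * z) powr (- (\<beta> + 1))) \<partial>\<mu>)"
  proof (rule nn_integral_mono_AE)
    show "AE t in \<mu>. ennreal (norm (?K t)) \<le> ennreal (norm (F t) * norm (1 - of_real t * z) powr (- (\<beta> + 1)))"
      using AE_01
    proof eventually_elim
      case (elim t)
      have "1 - of_real t * z \<noteq> 0" using norm_of_real_mult_less_1[OF _ _ z, of t] elim by auto
      then have "norm (?K t) = t * (norm (F t) * norm (1 - of_real t * z) powr (- (\<beta> + 1)))"
        using norm_powr_of_real[of "1 - of_real t * z" "- (\<beta> + 1)"] elim by (simp add: norm_mult)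
      also have "\<dots> \<le> norm (F t) * norm (1 - of_real t * z) powr (- (\<beta> + 1))"
        using elim by (intro mult_left_le_one_le) auto
      finally show ?case by (rule ennreal_leI)
    qed
  qed
  finally show ?thesis using \<beta> by (simp add: deriv_hilbert_op[OF z] norm_mult ennreal_mult' mult_left_mono)
qed

end

section \<open>Coefficient bounds\<close>

text \<open>On this annulus \<open>norm z ^ k\<close> stays above a constant, while the area is
  about \<open>1/N\<close> and the weight about \<open>N powr (- \<alpha>)\<close>. The hypothesis
  \<open>le\<close> abstracts the passage from \<open>|h|\<close> to \<open>|h|^p\<close>, which
  differs for \<open>p \<ge> 1\<close> and \<open>p < 1\<close>.\<close>

lemma taylor_coeff_le_annulus:
  assumes h: "h \<in> bergman_space p \<alpha>" and x: "x \<ge> 0" "y \<ge> 0"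
    and le: "\<And>z. 1 - 2 / (real k + 2) \<le> norm z \<Longrightarrow> norm z < 1 - 1 / (real k + 2) \<Longrightarrow> norm (h z) \<le> x + y * norm (h z) powr p"
  shows "norm (taylor_coeff h k) \<le> 2 * exp 2 * (2 * x + 4 powr \<bar>\<alpha>\<bar> * y * (real k + 2) powr (\<alpha> + 1) * enn2real (bergman_integral p \<alpha> h))"
proof -
  \<comment> \<open>The shift by 2 keeps the inner radius \<open>1 - 2/N\<close> nonnegative also
    for \<open>k = 0\<close>, and makes it equal to \<open>k/(k + 2)\<close>.\<close>
  define N where "N = real k + 2"
  have N: "N \<ge> 2" by (simp add: N_def)
  define A where "A = {z::complex. 1 - 2 / N \<le> norm z \<and> norm z < 1 - 1 / N}"
  have A_borel [measurable]: "A \<in> sets borel" unfolding A_def by measurable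
  have ab: "0 \<le> 1 - 2 / N" "1 - 2 / N \<le> 1 - 1 / N" "1 - 1 / N \<le> 1" using N by (auto simp: field_simps)
  have A1: "norm z < 1" if "z \<in> A" for z using that ab by (auto simp: A_def)
  have sub: "A \<subseteq> ball 0 1" using A1 by auto
  have hh: "h holomorphic_on ball 0 1" and fin: "bergman_integral p \<alpha> h < \<infinity>"
    using h by (auto simp: bergman_space_def)
  define I where "I = enn2real (bergman_integral p \<alpha> h)"
  have I: "bergman_integral p \<alpha> h = ennreal I" "I \<ge> 0" using fin by (auto simp: I_def less_top)
  define \<Psi> where "\<Psi> = (\<lambda>z. norm (h z) powr p * (1 - (norm z)\<^sup>2) powr \<alpha> / pi)"
  have meas: "(\<lambda>z. ennreal (indicator A z * \<Psi> z)) \<in> borel_measurable borel"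
    unfolding \<Psi>_def by (rule borel_measurable_bergman[OF hh sub A_borel])
  \<comment> \<open>\<open>Y\<close> undoes the weight and the normalisation of area: on the annulus
    \<open>1 - |z|^2\<close> is within a factor 4 of \<open>1/N\<close>.\<close>
  define Y where "Y = y * (4 powr \<bar>\<alpha>\<bar> * N powr \<alpha> * pi)"
  have Y: "Y \<ge> 0" using x by (simp add: Y_def)
  define c where "c = norm (taylor_coeff h k)"
  have affine: "(\<integral>\<^sup>+z. ennreal x * indicator A z + ennreal Y * H z \<partial>lborel)
      = ennreal x * emeasure lborel A + ennreal Y * (\<integral>\<^sup>+z. H z \<partial>lborel)"
    if [measurable]: "H \<in> borel_measurable borel" for H
    by (subst nn_integral_add) (simp_all add: nn_integral_cmult nn_integral_cmult_indicator)
  have "ennreal (c * exp (-2) * (pi / (2 * N))) \<le> ennreal (c * exp (-2)) * emeasure lborel A"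
  proof -
    \<comment> \<open>The difference of squares is \<open>(1/N) (2 - 3/N)\<close>, and
      \<open>2 - 3/N \<ge> 1/2\<close> because \<open>N \<ge> 2\<close>.\<close>
    have "pi / (2 * N) \<le> pi * ((1 - 1 / N)\<^sup>2 - (1 - 2 / N)\<^sup>2)"
      using N by (simp add: field_simps power2_eq_square)
    then have "ennreal (pi / (2 * N)) \<le> emeasure lborel A"
      unfolding A_def emeasure_annulus[OF ab(1,2)] by (rule ennreal_leI)
    moreover have "ennreal (c * exp (-2) * (pi / (2 * N))) = ennreal (c * exp (-2)) * ennreal (pi / (2 * N))"
      using N by (intro ennreal_mult) (auto simp: c_def)
    ultimately show ?thesis by (simp only: mult_left_mono zero_le)
  qed
  also have "\<dots> = (\<integral>\<^sup>+z. ennreal (c * exp (-2)) * indicator A z \<partial>lborel)"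
    by (simp add: nn_integral_cmult_indicator)
  also have "\<dots> \<le> (\<integral>\<^sup>+z. ennreal (indicator A z * (c * norm z ^ k)) \<partial>lborel)"
  proof (intro nn_integral_mono)
    fix z :: complex
    show "ennreal (c * exp (-2)) * indicator A z \<le> ennreal (indicator A z * (c * norm z ^ k))"
    proof (cases "z \<in> A")
      case True
      \<comment> \<open>For \<open>k > 0\<close> the number \<open>1 - 2/N\<close> is the inverse of
        \<open>1 + 2/k\<close>, so the claim is \<open>(1 + 2/k) ^ k \<le> exp 2\<close>.\<close>
      have "exp (-2) \<le> (1 - 2 / N) ^ k"
      proof (cases "k = 0")
        case False
        have "(1 + 2 / real k) ^ k \<le> exp 2" using False by (intro exp_ge_one_plus_x_over_n_power_n) auto
        moreover have "1 - 2 / N = inverse (1 + 2 / real k)" using False by (simp add: N_def field_simps)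
        moreover have "(1 + 2 / real k) ^ k > 0" by (intro zero_less_power add_pos_nonneg) auto
        ultimately show ?thesis by (simp add: exp_minus power_inverse le_imp_inverse_le)
      qed auto
      also have "\<dots> \<le> norm z ^ k" using True ab by (intro power_mono) (auto simp: A_def)
      finally show ?thesis using True by (auto simp: c_def intro!: ennreal_leI mult_left_mono)
    qed auto
  qed
  also have "\<dots> \<le> (\<integral>\<^sup>+z. ennreal (indicator A z * norm (h z)) \<partial>lborel)"
    unfolding c_def by (rule taylor_coeff_area_le[OF hh A_borel sub]) (auto simp: A_def norm_mult)
  also have "\<dots> \<le> (\<integral>\<^sup>+z. ennreal x * indicator A z + ennreal Y * ennreal (indicator A z * \<Psi> z) \<partial>lborel)"
  proof (intro nn_integral_mono)
    fix z :: complex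
    show "ennreal (indicator A z * norm (h z)) \<le> ennreal x * indicator A z + ennreal Y * ennreal (indicator A z * \<Psi> z)"
    proof (cases "z \<in> A")
      case True
      then have z: "1 / N \<le> 1 - norm z" "1 - norm z \<le> 2 / N" by (auto simp: A_def)
      have N0: "0 < 1 / N" using N by simp
      have "(1 / N) powr \<alpha> \<le> 4 powr \<bar>\<alpha>\<bar> * (1 - (norm z)\<^sup>2) powr \<alpha>"
        
      proof (rule powr_le_of_ratio)
        note w = one_minus_norm_sq_bounds[OF A1[OF True]]
        have "1 / N \<le> 1 - (norm z)\<^sup>2" using w(1) z(1) by (rule order_trans[rotated])
        moreover have "1 - (norm z)\<^sup>2 \<le> 2 * (2 / N)"
          using w(2) z(2) by (meson mult_left_mono order_trans zero_le_numeral)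
        ultimately show "1 / N \<le> 4 * (1 - (norm z)\<^sup>2)" "1 - (norm z)\<^sup>2 \<le> 4 * (1 / N)" "0 < 1 - (norm z)\<^sup>2"
          using w(3) by simp_all
      qed (use N0 in simp_all)
      then have "1 \<le> 4 powr \<bar>\<alpha>\<bar> * N powr \<alpha> * (1 - (norm z)\<^sup>2) powr \<alpha>"
        using N by (simp add: powr_divide field_simps)
      then have "y * norm (h z) powr p * 1 \<le> y * norm (h z) powr p * (4 powr \<bar>\<alpha>\<bar> * N powr \<alpha> * (1 - (norm z)\<^sup>2) powr \<alpha>)"
        using x by (intro mult_left_mono) auto
      also have "\<dots> = Y * \<Psi> z" by (simp add: Y_def \<Psi>_def)
      finally have "norm (h z) \<le> x + Y * \<Psi> z"
        using le[of z] True by (simp add: A_def N_def)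
      then show ?thesis using True x Y
        by (simp add: \<Psi>_def ennreal_leI flip: ennreal_mult ennreal_plus)
    qed auto
  qed
  also have "\<dots> = ennreal x * emeasure lborel A + ennreal Y * (\<integral>\<^sup>+z. ennreal (indicator A z * \<Psi> z) \<partial>lborel)"
    by (rule affine[OF meas])
  also have "\<dots> \<le> ennreal x * ennreal (2 * pi * (1 / N)) + ennreal Y * ennreal I"
  proof (intro add_mono mult_left_mono)
    show "emeasure lborel A \<le> ennreal (2 * pi * (1 / N))"
      using emeasure_annulus_le[OF ab] unfolding A_def by simp
    show "(\<integral>\<^sup>+z. ennreal (indicator A z * \<Psi> z) \<partial>lborel) \<le> ennreal I"
      unfolding I(1)[symmetric] bergman_integral_def \<Psi>_def
      using sub by (intro nn_integral_mono ennreal_leI) (auto simp: indicator_def)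
  qed auto
  also have "\<dots> = ennreal (x * (2 * pi * (1 / N)) + Y * I)"
  proof -
    have w: "0 \<le> 2 * pi * (1 / N)" using N by simp
    show ?thesis
      unfolding ennreal_mult[OF x(1) w, symmetric] ennreal_mult[OF Y I(2), symmetric]
      by (rule ennreal_plus[symmetric, OF mult_nonneg_nonneg[OF x(1) w] mult_nonneg_nonneg[OF Y I(2)]])
  qed
  finally have "c * exp (-2) * (pi / (2 * N)) \<le> x * (2 * pi * (1 / N)) + Y * I"
    using x Y I N by (subst (asm) ennreal_le_iff) auto
  then have "(2 * exp 2 * N / pi) * (c * exp (-2) * (pi / (2 * N))) \<le> (2 * exp 2 * N / pi) * (x * (2 * pi * (1 / N)) + Y * I)"
    using N by (intro mult_left_mono) auto
  also have "(2 * exp 2 * N / pi) * (c * exp (-2) * (pi / (2 * N))) = c * (exp 2 * exp (-2))"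
    using N by simp
  also have "exp 2 * exp (-2) = (1::real)" by (simp flip: exp_add)
  also have "(2 * exp 2 * N / pi) * (x * (2 * pi * (1 / N)) + Y * I)
     = 2 * exp 2 * (2 * x + 4 powr \<bar>\<alpha>\<bar> * y * (N powr \<alpha> * N) * I)"
    using N by (simp add: Y_def field_simps)
  also have "N powr \<alpha> * N = N powr (\<alpha> + 1)" using N by (simp add: powr_add)
  finally show ?thesis by (simp add: c_def N_def I_def)
qed

text \<open>Hardy-Littlewood growth exponents for Taylor coefficients of Bergman functions; the two
  formulas agree at \<open>p = 1\<close>.\<close>

definition coeff_exponent :: "real \<Rightarrow> real \<Rightarrow> real" where
  "coeff_exponent p \<alpha> = (if p \<ge> 1 then (\<alpha> + 1) / p else (\<alpha> + 2) / p - 1)"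

text \<open>For \<open>p \<ge> 1\<close> the two terms of the annulus bound balance at
  \<open>x = N powr \<tau>\<close>. For \<open>p < 1\<close> the additive term is 0: pointwise
  growth bounds \<open>|h|\<close> by \<open>M\<close> on the annulus, and
  \<open>M powr (1 - p)\<close> pays for passing to \<open>|h|^p\<close>.\<close>

lemma bergman_coeff_bound:
  assumes p: "p > 0" and h: "h \<in> bergman_space p \<alpha>"
  shows "\<exists>C\<ge>0. \<forall>k. norm (taylor_coeff h k) \<le> C * (real k + 2) powr coeff_exponent p \<alpha>"
proof -
  define I where "I = enn2real (bergman_integral p \<alpha> h)"
  have I: "I \<ge> 0" by (simp add: I_def)
  define \<tau> where "\<tau> = coeff_exponent p \<alpha>"
  show ?thesis
  proof (cases "p \<ge> 1")
    case True
    have "norm (taylor_coeff h k) \<le> 2 * exp 2 * (2 + 4 powr \<bar>\<alpha>\<bar> * I) * (real k + 2) powr \<tau>" for k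
    proof -
      define N where "N = real k + 2"
      have N: "N > 0" by (simp add: N_def)
      have "norm (taylor_coeff h k) \<le> 2 * exp 2 * (2 * N powr \<tau> + 4 powr \<bar>\<alpha>\<bar> * (N powr \<tau>) powr (1 - p) * N powr (\<alpha> + 1) * I)"
        unfolding N_def I_def using N
        by (intro taylor_coeff_le_annulus[OF h] le_add_powr[OF True]) (auto simp: N_def)
      also have "4 powr \<bar>\<alpha>\<bar> * (N powr \<tau>) powr (1 - p) * N powr (\<alpha> + 1) * I = 4 powr \<bar>\<alpha>\<bar> * N powr (\<tau> * (1 - p) + (\<alpha> + 1)) * I"
        by (simp add: powr_powr powr_add)
      also have "\<tau> * (1 - p) + (\<alpha> + 1) = \<tau>" using True by (simp add: \<tau>_def coeff_exponent_def field_simps)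
      finally show ?thesis by (simp add: N_def algebra_simps)
    qed
    then show ?thesis using I unfolding \<tau>_def by (intro exI[of _ "2 * exp 2 * (2 + 4 powr \<bar>\<alpha>\<bar> * I)"]) auto
  next
    case False
    have hh: "h holomorphic_on ball 0 1" and fin: "bergman_integral p \<alpha> h = ennreal I"
      using h by (auto simp: bergman_space_def I_def less_top)
    obtain Cg where Cg: "Cg > 0" "\<And>h a. h holomorphic_on ball 0 1 \<Longrightarrow> norm a < 1 \<Longrightarrow>
      ennreal (norm (h a) powr p * (1 - norm a) powr (\<alpha> + 2)) \<le> ennreal Cg * bergman_integral p \<alpha> h"
      using bergman_growth[OF p, of \<alpha>] by blast
    define Q where "Q = Cg * I"
    have Q: "Q \<ge> 0" using Cg(1) I by (simp add: Q_def)
    have "norm (taylor_coeff h k) \<le> 2 * exp 2 * (4 powr \<bar>\<alpha>\<bar> * (2 powr \<bar>\<alpha> + 2\<bar> * Q) powr ((1 - p) / p) * I) * (real k + 2) powr \<tau>" for k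
    proof -
      define N where "N = real k + 2"
      have N: "N \<ge> 2" by (simp add: N_def)
      \<comment> \<open>The growth estimate at distance about \<open>1/N\<close> from the circle,
        solved for \<open>|h|\<close>; the power of 2 is the cost of comparing
        \<open>1 - |z|\<close> with \<open>1/N\<close>.\<close>
      define M where "M = (2 powr \<bar>\<alpha> + 2\<bar> * Q * N powr (\<alpha> + 2)) powr (1 / p)"
      have hM: "norm (h z) \<le> 0 + M powr (1 - p) * norm (h z) powr p"
        if z: "1 - 2 / N \<le> norm z" "norm z < 1 - 1 / N" for z
      proof (cases "h z = 0")
        case False
        have N0: "1 / N > 0" using N by simp
        then have z1: "norm z < 1" using z by linarith
        have "ennreal (norm (h z) powr p * (1 - norm z) powr (\<alpha> + 2)) \<le> ennreal Q"
          using Cg(2)[OF hh z1] Cg(1) I by (simp add: fin Q_def flip: ennreal_mult)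
        then have 1: "norm (h z) powr p * (1 - norm z) powr (\<alpha> + 2) \<le> Q"
          using Q by (subst (asm) ennreal_le_iff) auto
        have "(1 / N) powr (\<alpha> + 2) \<le> 2 powr \<bar>\<alpha> + 2\<bar> * (1 - norm z) powr (\<alpha> + 2)"
          using z N0 by (intro powr_le_of_ratio) auto
        then have "norm (h z) powr p * (1 / N) powr (\<alpha> + 2) \<le> norm (h z) powr p * (2 powr \<bar>\<alpha> + 2\<bar> * (1 - norm z) powr (\<alpha> + 2))"
          by (intro mult_left_mono) auto
        also have "\<dots> \<le> 2 powr \<bar>\<alpha> + 2\<bar> * Q" using mult_left_mono[OF 1, of "2 powr \<bar>\<alpha> + 2\<bar>"] by (simp add: mult_ac)
        finally have "norm (h z) powr p \<le> 2 powr \<bar>\<alpha> + 2\<bar> * Q * N powr (\<alpha> + 2)"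
          using N by (simp add: powr_divide pos_divide_le_eq)
        then have "(norm (h z) powr p) powr (1 / p) \<le> M"
          unfolding M_def using p by (intro powr_mono2) auto
        then have "norm (h z) \<le> M" using p by (simp add: powr_powr)
        then have "norm (h z) powr (1 - p) * norm (h z) powr p \<le> M powr (1 - p) * norm (h z) powr p"
          using \<open>\<not> p \<ge> 1\<close> by (intro mult_right_mono powr_mono2) auto
        then show ?thesis using False by (simp flip: powr_add)
      qed auto
      have "norm (taylor_coeff h k) \<le> 2 * exp 2 * (2 * 0 + 4 powr \<bar>\<alpha>\<bar> * M powr (1 - p) * N powr (\<alpha> + 1) * I)"
        unfolding N_def I_def using hM
        by (intro taylor_coeff_le_annulus[OF h]) (auto simp: N_def)
      also have "M powr (1 - p) = (2 powr \<bar>\<alpha> + 2\<bar> * Q) powr ((1 - p) / p) * N powr ((\<alpha> + 2) * ((1 - p) / p))"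
        unfolding M_def using Q by (simp add: powr_mult powr_powr)
      also have "2 * exp 2 * (2 * 0 + 4 powr \<bar>\<alpha>\<bar> * ((2 powr \<bar>\<alpha> + 2\<bar> * Q) powr ((1 - p) / p) * N powr ((\<alpha> + 2) * ((1 - p) / p))) * N powr (\<alpha> + 1) * I)
        = 2 * exp 2 * (4 powr \<bar>\<alpha>\<bar> * (2 powr \<bar>\<alpha> + 2\<bar> * Q) powr ((1 - p) / p) * I) * N powr ((\<alpha> + 2) * ((1 - p) / p) + (\<alpha> + 1))"
        by (simp only: powr_add) (simp add: mult_ac)
      also have "(\<alpha> + 2) * ((1 - p) / p) + (\<alpha> + 1) = \<tau>"
        using False p by (simp add: \<tau>_def coeff_exponent_def field_simps)
      finally show ?thesis by (simp add: N_def)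
    qed
    then show ?thesis using I unfolding \<tau>_def
      by (intro exI[of _ "2 * exp 2 * (4 powr \<bar>\<alpha>\<bar> * (2 powr \<bar>\<alpha> + 2\<bar> * Q) powr ((1 - p) / p) * I)"]) auto
  qed
qed

text \<open>Decay in \<open>n\<close> is traded for a blow-up at \<open>t = 1\<close>. This combines
  \<open>t ^ n \<le> exp (- n (1 - t))\<close> with \<open>y \<le> exp y\<close> at
  \<open>y = n (1 - t) / s\<close>.\<close>

lemma power_mult_powr_le:
  fixes t s :: real
  assumes t: "0 \<le> t" "t < 1" and s: "s > 0" and n: "n > 0"
  shows "t ^ n \<le> s powr s * real n powr (- s) * (1 - t) powr (- s)"
proof -
  define x where "x = 1 - t"
  have x: "x > 0" using t by (simp add: x_def)
  define y where "y = real n * x / s"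
  have y: "y > 0" using x n s by (simp add: y_def)
  have "y \<le> exp y" using exp_ge_add_one_self[of y] by linarith
  then have "y powr s \<le> (exp y) powr s" using y s by (intro powr_mono2) auto
  also have "\<dots> = exp (real n * x)" using s by (simp add: exp_powr_real y_def)
  finally have 1: "y powr s \<le> exp (real n * x)" .
  have "t \<le> exp (- x)" using exp_ge_add_one_self[of "- x"] by (simp add: x_def)
  then have "t ^ n \<le> exp (- x) ^ n" using t by (intro power_mono) auto
  also have "\<dots> = exp (real n * (- x))" by (simp only: exp_of_nat_mult)
  also have "\<dots> = inverse (exp (real n * x))" by (simp add: exp_minus)
  also have "\<dots> \<le> inverse (y powr s)" using 1 y by (intro le_imp_inverse_le) auto
  also have "\<dots> = s powr s * real n powr (- s) * x powr (- s)"
    using s x n by (simp add: y_def powr_divide powr_mult powr_minus field_simps)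
  finally show ?thesis by (simp add: x_def)
qed

lemma taylor_coeff_deriv: "taylor_coeff (deriv f) k = of_nat (Suc k) * taylor_coeff f (Suc k)"
proof -
  have "(deriv ^^ k) (deriv f) = (deriv ^^ Suc k) f" by (simp add: funpow_swap1)
  then show ?thesis unfolding taylor_coeff_def fact_Suc of_nat_mult by (simp del: of_nat_Suc)
qed

text \<open>The coefficients of \<open>f\<close> are of order \<open>k powr (\<tau> - 1)\<close>.
  Trading \<open>t ^ k\<close> for \<open>k powr (- s') * (1 - t) powr (- s')\<close> leaves a
  series that converges because \<open>s' > \<tau>\<close>, and a function that is
  \<open>\<mu>\<close>-integrable because \<open>s' < s\<close>.\<close>

lemma dirichlet_majorant:
  assumes p: "p > 0" and \<tau>: "0 \<le> coeff_exponent p \<alpha>" "coeff_exponent p \<alpha> < s"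
    and f: "f \<in> dirichlet_space p \<alpha>"
    and c: "carleson \<mu> s" and sets [measurable_cong]: "sets \<mu> = sets borel"
  shows "\<exists>\<Phi>. integrable \<mu> \<Phi> \<and> (\<forall>t n. 0 \<le> t \<longrightarrow> t < 1 \<longrightarrow> (\<Sum>k<n. norm (taylor_coeff f k) * t ^ k) \<le> \<Phi> t)"
proof -
  define \<tau> where "\<tau> = coeff_exponent p \<alpha>"
  define s' where "s' = (\<tau> + s) / 2"
  have s': "\<tau> < s'" "s' < s" "0 < s'" using \<tau> by (auto simp: s'_def \<tau>_def)
  have df: "deriv f \<in> bergman_space p \<alpha>" using f by (auto simp: dirichlet_space_def)
  obtain C where C: "C \<ge> 0" "\<And>k. norm (taylor_coeff (deriv f) k) \<le> C * (real k + 2) powr \<tau>"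
    using bergman_coeff_bound[OF p df] unfolding \<tau>_def by blast
  have a: "norm (taylor_coeff f (Suc k)) \<le> C * 2 powr \<tau> * real (Suc k) powr (\<tau> - 1)" for k
  proof -
    have "(real k + 2) powr \<tau> \<le> (2 * real (Suc k)) powr \<tau>"
      using \<tau> by (intro powr_mono2) (auto simp: \<tau>_def)
    then have "C * (real k + 2) powr \<tau> \<le> C * (2 * real (Suc k)) powr \<tau>" using C(1) by (intro mult_left_mono)
    then have "real (Suc k) * norm (taylor_coeff f (Suc k)) \<le> C * (2 powr \<tau> * real (Suc k) powr \<tau>)"
      using C(2)[of k] unfolding taylor_coeff_deriv norm_mult norm_of_nat powr_mult by linarith
    then show ?thesis by (simp add: powr_diff field_simps del: of_nat_Suc)
  qed
  define Z where "Z = (\<Sum>k. real (Suc k) powr (\<tau> - 1 - s'))"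
  have sZ: "summable (\<lambda>k. real (Suc k) powr (\<tau> - 1 - s'))"
    using s' by (subst summable_Suc_iff) (simp add: summable_real_powr_iff)
  have Z: "(\<Sum>k<n. real (Suc k) powr (\<tau> - 1 - s')) \<le> Z" for n
    unfolding Z_def by (intro sum_le_suminf sZ) auto
  have Z0: "Z \<ge> 0" using Z[of 0] by simp
  define W where "W = norm (taylor_coeff f 0) + C * 2 powr \<tau> * s' powr s' * Z"
  define \<Phi> where "\<Phi> = (\<lambda>t. W * (indicator {0..<1} t * (1 - t) powr (- s')))"
  have "(\<Sum>k<n. norm (taylor_coeff f k) * t ^ k) \<le> \<Phi> t" if t: "0 \<le> t" "t < 1" for t n
  proof -
    define x where "x = (1 - t) powr (- s')"
    have x: "x \<ge> 1"
    proof -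
      have "1 powr (- s') \<le> (1 - t) powr (- s')" using t s' by (intro powr_mono2') auto
      then show ?thesis by (simp add: x_def)
    qed
    have "(\<Sum>k<n. norm (taylor_coeff f k) * t ^ k) \<le> (\<Sum>k<Suc n. norm (taylor_coeff f k) * t ^ k)"
      using t by simp
    also have "\<dots> = norm (taylor_coeff f 0) + (\<Sum>k<n. norm (taylor_coeff f (Suc k)) * t ^ Suc k)"
      by (subst sum.lessThan_Suc_shift) simp
    also have "\<dots> \<le> norm (taylor_coeff f 0) * x + (\<Sum>k<n. (C * 2 powr \<tau> * s' powr s') * x * real (Suc k) powr (\<tau> - 1 - s'))"
    proof (intro add_mono sum_mono)
      show "norm (taylor_coeff f 0) \<le> norm (taylor_coeff f 0) * x"
        using mult_left_mono[OF x, of "norm (taylor_coeff f 0)"] by simp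
      fix k
      have "norm (taylor_coeff f (Suc k)) * t ^ Suc k
        \<le> (C * 2 powr \<tau> * real (Suc k) powr (\<tau> - 1)) * (s' powr s' * real (Suc k) powr (- s') * x)"
        unfolding x_def using C(1) t s' by (intro mult_mono a power_mult_powr_le) auto
      also have "\<dots> = (C * 2 powr \<tau> * s' powr s') * x * (real (Suc k) powr (\<tau> - 1) * real (Suc k) powr (- s'))"
        by (simp only: mult_ac)
      finally show "norm (taylor_coeff f (Suc k)) * t ^ Suc k \<le> (C * 2 powr \<tau> * s' powr s') * x * real (Suc k) powr (\<tau> - 1 - s')"
        by (simp only: powr_add[symmetric] add_uminus_conv_diff)
    qed
    also have "\<dots> = norm (taylor_coeff f 0) * x + (C * 2 powr \<tau> * s' powr s') * x * (\<Sum>k<n. real (Suc k) powr (\<tau> - 1 - s'))"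
      by (simp only: sum_distrib_left)
    also have "\<dots> \<le> norm (taylor_coeff f 0) * x + (C * 2 powr \<tau> * s' powr s') * x * Z"
      using C(1) x by (intro add_left_mono mult_left_mono Z) auto
    also have "\<dots> = \<Phi> t" using t by (simp add: \<Phi>_def W_def x_def algebra_simps)
    finally show ?thesis .
  qed
  moreover have "integrable \<mu> \<Phi>"
    unfolding \<Phi>_def
  proof (intro integrable_mult_right integrableI_nonneg)
    show "(\<integral>\<^sup>+t. ennreal (indicator {0..<1} t * (1 - t) powr (- s')) \<partial>\<mu>) < \<infinity>"
      using s' by (intro carleson_integral_finite[OF c sets]) auto
  qed auto
  ultimately show ?thesis by blast
qed

section \<open>Sufficiency\<close>

text \<open>Together the bounds say that \<open>norm (1 - t z)\<close> is at least of order
  \<open>max (1 - t) (norm (1 - z))\<close>, dyadically \<open>2^(- min j m)\<close>. The factor 2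
  comes from absorbing \<open>(1 - t) z\<close> by the first bound.\<close>

lemma norm_one_minus_mult_ge:
  assumes "0 \<le> t" "t < 1" "norm (z::complex) < 1"
  shows "1 - t \<le> norm (1 - of_real t * z)" "norm (1 - z) / 2 \<le> norm (1 - of_real t * z)"
proof -
  have tz: "t * norm z \<le> t" using assms mult_left_mono[of "norm z" 1 t] by simp
  then show 1: "1 - t \<le> norm (1 - of_real t * z)"
    using norm_triangle_ineq2[of 1 "of_real t * z"] assms by (simp add: norm_mult)
  have "norm (1 - z) = norm ((1 - of_real t * z) - of_real (1 - t) * z)" by (simp add: algebra_simps)
  also have "\<dots> \<le> norm (1 - of_real t * z) + norm (of_real (1 - t) * z)" by (rule norm_triangle_ineq4)
  also have "norm (of_real (1 - t) * z) = (1 - t) * norm z" using assms by (simp only: norm_mult norm_of_real)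
  also have "(1 - t) * norm z \<le> 1 - t" using assms mult_left_mono[of "norm z" 1 "1 - t"] by simp
  finally show "norm (1 - z) / 2 \<le> norm (1 - of_real t * z)" using 1 by simp
qed

context hankel_setup
begin

text \<open>On block \<open>j\<close>, \<open>|F|\<close> is at most \<open>2^(j g) V_j\<close>, the
  kernel at most \<open>\<kappa> j\<close>, and the mass at most that of the whole tail. The kernel
  is abstract because the value at 0 and the derivative are both estimated this way.\<close>

lemma nn_integral_F_dyadic_le:
  assumes V: "dyadic_bound f g V" "\<And>j. V j \<ge> 0" and C: "C > 0"
    "\<And>j::nat. emeasure \<mu> {1 - 2 powr (- real j)..<1} \<le> ennreal (C * 2 powr (- real j * s))"
    and k: "\<And>t. 0 \<le> t \<Longrightarrow> t < 1 \<Longrightarrow> k t \<ge> 0"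
      "\<And>j t. 2 powr (- real j - 1) \<le> 1 - t \<Longrightarrow> 1 - t \<le> 2 powr (- real j) \<Longrightarrow> k t \<le> \<kappa> j" "\<And>j. \<kappa> j \<ge> 0"
  shows "(\<integral>\<^sup>+t. ennreal (norm (F t) * k t) \<partial>\<mu>) \<le> (\<Sum>j. ennreal (C * (2 powr (real j * (g - s)) * \<kappa> j * V j)))"
proof -
  have "(\<integral>\<^sup>+t. ennreal (norm (F t) * k t) \<partial>\<mu>)
    \<le> (\<Sum>j. (\<integral>\<^sup>+t. ennreal (2 powr (real j * g) * V j * \<kappa> j) * indicator {1 - 2 powr (- real j)..<1} t \<partial>\<mu>))"
  proof (rule nn_integral_le_suminf)
    fix t :: real
    show "\<exists>j. ennreal (norm (F t) * k t) \<le> ennreal (2 powr (real j * g) * V j * \<kappa> j) * indicator {1 - 2 powr (- real j)..<1} t"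
    proof (cases "0 \<le> t \<and> t < 1")
      case True
      then obtain j :: nat where j: "2 powr (- real j - 1) < 1 - t" "1 - t \<le> 2 powr (- real j)"
        using ex_dyadic[of "1 - t"] by auto
      have "norm (F t) \<le> 2 powr (real j * g) * V j"
        using V(1) j True by (simp add: F_eq dyadic_bound_def)
      then have "norm (F t) * k t \<le> 2 powr (real j * g) * V j * \<kappa> j"
        using k(1)[of t] k(2)[of j t] j True V(2)[of j] by (intro mult_mono) auto
      then show ?thesis using j True by (intro exI[of _ j]) (auto intro: ennreal_leI)
    qed (auto simp: F_def)
  qed measurable
  also have "\<dots> = (\<Sum>j. ennreal (2 powr (real j * g) * V j * \<kappa> j) * emeasure \<mu> {1 - 2 powr (- real j)..<1})"
    by (simp add: nn_integral_cmult_indicator sets_\<mu>)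
  also have "\<dots> \<le> (\<Sum>j. ennreal (C * (2 powr (real j * (g - s)) * \<kappa> j * V j)))"
  proof (intro suminf_le)
    fix j
    have "ennreal (2 powr (real j * g) * V j * \<kappa> j) * emeasure \<mu> {1 - 2 powr (- real j)..<1}
      \<le> ennreal (2 powr (real j * g) * V j * \<kappa> j) * ennreal (C * 2 powr (- real j * s))"
      by (intro mult_left_mono C) auto
    also have "\<dots> = ennreal (C * ((2 powr (real j * g) * 2 powr (- real j * s)) * \<kappa> j * V j))"
      using C(1) V(2)[of j] k(3)[of j] by (subst ennreal_mult[symmetric]) (auto simp: mult_ac)
    also have "2 powr (real j * g) * 2 powr (- real j * s) = (2::real) powr (real j * (g - s))"
      by (simp add: algebra_simps flip: powr_add)
    finally show "ennreal (2 powr (real j * g) * V j * \<kappa> j) * emeasure \<mu> {1 - 2 powr (- real j)..<1}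
      \<le> ennreal (C * (2 powr (real j * (g - s)) * \<kappa> j * V j))" .
  qed auto
  finally show ?thesis .
qed

lemma norm_hilbert_op_0_le: "ennreal (norm (hilbert_op \<mu> \<beta> f 0)) \<le> (\<integral>\<^sup>+t. ennreal (norm (F t)) \<partial>\<mu>)"
  unfolding hilbert_op_0 using integrable_F by (rule integral_norm_bound_ennreal)

end

text \<open>In either case the exponent is rewritten exactly; the base \<open>b\<close> only has to
  dominate both decay bases.\<close>

lemma dyadic_exponent_le_dist_kernel:
  fixes G q b :: real
  assumes b: "0 < b" "2 powr (- (G / q)) \<le> b" "2 powr (- (G * (1 - 1 / q))) \<le> b"
  shows "2 powr (- real j * (G * (1 - 1 / q)) + real (min j m) * G) \<le> 2 powr (real m * (G / q)) * dist_kernel b m j"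
proof (cases "j \<le> m")
  case True
  have "- real j * (G * (1 - 1 / q)) + real (min j m) * G = real m * (G / q) + - real (m - j) * (G / q)"
    using True by (simp add: of_nat_diff algebra_simps)
  then have "2 powr (- real j * (G * (1 - 1 / q)) + real (min j m) * G) = 2 powr (real m * (G / q)) * (2 powr (- (G / q))) ^ (m - j)"
    by (simp only: powr_add two_powr_neg_mult)
  also have "\<dots> \<le> 2 powr (real m * (G / q)) * b ^ (m - j)"
    using b by (intro mult_left_mono power_mono) auto
  finally show ?thesis using True by (simp add: dist_kernel_def)
next
  case False
  have "- real j * (G * (1 - 1 / q)) + real (min j m) * G = real m * (G / q) + - real (j - m) * (G * (1 - 1 / q))"
    using False by (simp add: of_nat_diff algebra_simps)
  then have "2 powr (- real j * (G * (1 - 1 / q)) + real (min j m) * G) = 2 powr (real m * (G / q)) * (2 powr (- (G * (1 - 1 / q)))) ^ (j - m)"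
    by (simp only: powr_add two_powr_neg_mult)
  also have "\<dots> \<le> 2 powr (real m * (G / q)) * b ^ (j - m)"
    using b by (intro mult_left_mono power_mono) auto
  finally show ?thesis using False by (simp add: dist_kernel_def)
qed

lemma hilbert_op_dyadic_bounds:
  assumes h: "hankel_setup \<mu> \<beta> f \<Phi>" and q: "q \<ge> 1"
    and b: "0 < b" "b < 1" "2 powr (- ((\<beta> + 1) / q)) \<le> b" "2 powr (- ((\<beta> + 1) * (1 - 1 / q))) \<le> b"
    and V: "dyadic_bound f g V" "\<And>j. V j \<ge> 0" "summable (\<lambda>j. V j powr q)"
    and C: "C > 0" "\<And>j::nat. emeasure \<mu> {1 - 2 powr (- real j)..<1} \<le> ennreal (C * 2 powr (- real j * s))"
    and s: "s = g + (\<beta> + 1) * (1 - 1 / q)"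
  defines "U \<equiv> \<lambda>m. \<Sum>j. dist_kernel b m j * V j"
  shows "norm (hilbert_op \<mu> \<beta> f 0) \<le> C * U 0"
    and "\<And>m z. norm z < 1 \<Longrightarrow> 2 powr (- real m) \<le> norm (1 - z) \<Longrightarrow>
      norm (deriv (hilbert_op \<mu> \<beta> f) z) \<le> \<beta> * C * 2 powr (\<beta> + 1) * 2 powr (real m * ((\<beta> + 1) / q)) * U m"
proof -
  interpret hankel_setup \<mu> \<beta> f \<Phi> by (rule h)
  define G where "G = \<beta> + 1"
  have G: "G > 0" using \<beta> by (simp add: G_def)
  have sU: "summable (\<lambda>j. dist_kernel b m j * V j)" for m
    by (rule dist_kernel_convolution(1)[OF b(1,2) q V(2,3)])
  have kV: "dist_kernel b m j * V j \<ge> 0" for m j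
    using dist_kernel_pos[OF b(1), of m j] V(2)[of j] by (intro mult_nonneg_nonneg) auto
  have U0: "U m \<ge> 0" for m unfolding U_def by (intro suminf_nonneg sU kV)
  have gs: "real j * (g - s) = - real j * (G * (1 - 1 / q))" for j
  proof -
    have "g - s = - (G * (1 - 1 / q))" by (simp add: s G_def)
    then show ?thesis by simp
  qed
  have bound: "(\<integral>\<^sup>+t. ennreal (norm (F t) * k t) \<partial>\<mu>) \<le> ennreal (C * c * 2 powr (real m * (G / q)) * U m)"
    if k: "\<And>t. 0 \<le> t \<Longrightarrow> t < 1 \<Longrightarrow> k t \<ge> 0" and c: "c \<ge> 0"
      and le: "\<And>j t. 2 powr (- real j - 1) \<le> 1 - t \<Longrightarrow> 1 - t \<le> 2 powr (- real j) \<Longrightarrow> k t \<le> c * 2 powr (real (min j m) * G)" for k c m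
  proof -
    have "(\<integral>\<^sup>+t. ennreal (norm (F t) * k t) \<partial>\<mu>)
      \<le> (\<Sum>j. ennreal (C * (2 powr (real j * (g - s)) * (c * 2 powr (real (min j m) * G)) * V j)))"
      using k c le by (intro nn_integral_F_dyadic_le V(1,2) C) auto
    also have "\<dots> \<le> (\<Sum>j. ennreal (C * c * 2 powr (real m * (G / q)) * (dist_kernel b m j * V j)))"
    proof (intro suminf_le ennreal_leI)
      fix j
      have "C * (2 powr (real j * (g - s)) * (c * 2 powr (real (min j m) * G)) * V j)
        = C * c * V j * 2 powr (- real j * (G * (1 - 1 / q)) + real (min j m) * G)"
        unfolding gs powr_add by simp
      also have "\<dots> \<le> C * c * V j * (2 powr (real m * (G / q)) * dist_kernel b m j)"
        using b C(1) c V(2)[of j] unfolding G_def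
        by (intro mult_left_mono dyadic_exponent_le_dist_kernel) auto
      finally show "C * (2 powr (real j * (g - s)) * (c * 2 powr (real (min j m) * G)) * V j)
        \<le> C * c * 2 powr (real m * (G / q)) * (dist_kernel b m j * V j)" by (simp only: mult_ac)
    qed auto
    also have "\<dots> = ennreal (\<Sum>j. C * c * 2 powr (real m * (G / q)) * (dist_kernel b m j * V j))"
      using C(1) c kV by (intro suminf_ennreal2 summable_mult sU) auto
    also have "\<dots> = ennreal (C * c * 2 powr (real m * (G / q)) * U m)"
      unfolding U_def by (subst suminf_mult[OF sU]) simp
    finally show ?thesis .
  qed
  \<comment> \<open>For \<open>m = 0\<close> the power of 2 in the kernel bound is 1, so the
    constant kernel 1 fits, and the value at 0 is controlled by \<open>U 0\<close>.\<close>
  have "ennreal (norm (hilbert_op \<mu> \<beta> f 0)) \<le> ennreal (C * U 0)"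
    using norm_hilbert_op_0_le bound[of "\<lambda>_. 1" 1 0] by simp
  then show "norm (hilbert_op \<mu> \<beta> f 0) \<le> C * U 0" using C(1) U0[of 0] by simp
  fix m and z :: complex assume z: "norm z < 1" "2 powr (- real m) \<le> norm (1 - z)"
  have "ennreal (norm (deriv (hilbert_op \<mu> \<beta> f) z))
    \<le> ennreal \<beta> * (\<integral>\<^sup>+t. ennreal (norm (F t) * norm (1 - of_real t * z) powr (- G)) \<partial>\<mu>)"
    unfolding G_def by (rule norm_deriv_hilbert_op_le[OF z(1)])
  also have "\<dots> \<le> ennreal \<beta> * ennreal (C * 2 powr G * 2 powr (real m * (G / q)) * U m)"
  proof (intro mult_left_mono bound)
    fix j :: nat and t :: real
    assume t: "2 powr (- real j - 1) \<le> 1 - t" "1 - t \<le> 2 powr (- real j)"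
    have "(2::real) powr (- real j) \<le> 2 powr 0" by (intro powr_mono) auto
    then have "0 \<le> t" using t by simp
    moreover have "0 < (2::real) powr (- real j - 1)" by simp
    then have "t < 1" using t by linarith
    ultimately have t01: "0 \<le> t" "t < 1" .
    have "2 powr (- real m) / 2 \<le> norm (1 - of_real t * z)"
      using norm_one_minus_mult_ge(2)[OF t01 z(1)] z(2) by linarith
    then have m: "2 powr (- real m - 1) \<le> norm (1 - of_real t * z)" by (simp add: powr_diff)
    have j: "2 powr (- real j - 1) \<le> norm (1 - of_real t * z)"
      using norm_one_minus_mult_ge(1)[OF t01 z(1)] t(1) by linarith
    \<comment> \<open>Both lower bounds hold, so the larger one may be used; it belongs to the
      smaller of \<open>j\<close> and \<open>m\<close>.\<close>
    have "2 powr (- real (min j m) - 1) \<le> norm (1 - of_real t * z)"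
      using m j by (auto simp: min_def)
    then have "norm (1 - of_real t * z) powr (- G) \<le> (2 powr (- real (min j m) - 1)) powr (- G)"
      using G by (intro powr_mono2') auto
    also have "\<dots> = 2 powr (G + real (min j m) * G)" by (simp add: powr_powr algebra_simps)
    finally show "norm (1 - of_real t * z) powr (- G) \<le> 2 powr G * 2 powr (real (min j m) * G)"
      by (simp only: powr_add)
  qed auto
  also have "\<dots> = ennreal (\<beta> * C * 2 powr G * 2 powr (real m * (G / q)) * U m)"
    using \<beta> by (simp add: mult.assoc flip: ennreal_mult')
  finally show "norm (deriv (hilbert_op \<mu> \<beta> f) z) \<le> \<beta> * C * 2 powr (\<beta> + 1) * 2 powr (real m * ((\<beta> + 1) / q)) * U m"
    using \<beta> C(1) U0[of m] unfolding G_def by (subst (asm) ennreal_le_iff) auto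
qed

text \<open>The shell where \<open>norm (1 - z)\<close> is about \<open>2^(-m)\<close> has weighted
  area of order \<open>2^(-m (\<gamma> + 2))\<close>, which exactly cancels the \<open>q\<close>-th
  power of the growth factor of \<open>h\<close>. What remains is the sum of
  \<open>U powr q\<close>.\<close>

lemma bergman_integral_le_of_shells:
  assumes q: "q > 0" and \<gamma>: "\<gamma> > -1" and sU: "summable (\<lambda>m. U m powr q)" and U: "\<And>m. U m \<ge> 0" and A: "A \<ge> 0"
    and h: "\<And>m z. norm z < 1 \<Longrightarrow> 2 powr (- real m) \<le> norm (1 - z) \<Longrightarrow> norm (h z) \<le> A * 2 powr (real m * ((\<gamma> + 2) / q)) * U m"
    and L: "\<And>r. 0 < r \<Longrightarrow> (\<integral>\<^sup>+z. ennreal (indicator (ball 0 1 \<inter> ball 1 r) (z::complex) * (1 - (norm z)\<^sup>2) powr \<gamma>) \<partial>lborel)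
     \<le> ennreal (L * r powr (\<gamma> + 2))" and L0: "L \<ge> 0"
  shows "bergman_integral q \<gamma> h \<le> ennreal (A powr q * (L * 3 powr (\<gamma> + 2) / pi) * (\<Sum>m. U m powr q))"
proof -
  define B where "B = (\<lambda>m. A * 2 powr (real m * ((\<gamma> + 2) / q)) * U m)"
  \<comment> \<open>The shell reaches up to \<open>norm (1 - z) = 2 * 2 powr (- m)\<close>; the
    factor 3 leaves room because the ball is open.\<close>
  define S where "S = (\<lambda>m::nat. ball 0 1 \<inter> ball (1::complex) (3 * 2 powr (- real m)))"
  have [measurable]: "S m \<in> sets borel" for m by (simp add: S_def)
  have Bq: "B m powr q * 2 powr (- real m * (\<gamma> + 2)) = A powr q * U m powr q" for m
  proof -
    have "(2 powr (real m * ((\<gamma> + 2) / q))) powr q = (2::real) powr (real m * (\<gamma> + 2))"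
      using q by (simp add: powr_powr)
    then have "B m powr q = A powr q * U m powr q * 2 powr (real m * (\<gamma> + 2))" by (simp add: B_def powr_mult)
    moreover have "2 powr (real m * (\<gamma> + 2)) * (2::real) powr (- real m * (\<gamma> + 2)) = 1" by (simp flip: powr_add)
    ultimately show ?thesis by simp
  qed
  have "bergman_integral q \<gamma> h
    \<le> (\<Sum>m. (\<integral>\<^sup>+z. ennreal (B m powr q / pi) * ennreal (indicator (S m) z * (1 - (norm z)\<^sup>2) powr \<gamma>) \<partial>lborel))"
    unfolding bergman_integral_def
  proof (rule nn_integral_le_suminf)
    fix z :: complex
    show "\<exists>m. ennreal (indicator (ball 0 1) z * (norm (h z) powr q * (1 - (norm z)\<^sup>2) powr \<gamma> / pi))
      \<le> ennreal (B m powr q / pi) * ennreal (indicator (S m) z * (1 - (norm z)\<^sup>2) powr \<gamma>)"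
    proof (cases "norm z < 1")
      case True
      have "z \<noteq> 1" using True by auto
      moreover have "norm (1 - z) \<le> 2" using norm_triangle_ineq4[of 1 z] True by simp
      \<comment> \<open>Halving brings \<open>norm (1 - z)\<close>, which can come close to 2, into
        the range of \<open>ex_dyadic\<close>.\<close>
      ultimately obtain m :: nat where m: "2 powr (- real m - 1) < norm (1 - z) / 2" "norm (1 - z) / 2 \<le> 2 powr (- real m)"
        using ex_dyadic[of "norm (1 - z) / 2"] by auto
      have "2 powr (- real m) \<le> norm (1 - z)" using m(1) by (simp add: powr_diff)
      then have "norm (h z) powr q \<le> B m powr q" unfolding B_def using h[OF True] q by (intro powr_mono2) auto
      then have "norm (h z) powr q * (1 - (norm z)\<^sup>2) powr \<gamma> / pi \<le> B m powr q / pi * (1 - (norm z)\<^sup>2) powr \<gamma>"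
        by (simp add: divide_right_mono mult_right_mono)
      moreover have "0 < (2::real) powr (- real m)" by simp
      then have "norm (1 - z) < 3 * 2 powr (- real m)" using m(2) by linarith
      then have "z \<in> S m" using True by (simp add: S_def dist_norm)
      ultimately show ?thesis using True by (intro exI[of _ m]) (simp add: ennreal_leI flip: ennreal_mult)
    qed auto
  qed simp
  also have "\<dots> \<le> (\<Sum>m. ennreal (A powr q * (L * 3 powr (\<gamma> + 2) / pi) * U m powr q))"
  proof (intro suminf_le)
    fix m
    have "(\<integral>\<^sup>+z. ennreal (B m powr q / pi) * ennreal (indicator (S m) z * (1 - (norm z)\<^sup>2) powr \<gamma>) \<partial>lborel)
      = ennreal (B m powr q / pi) * (\<integral>\<^sup>+z. ennreal (indicator (S m) z * (1 - (norm z)\<^sup>2) powr \<gamma>) \<partial>lborel)"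
      by (rule nn_integral_cmult) simp
    also have "\<dots> \<le> ennreal (B m powr q / pi) * ennreal (L * (3 * 2 powr (- real m)) powr (\<gamma> + 2))"
      unfolding S_def by (intro mult_left_mono L) auto
    also have "\<dots> = ennreal ((B m powr q * 2 powr (- real m * (\<gamma> + 2))) * (L * 3 powr (\<gamma> + 2) / pi))"
      using L0 by (simp add: powr_mult powr_powr mult_ac flip: ennreal_mult)
    finally show "(\<integral>\<^sup>+z. ennreal (B m powr q / pi) * ennreal (indicator (S m) z * (1 - (norm z)\<^sup>2) powr \<gamma>) \<partial>lborel)
      \<le> ennreal (A powr q * (L * 3 powr (\<gamma> + 2) / pi) * U m powr q)" unfolding Bq by (simp only: mult_ac)
  qed auto
  also have "\<dots> = ennreal (\<Sum>m. A powr q * (L * 3 powr (\<gamma> + 2) / pi) * U m powr q)"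
    using L0 by (intro suminf_ennreal2 summable_mult sU) auto
  also have "\<dots> = ennreal (A powr q * (L * 3 powr (\<gamma> + 2) / pi) * (\<Sum>m. U m powr q))"
    by (subst suminf_mult[OF sU]) simp
  finally show ?thesis .
qed

lemma carleson_imp_hilbert_bounded:
  fixes p q \<alpha> :: real
  assumes q: "q > 1" and p: "0 < p" "p \<le> q" and \<alpha>: "\<alpha> > p - 1" and \<mu>: "borel_measure_on_01 \<mu>"
    and c: "carleson \<mu> ((\<alpha> + 2 - p) / p + (\<alpha> + 2 - p) / (q / (q - 1)))"
  shows "hilbert_bounded_DD \<mu> (\<alpha> + 1 - p) p \<alpha> q (\<alpha> - p)"
proof -
  define G where "G = \<alpha> + 2 - p"
  define \<beta> where "\<beta> = \<alpha> + 1 - p"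
  define g where "g = (\<alpha> + 2) / p - 1"
  define s where "s = g + G * (1 - 1 / q)"
  have G: "G > 1" and \<beta>: "\<beta> > 0" and \<beta>G: "\<beta> + 1 = G" using \<alpha> by (auto simp: G_def \<beta>_def)
  have gG: "g = G / p" using p by (simp add: g_def G_def field_simps)
  \<comment> \<open>The quotient \<open>q / (q - 1)\<close> is the conjugate exponent, so dividing
    by it means multiplying by \<open>1 - 1/q\<close>; the first summand \<open>G / p\<close> is
    \<open>g\<close>.\<close>
  have cs: "carleson \<mu> s" using c q gG by (simp add: s_def G_def field_simps)
  have sets: "sets \<mu> = sets borel" using \<mu> by (simp add: borel_measure_on_01_def)
  have \<tau>: "0 \<le> coeff_exponent p \<alpha>" "coeff_exponent p \<alpha> < s"
  proof -
    have pos: "G * (1 - 1 / q) > 0" using G q by simp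
    have "0 \<le> coeff_exponent p \<alpha> \<and> coeff_exponent p \<alpha> < s"
    proof (cases "p \<ge> 1")
      case False
      then have "coeff_exponent p \<alpha> = g" by (simp add: coeff_exponent_def g_def)
      then show ?thesis using pos gG G p by (auto simp: s_def)
    next
      case True
      then have 1: "coeff_exponent p \<alpha> = g + (1 - 1 / p)" using p by (simp add: coeff_exponent_def g_def field_simps)
      have "1 - 1 / p \<le> 1 - 1 / q" using p q by (simp add: field_simps)
      also have "\<dots> < G * (1 - 1 / q)" using mult_strict_right_mono[OF G, of "1 - 1 / q"] q by simp
      finally have "coeff_exponent p \<alpha> < s" by (simp add: 1 s_def)
      moreover have "0 \<le> coeff_exponent p \<alpha>" using \<alpha> True by (simp add: coeff_exponent_def)
      ultimately show ?thesis by blast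
    qed
    then show "0 \<le> coeff_exponent p \<alpha>" "coeff_exponent p \<alpha> < s" by auto
  qed
  \<comment> \<open>The slowest of three decay rates: radial integration has rate \<open>g\<close>,
    the two sides of the diagonal of the operator have \<open>G / q\<close> and
    \<open>G * (1 - 1 / q)\<close>. A single base \<open>b\<close> then serves both
    convolutions.\<close>
  define e where "e = Min {g, G / q, G * (1 - 1 / q)}"
  have e: "e > 0" "e \<le> g" "e \<le> G / q" "e \<le> G * (1 - 1 / q)"
    using G p q by (auto simp: e_def gG)
  define b where "b = (2::real) powr (- e)"
  have b: "0 < b" "b < 1" "2 powr (- g) \<le> b" "2 powr (- (G / q)) \<le> b" "2 powr (- (G * (1 - 1 / q))) \<le> b"
    unfolding b_def using e by (auto simp: powr_less_one intro!: powr_mono)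
  have \<alpha>1: "\<alpha> > -1" using \<alpha> p by simp
  have q1: "q \<ge> 1" using q by simp
  obtain C1 where C1: "C1 > 0" "\<forall>f\<in>dirichlet_space p \<alpha>. \<exists>V::nat \<Rightarrow> real. (\<forall>j. 0 \<le> V j) \<and>
    summable (\<lambda>j. V j powr q) \<and> (\<Sum>j. V j powr q) \<le> (C1 * dirichlet_norm p \<alpha> f) powr q \<and> dyadic_bound f g V"
    using dirichlet_radial_bound[OF q1 p \<alpha>1 b(1,2,3) g_def] by (elim exE conjE)
  obtain C2 where C2: "C2 > 0" "\<And>j::nat. emeasure \<mu> {1 - 2 powr (- real j)..<1} \<le> ennreal (C2 * 2 powr (- real j * s))"
    using carleson_dyadic[OF cs] by blast
  have \<gamma>: "\<alpha> - p > -1" using \<alpha> by simp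
  have \<gamma>G: "\<alpha> - p + 2 = G" by (simp add: G_def)
  obtain L where L: "L > 0" "\<And>r. 0 < r \<Longrightarrow>
    (\<integral>\<^sup>+z. ennreal (indicator (ball 0 1 \<inter> ball 1 r) (z::complex) * (1 - (norm z)\<^sup>2) powr (\<alpha> - p)) \<partial>lborel)
     \<le> ennreal (L * r powr (\<alpha> - p + 2))" using weight_near_one_le[OF \<gamma>] by blast
  define A where "A = \<beta> * C2 * 2 powr G"
  have A: "A > 0" using \<beta> C2 by (simp add: A_def)
  define K where "K = 4 / (1 - b) * C1"
  have K: "K > 0" using b C1 by (simp add: K_def)
  define M where "M = L * 3 powr G / pi"
  have M: "M > 0" using L by (simp add: M_def)
  \<comment> \<open>The first summand bounds the value at 0, the second the Bergman norm;
    \<open>(\<alpha> - p + 1) * M\<close> collects the normalisation and the area constant.\<close>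
  define R where "R = C2 * K + ((\<alpha> - p + 1) * M) powr (1 / q) * A * K"
  have main: "hilbert_defined \<mu> \<beta> f \<and> hilbert_op \<mu> \<beta> f \<in> dirichlet_space q (\<alpha> - p) \<and>
    dirichlet_norm q (\<alpha> - p) (hilbert_op \<mu> \<beta> f) \<le> R * dirichlet_norm p \<alpha> f"
    if fD: "f \<in> dirichlet_space p \<alpha>" for f
  proof -
    obtain \<Phi> where \<Phi>: "integrable \<mu> \<Phi>" "\<forall>t n. 0 \<le> t \<longrightarrow> t < 1 \<longrightarrow> (\<Sum>k<n. norm (taylor_coeff f k) * t ^ k) \<le> \<Phi> t"
      using dirichlet_majorant[OF p(1) \<tau> fD cs sets] by blast
    have h: "hankel_setup \<mu> \<beta> f \<Phi>"
      using \<mu> \<beta> carleson_finite[OF cs] fD \<Phi> by unfold_locales (auto simp: dirichlet_space_def)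
    interpret hankel_setup \<mu> \<beta> f \<Phi> by (rule h)
    define D where "D = dirichlet_norm p \<alpha> f"
    have D: "D \<ge> 0" by (simp add: D_def dirichlet_norm_def bergman_norm_def)
    from bspec[OF C1(2) fD] obtain V :: "nat \<Rightarrow> real" where V: "\<And>j. 0 \<le> V j" "summable (\<lambda>j. V j powr q)"
      "(\<Sum>j. V j powr q) \<le> (C1 * D) powr q" "dyadic_bound f g V" unfolding D_def by blast
    define U where "U = (\<lambda>m. \<Sum>j. dist_kernel b m j * V j)"
    have U: "summable (\<lambda>j. dist_kernel b m j * V j)" "summable (\<lambda>m. U m powr q)"
      "(\<Sum>m. U m powr q) \<le> (4 / (1 - b)) powr q * (\<Sum>j. V j powr q)" for m
      unfolding U_def by (rule dist_kernel_convolution[OF b(1,2) q1 V(1,2)])+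
    have U0: "U m \<ge> 0" for m unfolding U_def
      using dist_kernel_pos[OF b(1)] V(1) by (intro suminf_nonneg U(1) mult_nonneg_nonneg) (auto simp: less_imp_le)
    have Uq: "(\<Sum>m. U m powr q) \<le> (K * D) powr q"
    proof -
      have "(\<Sum>m. U m powr q) \<le> (4 / (1 - b)) powr q * (C1 * D) powr q"
        using U(3) V(3) by (meson mult_left_mono order_trans powr_ge_zero)
      also have "\<dots> = (4 / (1 - b) * (C1 * D)) powr q" by (simp only: powr_mult)
      finally show ?thesis by (simp add: K_def mult.assoc)
    qed
    have bb: "2 powr (- ((\<beta> + 1) / q)) \<le> b" "2 powr (- ((\<beta> + 1) * (1 - 1 / q))) \<le> b"
      using b unfolding \<beta>G by auto
    have s: "s = g + (\<beta> + 1) * (1 - 1 / q)" unfolding \<beta>G by (simp add: s_def)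
    note bd = hilbert_op_dyadic_bounds[OF h q1 b(1,2) bb V(4,1,2) C2 s, folded U_def, unfolded \<beta>G]
    let ?g = "hilbert_op \<mu> \<beta> f"
    have "bergman_integral q (\<alpha> - p) (deriv ?g) \<le> ennreal (A powr q * (L * 3 powr (\<alpha> - p + 2) / pi) * (\<Sum>m. U m powr q))"
    proof (rule bergman_integral_le_of_shells[OF _ \<gamma> U(2) U0 _ _ L(2)])
      show "norm (deriv ?g z) \<le> A * 2 powr (real m * ((\<alpha> - p + 2) / q)) * U m"
        if "norm z < 1" "2 powr (- real m) \<le> norm (1 - z)" for m z
        using bd(2)[OF that] unfolding A_def \<gamma>G U_def by simp
    qed (use q A L in simp_all)
    also have "\<dots> \<le> ennreal (A powr q * M * (K * D) powr q)"
      unfolding \<gamma>G M_def[symmetric] using M by (intro ennreal_leI mult_left_mono Uq) auto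
    finally have I: "bergman_integral q (\<alpha> - p) (deriv ?g) \<le> ennreal (A powr q * M * (K * D) powr q)" .
    then have fin: "bergman_integral q (\<alpha> - p) (deriv ?g) < \<infinity>" by (auto intro: order_le_less_trans)
    have "enn2real (bergman_integral q (\<alpha> - p) (deriv ?g)) \<le> A powr q * M * (K * D) powr q"
      using I M by (intro enn2real_leI) auto
    then have "(\<alpha> - p + 1) * enn2real (bergman_integral q (\<alpha> - p) (deriv ?g)) \<le> (\<alpha> - p + 1) * (A powr q * M * (K * D) powr q)"
      using \<gamma> by (intro mult_left_mono) auto
    then have "bergman_norm q (\<alpha> - p) (deriv ?g) \<le> ((\<alpha> - p + 1) * (A powr q * M * (K * D) powr q)) powr (1 / q)"
      unfolding bergman_norm_def using q \<gamma> by (intro powr_mono2) auto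
    also have "\<dots> = (((\<alpha> - p + 1) * M) * (A * (K * D)) powr q) powr (1 / q)"
      by (simp add: powr_mult mult_ac)
    also have "\<dots> = ((\<alpha> - p + 1) * M) powr (1 / q) * (A * (K * D))"
      using q A K D by (subst powr_mult) (simp add: powr_powr)
    finally have 1: "bergman_norm q (\<alpha> - p) (deriv ?g) \<le> ((\<alpha> - p + 1) * M) powr (1 / q) * A * K * D"
      by (simp add: mult.assoc)
    \<comment> \<open>A single entry is at most the \<open>l^q\<close> norm, so the estimate for
      \<open>U\<close> also settles the value at 0.\<close>
    have "U 0 \<le> (\<Sum>m. U m powr q) powr (1 / q)"
      using q by (intro summable_powr_imp_bounded U(2) U0) auto
    also have "\<dots> \<le> ((K * D) powr q) powr (1 / q)"
      using q U0 by (intro powr_mono2 Uq suminf_nonneg U(2)) auto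
    also have "\<dots> = K * D" using q K D by (simp add: powr_powr)
    finally have UK: "U 0 \<le> K * D" .
    have "norm (?g 0) \<le> C2 * U 0" using bd(1) by (simp add: U_def)
    also have "\<dots> \<le> C2 * (K * D)" using UK C2(1) by (intro mult_left_mono) auto
    finally have "norm (?g 0) \<le> C2 * K * D" by (simp add: mult.assoc)
    then have "dirichlet_norm q (\<alpha> - p) ?g \<le> R * D"
      unfolding dirichlet_norm_def using 1 by (simp add: R_def distrib_right)
    moreover have "?g \<in> dirichlet_space q (\<alpha> - p)"
      using hilbert_op_holomorphic fin by (auto simp: dirichlet_space_def bergman_space_def intro!: holomorphic_deriv)
    ultimately show ?thesis using hilbert_defined unfolding D_def by blast
  qed
  then show ?thesis unfolding hilbert_bounded_DD_def \<beta>_def by blast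
qed

section \<open>Necessity\<close>

text \<open>The disc is cut into shells around 1 at the scale \<open>1 - a\<close>.\<close>

lemma kernel_integral_le:
  assumes \<gamma>: "\<gamma> > -1" and l: "l > \<gamma> + 2"
  obtains C where "C > 0" "\<And>a. 0 \<le> a \<Longrightarrow> a < 1 \<Longrightarrow>
    (\<integral>\<^sup>+z. ennreal (indicator (ball 0 1) (z::complex) * (norm (1 - of_real a * z) powr (- l) * (1 - (norm z)\<^sup>2) powr \<gamma>)) \<partial>lborel)
     \<le> ennreal (C * (1 - a) powr (\<gamma> + 2 - l))"
proof -
  obtain L where L: "L > 0" "\<And>r. 0 < r \<Longrightarrow>
    (\<integral>\<^sup>+z. ennreal (indicator (ball 0 1 \<inter> ball 1 r) (z::complex) * (1 - (norm z)\<^sup>2) powr \<gamma>) \<partial>lborel)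
     \<le> ennreal (L * r powr (\<gamma> + 2))" using weight_near_one_le[OF \<gamma>] by blast
  \<comment> \<open>From one shell to the next the kernel bound loses \<open>2 powr l\<close> and
    the area bound gains \<open>2 powr (\<gamma> + 2)\<close>.\<close>
  define r where "r = (2::real) powr (- (l - (\<gamma> + 2)))"
  have r: "0 < r" "r < 1" using l by (auto simp: r_def powr_less_one)
  define M where "M = 2 powr l * L * 2 powr (\<gamma> + 2)"
  have M: "M > 0" using L by (simp add: M_def)
  have "(\<integral>\<^sup>+z. ennreal (indicator (ball 0 1) (z::complex) * (norm (1 - of_real a * z) powr (- l) * (1 - (norm z)\<^sup>2) powr \<gamma>)) \<partial>lborel)
     \<le> ennreal (M * (1 / (1 - r)) * (1 - a) powr (\<gamma> + 2 - l))" if a: "0 \<le> a" "a < 1" for a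
  proof -
    define d where "d = 1 - a"
    have d: "d > 0" using a by (simp add: d_def)
    define S where "S = (\<lambda>k::nat. ball 0 1 \<inter> ball (1::complex) (2 * 2 ^ k * d))"
    have [measurable]: "S k \<in> sets borel" for k by (simp add: S_def)
    have "(\<integral>\<^sup>+z. ennreal (indicator (ball 0 1) (z::complex) * (norm (1 - of_real a * z) powr (- l) * (1 - (norm z)\<^sup>2) powr \<gamma>)) \<partial>lborel)
      \<le> (\<Sum>k. (\<integral>\<^sup>+z. ennreal ((2 ^ k * d / 2) powr (- l)) * ennreal (indicator (S k) z * (1 - (norm z)\<^sup>2) powr \<gamma>) \<partial>lborel))"
    proof (rule nn_integral_le_suminf)
      fix z :: complex
      show "\<exists>k. ennreal (indicator (ball 0 1) z * (norm (1 - of_real a * z) powr (- l) * (1 - (norm z)\<^sup>2) powr \<gamma>))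
        \<le> ennreal ((2 ^ k * d / 2) powr (- l)) * ennreal (indicator (S k) z * (1 - (norm z)\<^sup>2) powr \<gamma>)"
      proof (cases "norm z < 1")
        case True
        have "\<exists>k. norm (1 - z) < 2 * 2 ^ k * d"
        proof -
          obtain k where "norm (1 - z) / (2 * d) < 2 ^ k" using real_arch_pow[of 2 "norm (1 - z) / (2 * d)"] by auto
          then show ?thesis using d by (intro exI[of _ k]) (simp add: field_simps)
        qed
        define k where "k = (LEAST k. norm (1 - z) < 2 * 2 ^ k * d)"
        have k: "norm (1 - z) < 2 * 2 ^ k * d" unfolding k_def by (rule LeastI_ex) fact
        \<comment> \<open>On the first shell the bound \<open>1 - a\<close> is used; on later ones
          minimality of \<open>k\<close> bounds \<open>norm (1 - z)\<close> from below, and half of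
          it is kept.\<close>
        have low: "2 ^ k * d / 2 \<le> norm (1 - of_real a * z)"
        proof (cases k)
          case 0
          then show ?thesis using norm_one_minus_mult_ge(1)[OF a True] d by (simp add: d_def)
        next
          case (Suc i)
          then have "\<not> norm (1 - z) < 2 * 2 ^ i * d"
            using not_less_Least[of i "\<lambda>k. norm (1 - z) < 2 * 2 ^ k * d"] by (simp add: k_def)
          then show ?thesis using norm_one_minus_mult_ge(2)[OF a True] Suc by simp
        qed
        have "norm (1 - of_real a * z) powr (- l) \<le> (2 ^ k * d / 2) powr (- l)"
          using low l \<gamma> d by (intro powr_mono2') auto
        then have "norm (1 - of_real a * z) powr (- l) * (1 - (norm z)\<^sup>2) powr \<gamma> \<le> (2 ^ k * d / 2) powr (- l) * (1 - (norm z)\<^sup>2) powr \<gamma>"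
          by (intro mult_right_mono) auto
        moreover have "z \<in> S k" using True k by (simp add: S_def dist_norm)
        ultimately show ?thesis using True by (intro exI[of _ k]) (simp add: ennreal_leI flip: ennreal_mult)
      qed auto
    qed simp
    also have "\<dots> \<le> (\<Sum>k. ennreal (M * d powr (\<gamma> + 2 - l) * r ^ k))"
    proof (intro suminf_le)
      fix k
      have "(\<integral>\<^sup>+z. ennreal ((2 ^ k * d / 2) powr (- l)) * ennreal (indicator (S k) z * (1 - (norm z)\<^sup>2) powr \<gamma>) \<partial>lborel)
        = ennreal ((2 ^ k * d / 2) powr (- l)) * (\<integral>\<^sup>+z. ennreal (indicator (S k) z * (1 - (norm z)\<^sup>2) powr \<gamma>) \<partial>lborel)"
        by (rule nn_integral_cmult) simp
      also have "\<dots> \<le> ennreal ((2 ^ k * d / 2) powr (- l)) * ennreal (L * (2 * 2 ^ k * d) powr (\<gamma> + 2))"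
        unfolding S_def using d by (intro mult_left_mono L) auto
      also have "\<dots> = ennreal ((2 ^ k * d / 2) powr (- l) * (L * (2 * 2 ^ k * d) powr (\<gamma> + 2)))"
        using L(1) by (simp flip: ennreal_mult)
      also have "(2 ^ k * d / 2) powr (- l) * (L * (2 * 2 ^ k * d) powr (\<gamma> + 2)) = M * d powr (\<gamma> + 2 - l) * r ^ k"
      proof -
        define x where "x = 2 ^ k * d"
        have x: "x > 0" using d by (simp add: x_def)
        have "(x / 2) powr (- l) * (L * (2 * x) powr (\<gamma> + 2)) = M * (x powr (- l) * x powr (\<gamma> + 2))"
          using x by (simp add: M_def powr_divide powr_mult powr_minus field_simps)
        also have "x powr (- l) * x powr (\<gamma> + 2) = x powr (\<gamma> + 2 - l)" by (simp flip: powr_add)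
        also have "\<dots> = d powr (\<gamma> + 2 - l) * (2 ^ k) powr (\<gamma> + 2 - l)" by (simp add: x_def powr_mult)
        also have "(2 ^ k) powr (\<gamma> + 2 - l) = r ^ k"
          by (simp add: r_def powr_powr mult.commute flip: powr_realpow)
        finally show ?thesis by (simp add: x_def mult.assoc)
      qed
      finally show "(\<integral>\<^sup>+z. ennreal ((2 ^ k * d / 2) powr (- l)) * ennreal (indicator (S k) z * (1 - (norm z)\<^sup>2) powr \<gamma>) \<partial>lborel)
        \<le> ennreal (M * d powr (\<gamma> + 2 - l) * r ^ k)" .
    qed auto
    also have "\<dots> = ennreal (\<Sum>k. M * d powr (\<gamma> + 2 - l) * r ^ k)"
      using r M by (intro suminf_ennreal2) (auto intro!: summable_mult)
    also have "\<dots> = ennreal (M * (1 / (1 - r)) * d powr (\<gamma> + 2 - l))"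
      using r by (subst suminf_mult) (auto simp: suminf_geometric mult_ac)
    finally show ?thesis by (simp add: d_def)
  qed
  moreover have "M * (1 / (1 - r)) > 0" using M r by simp
  ultimately show ?thesis using that by blast
qed

text \<open>The exponent is a natural number, so no branch is involved. For \<open>0 < a < 1\<close>
  the pole \<open>1 / a\<close> lies outside the closed disc, hence the Taylor series converges
  absolutely at 1 and has a constant majorant on \<open>[0, 1)\<close>.\<close>

definition test_fun :: "nat \<Rightarrow> real \<Rightarrow> complex \<Rightarrow> complex" where
  "test_fun N a z = 1 / (1 - of_real a * z) ^ N"

context
  fixes a :: real assumes a: "0 < a" "a < 1"
begin

lemma test_fun_nz:
  fixes z :: complex
  assumes "norm z < 1 / a"
  shows "1 - of_real a * z \<noteq> 0"
proof
  assume "1 - of_real a * z = 0"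
  then have "norm (of_real a * z) = 1" by simp
  then show False using assms a by (simp add: norm_mult field_simps)
qed

lemma test_fun_deriv:
  assumes "norm z < 1 / a"
  shows "(test_fun N a has_field_derivative of_nat N * of_real a / (1 - of_real a * z) ^ Suc N) (at z)"
proof -
  define w where "w = 1 - of_real a * z"
  have nz: "w \<noteq> 0" unfolding w_def by (rule test_fun_nz[OF assms])
  have "(test_fun N a has_field_derivative (of_nat N * w ^ (N - 1) * of_real a) / (w ^ N * w ^ N)) (at z)"
    unfolding test_fun_def[abs_def] w_def using nz[unfolded w_def]
    by (auto intro!: derivative_eq_intros)
  also have "(of_nat N * w ^ (N - 1) * of_real a) / (w ^ N * w ^ N) = of_nat N * of_real a / w ^ Suc N"
    using nz by (cases N) simp_all
  finally show ?thesis by (simp add: w_def)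
qed

lemma test_fun_holomorphic: "test_fun N a holomorphic_on ball 0 (1 / a)"
  unfolding test_fun_def[abs_def] using test_fun_nz by (auto intro!: holomorphic_intros)

lemma test_fun_holomorphic1: "test_fun N a holomorphic_on ball 0 1"
  by (rule holomorphic_on_subset[OF test_fun_holomorphic subset_ball]) (use a in simp)

lemma test_fun_summable: "summable (\<lambda>k. norm (taylor_coeff (test_fun N a) k))"
proof -
  define R where "R = (1 + 1 / a) / 2"
  have R: "1 < R" "R < 1 / a" using a by (auto simp: R_def field_simps)
  have "summable (\<lambda>k. taylor_coeff (test_fun N a) k * of_real R ^ k)"
    using holomorphic_taylor_sums[OF test_fun_holomorphic, of "of_real R" N] R by (auto simp: sums_iff)
  from powser_insidea[OF this, of 1] show ?thesis using R by simp
qed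

end

text \<open>The derivative is of size \<open>norm (1 - a z) powr (- (N + 1))\<close>, so its
  \<open>p\<close>-th power falls under \<open>kernel_integral_le\<close> as soon as
  \<open>(N + 1) p > \<alpha> + 2\<close>.\<close>

lemma test_fun_norm_le:
  assumes p: "p > 0" and \<alpha>: "\<alpha> > -1" and N: "(real N + 1) * p > \<alpha> + 2"
  obtains C where "C > 0" "\<And>a. 0 < a \<Longrightarrow> a < 1 \<Longrightarrow> test_fun N a \<in> dirichlet_space p \<alpha> \<and>
    dirichlet_norm p \<alpha> (test_fun N a) \<le> C * (1 - a) powr ((\<alpha> + 2) / p - (real N + 1))"
proof -
  define l where "l = (real N + 1) * p"
  obtain C where C: "C > 0" "\<And>a. 0 \<le> a \<Longrightarrow> a < 1 \<Longrightarrow>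
    (\<integral>\<^sup>+z. ennreal (indicator (ball 0 1) (z::complex) * (norm (1 - of_real a * z) powr (- l) * (1 - (norm z)\<^sup>2) powr \<alpha>)) \<partial>lborel)
     \<le> ennreal (C * (1 - a) powr (\<alpha> + 2 - l))"
    using kernel_integral_le[OF \<alpha>, of l] N unfolding l_def by blast
  define K where "K = ((\<alpha> + 1) * (real N powr p / pi * C)) powr (1 / p)"
  have main: "test_fun N a \<in> dirichlet_space p \<alpha> \<and>
    dirichlet_norm p \<alpha> (test_fun N a) \<le> (1 + K) * (1 - a) powr ((\<alpha> + 2) / p - (real N + 1))"
    if a: "0 < a" "a < 1" for a
  proof -
    let ?f = "test_fun N a"
    note f1 = test_fun_holomorphic1[OF a, of N]
    have df: "deriv ?f z = of_nat N * of_real a / (1 - of_real a * z) ^ Suc N" if "norm z < 1" for z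
    proof -
      have "1 \<le> 1 / a" using a by simp
      then show ?thesis using that by (intro DERIV_imp_deriv test_fun_deriv[OF a]) linarith
    qed
    have le: "norm (deriv ?f z) powr p \<le> real N powr p * norm (1 - of_real a * z) powr (- l)" if z: "norm z < 1" for z
    proof -
      define x where "x = norm (1 - of_real a * z)"
      have x: "x > 0" using norm_one_minus_mult_ge(1)[of a z] a z unfolding x_def by linarith
      have "norm (deriv ?f z) = real N * a / x ^ Suc N"
        using a by (simp add: df[OF z] norm_mult norm_divide norm_power x_def)
      also have "\<dots> \<le> real N / x ^ Suc N" using a x by (intro divide_right_mono mult_left_le) auto
      also have "\<dots> = real N * x powr (- (real N + 1))"
      proof -
        have "x powr (- (real N + 1)) = inverse (x powr real (Suc N))"
          unfolding powr_minus by (simp add: add.commute)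
        also have "x powr real (Suc N) = x ^ Suc N" using x by (rule powr_realpow)
        finally show ?thesis by (simp add: divide_inverse)
      qed
      finally have "norm (deriv ?f z) powr p \<le> (real N * x powr (- (real N + 1))) powr p"
        using p by (intro powr_mono2) auto
      also have "\<dots> = real N powr p * x powr (- l)" 
      proof -
        have "- (real N + 1) * p = - l" by (simp only: l_def mult_minus_left)
        then show ?thesis by (simp only: powr_mult powr_powr)
      qed
      finally show ?thesis by (simp add: x_def)
    qed
    define H where "H = (\<lambda>z::complex. ennreal (indicator (ball 0 1) z * (norm (1 - of_real a * z) powr (- l) * (1 - (norm z)\<^sup>2) powr \<alpha>)))"
    have [measurable]: "ball (0::complex) 1 \<in> sets borel" by simp
    have [measurable]: "(\<lambda>z::complex. norm (1 - of_real a * z)) \<in> borel_measurable borel"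
      by (intro borel_measurable_continuous_onI continuous_intros)
    have [measurable]: "H \<in> borel_measurable borel" unfolding H_def by simp
    have "bergman_integral p \<alpha> (deriv ?f) \<le> (\<integral>\<^sup>+z. ennreal (real N powr p / pi) * H z \<partial>lborel)"
      unfolding bergman_integral_def
    proof (intro nn_integral_mono)
      fix z :: complex
      show "ennreal (indicator (ball 0 1) z * (norm (deriv ?f z) powr p * (1 - (norm z)\<^sup>2) powr \<alpha> / pi)) \<le> ennreal (real N powr p / pi) * H z"
      proof (cases "norm z < 1")
        case True
        have "norm (deriv ?f z) powr p * (1 - (norm z)\<^sup>2) powr \<alpha> / pi
           \<le> (real N powr p * norm (1 - of_real a * z) powr (- l)) * (1 - (norm z)\<^sup>2) powr \<alpha> / pi"
          by (intro divide_right_mono mult_right_mono le True) auto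
        then show ?thesis using True by (simp add: H_def ennreal_leI mult.assoc flip: ennreal_mult)
      qed auto
    qed
    also have "\<dots> = ennreal (real N powr p / pi) * (\<integral>\<^sup>+z. H z \<partial>lborel)" by (rule nn_integral_cmult) simp
    also have "\<dots> \<le> ennreal (real N powr p / pi) * ennreal (C * (1 - a) powr (\<alpha> + 2 - l))"
      unfolding H_def using a by (intro mult_left_mono C) auto
    also have "\<dots> = ennreal (real N powr p / pi * C * (1 - a) powr (\<alpha> + 2 - l))"
      using C(1) by (simp flip: ennreal_mult)
    finally have I: "bergman_integral p \<alpha> (deriv ?f) \<le> ennreal (real N powr p / pi * C * (1 - a) powr (\<alpha> + 2 - l))" .
    then have "bergman_integral p \<alpha> (deriv ?f) < \<infinity>" by (auto intro: order_le_less_trans)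
    then have 1: "?f \<in> dirichlet_space p \<alpha>"
      using f1 by (auto simp: dirichlet_space_def bergman_space_def intro!: holomorphic_deriv)
    have "enn2real (bergman_integral p \<alpha> (deriv ?f)) \<le> real N powr p / pi * C * (1 - a) powr (\<alpha> + 2 - l)"
      using I C(1) by (intro enn2real_leI) auto
    then have "(\<alpha> + 1) * enn2real (bergman_integral p \<alpha> (deriv ?f)) \<le> (\<alpha> + 1) * (real N powr p / pi * C * (1 - a) powr (\<alpha> + 2 - l))"
      using \<alpha> by (intro mult_left_mono) auto
    then have "bergman_norm p \<alpha> (deriv ?f) \<le> ((\<alpha> + 1) * (real N powr p / pi * C * (1 - a) powr (\<alpha> + 2 - l))) powr (1 / p)"
      unfolding bergman_norm_def using p \<alpha> by (intro powr_mono2) auto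
    also have "\<dots> = (((\<alpha> + 1) * (real N powr p / pi * C)) * (1 - a) powr (\<alpha> + 2 - l)) powr (1 / p)"
      by (simp add: mult.assoc)
    also have "\<dots> = K * (1 - a) powr ((\<alpha> + 2) / p - (real N + 1))"
    proof -
      have "(\<alpha> + 2 - l) * (1 / p) = (\<alpha> + 2) / p - (real N + 1)" using p by (simp add: l_def field_simps)
      then show ?thesis unfolding K_def powr_mult powr_powr by simp
    qed
    finally have 2: "bergman_norm p \<alpha> (deriv ?f) \<le> K * (1 - a) powr ((\<alpha> + 2) / p - (real N + 1))" .
    \<comment> \<open>The exponent of \<open>1 - a\<close> is nonpositive, so this power is at least
      1 and absorbs the value 1 of the test function at 0.\<close>
    have "(\<alpha> + 2) / p \<le> real N + 1" using N p by (simp add: pos_divide_le_eq)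
    then have "1 powr ((\<alpha> + 2) / p - (real N + 1)) \<le> (1 - a) powr ((\<alpha> + 2) / p - (real N + 1))"
      using a by (intro powr_mono2') auto
    moreover have "norm (?f 0) = 1" by (simp add: test_fun_def)
    ultimately have "dirichlet_norm p \<alpha> ?f \<le> (1 + K) * (1 - a) powr ((\<alpha> + 2) / p - (real N + 1))"
      using 2 by (simp add: dirichlet_norm_def distrib_right)
    with 1 show ?thesis by blast
  qed
  have "1 + K > 0" by (auto simp: K_def intro: add_pos_nonneg)
  with main show ?thesis using that[of "1 + K"] by blast
qed

lemma hankel_setup_test_fun:
  assumes "borel_measure_on_01 \<mu>" "\<beta> > 0" "emeasure \<mu> {0..<1} < \<infinity>" and a: "0 < a" "a < 1"
  shows "hankel_setup \<mu> \<beta> (test_fun N a) (\<lambda>t. (\<Sum>k. norm (taylor_coeff (test_fun N a) k)) * indicator {0..<1} t)"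
proof
  show "test_fun N a holomorphic_on ball 0 1" by (rule test_fun_holomorphic1[OF a])
  show "integrable \<mu> (\<lambda>t. (\<Sum>k. norm (taylor_coeff (test_fun N a) k)) * indicator {0..<1} t)"
    using assms by (intro integrable_mult_right integrable_real_indicator) (auto simp: borel_measure_on_01_def)
  fix t :: real and n assume t: "0 \<le> t" "t < 1"
  have "(\<Sum>k<n. norm (taylor_coeff (test_fun N a) k) * t ^ k) \<le> (\<Sum>k<n. norm (taylor_coeff (test_fun N a) k))"
    using t by (intro sum_mono mult_left_le power_le_one) auto
  also have "\<dots> \<le> (\<Sum>k. norm (taylor_coeff (test_fun N a) k))"
    by (intro sum_le_suminf test_fun_summable[OF a]) auto
  finally show "(\<Sum>k<n. norm (taylor_coeff (test_fun N a) k) * t ^ k)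
    \<le> (\<Sum>k. norm (taylor_coeff (test_fun N a) k)) * indicator {0..<1} t" using t by simp
qed (use assms in auto)

text \<open>At the real point \<open>a\<close> the integrand is nonnegative, so it may be restricted
  to \<open>[a, 1)\<close>. There \<open>1 - a t \<le> 1 - a^2 \<le> 2 (1 - a)\<close>, and
  \<open>t \<ge> 1/2\<close> accounts for the factor 1/2.\<close>

lemma deriv_hilbert_op_test_fun_ge:
  assumes \<mu>: "borel_measure_on_01 \<mu>" and \<beta>: "\<beta> > 0" and fin: "emeasure \<mu> {0..<1} < \<infinity>" and a: "1 / 2 \<le> a" "a < 1"
  shows "\<beta> / 2 * (2 * (1 - a)) powr (- (real N + \<beta> + 1)) * measure \<mu> {a..<1}
    \<le> norm (deriv (hilbert_op \<mu> \<beta> (test_fun N a)) (of_real a))"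
proof -
  have a0: "0 < a" using a by simp
  interpret hankel_setup \<mu> \<beta> "test_fun N a" "\<lambda>t. (\<Sum>k. norm (taylor_coeff (test_fun N a) k)) * indicator {0..<1} t"
    by (rule hankel_setup_test_fun[OF \<mu> \<beta> fin a0 a(2)])
  define k where "k = (\<lambda>t. indicator {0..<1} t * (t * (1 - a * t) powr (- (real N + \<beta> + 1))))"
  have [measurable]: "k \<in> borel_measurable borel" unfolding k_def by measurable
  have at: "1 - a \<le> 1 - a * t" if "0 \<le> t" "t < 1" for t
    using that a0 mult_left_mono[of t 1 a] by simp
  have keq: "of_real t * F t * (1 - of_real t * of_real a) powr (- of_real (\<beta> + 1)) = complex_of_real (k t)" if t: "0 \<le> t" "t < 1" for t
  proof -
    define x where "x = 1 - a * t"
    have x: "x > 0" using at[OF t] a unfolding x_def by linarith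
    have "1 - complex_of_real t * of_real a = of_real x" by (simp add: x_def mult.commute)
    moreover have "(complex_of_real x) powr (- of_real (\<beta> + 1)) = of_real (x powr (- (\<beta> + 1)))"
      using x powr_of_real[of x "- (\<beta> + 1)"] by simp
    moreover have "F t = of_real (x powr (- real N))"
      using t x by (simp add: F_eq test_fun_def x_def powr_minus powr_realpow divide_inverse)
    moreover have "- (real N + \<beta> + 1) = - real N + - (\<beta> + 1)" by simp
    then have "x powr (- (real N + \<beta> + 1)) = x powr (- real N) * x powr (- (\<beta> + 1))"
      by (simp only: powr_add)
    then have "k t = t * (x powr (- real N) * x powr (- (\<beta> + 1)))"
      using t by (simp add: k_def x_def)
    ultimately show ?thesis by simp
  qed
  define c where "c = (1 / 2) * (2 * (1 - a)) powr (- (real N + \<beta> + 1))"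
  have "c * measure \<mu> {a..<1} = (\<integral>t. c * indicator {a..<1} t \<partial>\<mu>)"
    using sets_\<mu> by simp
  also have "\<dots> \<le> (\<integral>t. k t \<partial>\<mu>)"
  proof (rule integral_mono)
    have "emeasure \<mu> {a..<1} \<le> emeasure \<mu> {0..<1}" using a0 by (intro emeasure_mono) (auto simp: sets_\<mu>)
    then show "integrable \<mu> (\<lambda>t. c * indicator {a..<1} t)"
      using fin by (intro integrable_mult_right integrable_real_indicator) (auto simp: sets_\<mu> order_le_less_trans)
    show "integrable \<mu> k"
    proof (rule finite_measure.integrable_const_bound[OF finite_\<mu>])
      show "AE t in \<mu>. norm (k t) \<le> (1 - a) powr (- (real N + \<beta> + 1))"
        using AE_01
      proof eventually_elim
        case (elim t)
        have "(1 - a * t) powr (- (real N + \<beta> + 1)) \<le> (1 - a) powr (- (real N + \<beta> + 1))"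
          using at[of t] elim a \<beta> by (intro powr_mono2') auto
        then have "t * (1 - a * t) powr (- (real N + \<beta> + 1)) \<le> 1 * (1 - a) powr (- (real N + \<beta> + 1))"
          using elim by (intro mult_mono) auto
        then show ?case using elim by (simp add: k_def)
      qed
    qed measurable
    show "c * indicator {a..<1} t \<le> k t" for t
    proof (cases "t \<in> {a..<1}")
      case True
      then have t: "0 \<le> t" "t < 1" "a \<le> t" using a0 by auto
      have "a * a \<le> a * t" using t a0 by (intro mult_left_mono) auto
      moreover have "0 \<le> (1 - a) * (1 - a)" by simp
      ultimately have "1 - a * t \<le> 2 * (1 - a)" by (simp add: algebra_simps)
      moreover have "0 < 1 - a * t" using at[OF t(1,2)] a by linarith
      ultimately have "(2 * (1 - a)) powr (- (real N + \<beta> + 1)) \<le> (1 - a * t) powr (- (real N + \<beta> + 1))"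
        using \<beta> by (intro powr_mono2') simp_all
      then have "c \<le> t * (1 - a * t) powr (- (real N + \<beta> + 1))"
        unfolding c_def using t a by (intro mult_mono) auto
      then show ?thesis using True t by (simp add: k_def)
    next
      case False
      then show ?thesis by (auto simp: k_def indicator_def)
    qed
  qed
  also have "\<dots> \<le> norm (complex_of_real (\<integral>t. k t \<partial>\<mu>))" by (simp only: norm_of_real abs_ge_self)
  also have "complex_of_real (\<integral>t. k t \<partial>\<mu>) = (\<integral>t. of_real t * F t * (1 - of_real t * of_real a) powr (- of_real (\<beta> + 1)) \<partial>\<mu>)"
  proof -
    have "(\<integral>t. of_real t * F t * (1 - of_real t * of_real a) powr (- of_real (\<beta> + 1)) \<partial>\<mu>) = (\<integral>t. complex_of_real (k t) \<partial>\<mu>)"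
    proof (rule integral_cong_AE)
      show "AE t in \<mu>. of_real t * F t * (1 - of_real t * of_real a) powr (- of_real (\<beta> + 1)) = complex_of_real (k t)"
        using AE_01 by eventually_elim (rule keq; simp)
    qed measurable
    then show ?thesis by simp
  qed
  finally have "\<beta> * (c * measure \<mu> {a..<1}) \<le> \<beta> * norm (\<integral>t. of_real t * F t * (1 - of_real t * of_real a) powr (- of_real (\<beta> + 1)) \<partial>\<mu>)"
    using \<beta> by (intro mult_left_mono) auto
  also have "\<dots> = norm (deriv (hilbert_op \<mu> \<beta> (test_fun N a)) (of_real a))"
    using a a0 \<beta> by (subst deriv_hilbert_op) (auto simp: norm_mult)
  finally show ?thesis by (simp add: c_def mult_ac)
qed

lemma dirichlet_deriv_growth:
  assumes q: "q > 0" and \<gamma>: "\<gamma> > -1"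
  obtains C where "C > 0" "\<And>g a. g \<in> dirichlet_space q \<gamma> \<Longrightarrow> norm a < 1 \<Longrightarrow>
    norm (deriv g a) * (1 - norm a) powr ((\<gamma> + 2) / q) \<le> C * dirichlet_norm q \<gamma> g"
proof -
  obtain C where C: "C > 0" "\<And>h a. h holomorphic_on ball 0 1 \<Longrightarrow> norm a < 1 \<Longrightarrow>
      ennreal (norm (h a) powr q * (1 - norm a) powr (\<gamma> + 2)) \<le> ennreal C * bergman_integral q \<gamma> h"
    using bergman_growth[OF q, of \<gamma>] by blast
  have "norm (deriv g a) * (1 - norm a) powr ((\<gamma> + 2) / q) \<le> (C / (\<gamma> + 1)) powr (1 / q) * dirichlet_norm q \<gamma> g"
    if g: "g \<in> dirichlet_space q \<gamma>" and a: "norm a < 1" for g a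
  proof -
    have h: "deriv g holomorphic_on ball 0 1" "bergman_integral q \<gamma> (deriv g) < \<infinity>"
      using g by (auto simp: dirichlet_space_def bergman_space_def)
    define I where "I = enn2real (bergman_integral q \<gamma> (deriv g))"
    have I: "bergman_integral q \<gamma> (deriv g) = ennreal I" "I \<ge> 0" using h(2) by (auto simp: I_def less_top)
    have "ennreal (norm (deriv g a) powr q * (1 - norm a) powr (\<gamma> + 2)) \<le> ennreal (C * I)"
      using C(2)[OF h(1) a] C(1) I by (simp add: ennreal_mult')
    then have "norm (deriv g a) powr q * (1 - norm a) powr (\<gamma> + 2) \<le> C * I"
      using C(1) I by (subst (asm) ennreal_le_iff) auto
    then have "(norm (deriv g a) powr q * (1 - norm a) powr (\<gamma> + 2)) powr (1 / q) \<le> (C / (\<gamma> + 1) * ((\<gamma> + 1) * I)) powr (1 / q)"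
      using q \<gamma> by (intro powr_mono2) auto
    then have "norm (deriv g a) * (1 - norm a) powr ((\<gamma> + 2) / q) \<le> (C / (\<gamma> + 1)) powr (1 / q) * ((\<gamma> + 1) * I) powr (1 / q)"
      using q by (simp only: powr_mult powr_powr) simp
    also have "\<dots> \<le> (C / (\<gamma> + 1)) powr (1 / q) * dirichlet_norm q \<gamma> g"
      by (intro mult_left_mono) (auto simp: dirichlet_norm_def bergman_norm_def I_def)
    finally show ?thesis .
  qed
  moreover have "(C / (\<gamma> + 1)) powr (1 / q) > 0" using C(1) \<gamma> by simp
  ultimately show ?thesis using that by blast
qed

lemma hilbert_bounded_imp_carleson:
  fixes p q \<alpha> :: real
  assumes q: "q > 1" and p: "0 < p" and \<alpha>: "\<alpha> > p - 1" and \<mu>: "borel_measure_on_01 \<mu>"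
    and fin: "emeasure \<mu> {0..<1} < \<infinity>"
    and bdd: "hilbert_bounded_DD \<mu> (\<alpha> + 1 - p) p \<alpha> q (\<alpha> - p)"
  shows "carleson \<mu> ((\<alpha> + 2 - p) / p + (\<alpha> + 2 - p) / (q / (q - 1)))"
proof -
  define G where "G = \<alpha> + 2 - p"
  define \<beta> where "\<beta> = \<alpha> + 1 - p"
  define s where "s = G / p + G / (q / (q - 1))"
  have \<beta>: "\<beta> > 0" and G: "G = \<beta> + 1" using \<alpha> by (auto simp: G_def \<beta>_def)
  have s: "s = (\<alpha> + 2) / p - 1 + G - G / q" using p q by (simp add: s_def G_def field_simps)
  have s0: "s \<ge> 0" using \<beta> p q by (simp add: s_def G)
  have sets: "sets \<mu> = sets borel" using \<mu> by (simp add: borel_measure_on_01_def)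
  obtain B where B: "\<And>f. f \<in> dirichlet_space p \<alpha> \<Longrightarrow> hilbert_op \<mu> \<beta> f \<in> dirichlet_space q (\<alpha> - p) \<and>
        dirichlet_norm q (\<alpha> - p) (hilbert_op \<mu> \<beta> f) \<le> B * dirichlet_norm p \<alpha> f"
    using bdd unfolding hilbert_bounded_DD_def \<beta>_def by blast
  obtain N :: nat where "(\<alpha> + 2) / p < real N" using reals_Archimedean2 by blast
  then have N: "(real N + 1) * p > \<alpha> + 2" using p by (simp add: field_simps)
  have \<alpha>1: "\<alpha> > -1" using \<alpha> p by simp
  have \<gamma>: "\<alpha> - p > -1" using \<alpha> by simp
  obtain C1 where C1: "C1 > 0" "\<And>a. 0 < a \<Longrightarrow> a < 1 \<Longrightarrow> test_fun N a \<in> dirichlet_space p \<alpha> \<and>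
    dirichlet_norm p \<alpha> (test_fun N a) \<le> C1 * (1 - a) powr ((\<alpha> + 2) / p - (real N + 1))"
    using test_fun_norm_le[OF p \<alpha>1 N] by blast
  have q0: "q > 0" using q by simp
  obtain C2 where C2: "C2 > 0" "\<And>g a. g \<in> dirichlet_space q (\<alpha> - p) \<Longrightarrow> norm a < 1 \<Longrightarrow>
    norm (deriv g a) * (1 - norm a) powr ((\<alpha> - p + 2) / q) \<le> C2 * dirichlet_norm q (\<alpha> - p) g"
    using dirichlet_deriv_growth[OF q0 \<gamma>] by blast
  define m where "m = measure \<mu> {0..<1}"
  have mfin: "emeasure \<mu> {t..<1} = ennreal (measure \<mu> {t..<1}) \<and> measure \<mu> {t..<1} \<le> m" if "0 \<le> t" for t
  proof -
    have f: "emeasure \<mu> {t..<1} \<le> emeasure \<mu> {0..<1}" using that by (intro emeasure_mono) (auto simp: sets)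
    then have "emeasure \<mu> {t..<1} \<noteq> top" using fin by (auto simp: top_unique)
    moreover have "measure \<mu> {t..<1} \<le> m" unfolding m_def measure_def using f fin by (intro enn2real_mono) auto
    ultimately show ?thesis by (simp add: emeasure_eq_ennreal_measure)
  qed
  define P where "P = \<beta> / 2 * 2 powr (- (real N + G))"
  have P: "P > 0" using \<beta> by (simp add: P_def)
  define R where "R = C2 * \<bar>B\<bar> * C1 / P"
  have R: "R \<ge> 0" using C1(1) C2(1) P by (simp add: R_def)
  have big: "measure \<mu> {a..<1} \<le> R * (1 - a) powr s" if a: "1 / 2 \<le> a" "a < 1" for a
  proof -
    define d where "d = 1 - a"
    have d: "d > 0" using a by (simp add: d_def)
    have a0: "0 < a" using a by simp
    let ?f = "test_fun N a"
    have f: "?f \<in> dirichlet_space p \<alpha>" "dirichlet_norm p \<alpha> ?f \<le> C1 * d powr ((\<alpha> + 2) / p - (real N + 1))"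
      using C1(2)[OF a0 a(2)] by (auto simp: d_def)
    have "\<beta> / 2 * (2 * (1 - a)) powr (- (real N + \<beta> + 1)) = P * d powr (- (real N + G))"
      by (simp only: P_def G d_def powr_mult add.assoc mult.assoc)
    then have "P * d powr (- (real N + G)) * measure \<mu> {a..<1} \<le> norm (deriv (hilbert_op \<mu> \<beta> ?f) (of_real a))"
      using deriv_hilbert_op_test_fun_ge[OF \<mu> \<beta> fin a, of N] by simp
    then have "P * d powr (- (real N + G)) * measure \<mu> {a..<1} * d powr (G / q)
      \<le> norm (deriv (hilbert_op \<mu> \<beta> ?f) (of_real a)) * d powr (G / q)"
      by (rule mult_right_mono) simp
    also have "\<dots> \<le> C2 * dirichlet_norm q (\<alpha> - p) (hilbert_op \<mu> \<beta> ?f)"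
    proof -
      have "\<alpha> - p + 2 = G" by (simp add: G_def)
      then show ?thesis using C2(2)[of "hilbert_op \<mu> \<beta> ?f" "of_real a"] B[OF f(1)] a a0 by (simp add: d_def)
    qed
    also have "\<dots> \<le> C2 * (\<bar>B\<bar> * (C1 * d powr ((\<alpha> + 2) / p - (real N + 1))))"
    proof (intro mult_left_mono)
      have D0: "0 \<le> dirichlet_norm p \<alpha> ?f" by (simp add: dirichlet_norm_def bergman_norm_def)
      have "dirichlet_norm q (\<alpha> - p) (hilbert_op \<mu> \<beta> ?f) \<le> B * dirichlet_norm p \<alpha> ?f" using B[OF f(1)] by blast
      also have "\<dots> \<le> \<bar>B\<bar> * (C1 * d powr ((\<alpha> + 2) / p - (real N + 1)))"
        using f(2) D0 by (intro mult_mono) auto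
      finally show "dirichlet_norm q (\<alpha> - p) (hilbert_op \<mu> \<beta> ?f) \<le> \<bar>B\<bar> * (C1 * d powr ((\<alpha> + 2) / p - (real N + 1)))" .
    qed (use C2(1) in simp)
    finally have 1: "P * measure \<mu> {a..<1} * (d powr (- (real N + G)) * d powr (G / q)) \<le> P * R * d powr ((\<alpha> + 2) / p - (real N + 1))"
      using P by (simp add: R_def mult_ac)
    have "d powr (- (real N + G)) * d powr (G / q) = d powr (- (real N + G) + G / q)" by (simp only: powr_add)
    \<comment> \<open>Multiplying by \<open>d powr (N + G - G/q)\<close> clears the power on the
      left; on the right the exponents add up to \<open>s\<close>, independently of
      \<open>N\<close>.\<close>
    then have "P * measure \<mu> {a..<1} * d powr (- (real N + G) + G / q) * d powr (real N + G - G / q)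
      \<le> P * R * d powr ((\<alpha> + 2) / p - (real N + 1)) * d powr (real N + G - G / q)"
      using 1 by (intro mult_right_mono) auto
    moreover have "d powr (- (real N + G) + G / q) * d powr (real N + G - G / q) = 1"
      using d by (simp flip: powr_add)
    moreover have "d powr ((\<alpha> + 2) / p - (real N + 1)) * d powr (real N + G - G / q) = d powr s"
      unfolding s by (simp add: algebra_simps flip: powr_add)
    ultimately have "P * measure \<mu> {a..<1} \<le> P * (R * d powr s)" by (simp add: mult.assoc)
    then show ?thesis using P by (simp add: d_def)
  qed
  have "emeasure \<mu> {t..<1} \<le> ennreal ((R + m * 2 powr s) * (1 - t) powr s)" if t: "0 \<le> t" "t < 1" for t
  proof -
    have m0: "m \<ge> 0" by (simp add: m_def)
    have "measure \<mu> {t..<1} \<le> (R + m * 2 powr s) * (1 - t) powr s"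
    \<comment> \<open>For \<open>t < 1/2\<close> the total mass suffices, because
      \<open>(2 * (1 - t)) powr s\<close> is at least 1 for \<open>s \<ge> 0\<close>.\<close>
    proof (cases "1 / 2 \<le> t")
      case True
      have "measure \<mu> {t..<1} \<le> R * (1 - t) powr s" using big[OF True t(2)] .
      also have "\<dots> \<le> (R + m * 2 powr s) * (1 - t) powr s" using m0 by (intro mult_right_mono) auto
      finally show ?thesis .
    next
      case False
      have "1 powr s \<le> (2 * (1 - t)) powr s" using False s0 by (intro powr_mono2) auto
      then have "1 \<le> 2 powr s * (1 - t) powr s" by (simp only: powr_mult powr_one_eq_one)
      then have "m * 1 \<le> m * (2 powr s * (1 - t) powr s)" using m0 by (intro mult_left_mono)
      also have "\<dots> \<le> (R + m * 2 powr s) * (1 - t) powr s" using R by (simp add: distrib_right mult.assoc)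
      finally show ?thesis using mfin[OF t(1)] by simp
    qed
    then show ?thesis using mfin[OF t(1)] by (simp add: ennreal_leI)
  qed
  then have "carleson \<mu> s" unfolding carleson_def by blast
  then show ?thesis by (simp add: s_def G_def)
qed

theorem theorem4p03:
  fixes p q \<alpha> :: real and \<mu> :: "real measure"
  assumes "q > 1" and "0 < p" and "p \<le> q" and "\<alpha> > p - 1"
    and "borel_measure_on_01 \<mu>"
    and "cond_W p \<alpha> \<mu>"
  shows "hilbert_bounded_DD \<mu> (\<alpha> + 1 - p) p \<alpha> q (\<alpha> - p) \<longleftrightarrow>
         carleson \<mu> ((\<alpha> + 2 - p) / p + (\<alpha> + 2 - p) / (q / (q - 1)))"
proof
  \<comment> \<open>Whichever range \<open>p\<close> falls in, \<open>cond_W\<close> yields a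
    Carleson condition, and \<open>t = 0\<close> in it gives finite mass. Bounded functions such as
    the test function majorants are then \<open>\<mu>\<close>-integrable.\<close>
  have "emeasure \<mu> {0..<1} < \<infinity>"
    using assms(2,6) carleson_finite unfolding cond_W_def by (cases "p \<le> 1"; cases "p \<le> 2") auto
  then show "hilbert_bounded_DD \<mu> (\<alpha> + 1 - p) p \<alpha> q (\<alpha> - p) \<Longrightarrow>
      carleson \<mu> ((\<alpha> + 2 - p) / p + (\<alpha> + 2 - p) / (q / (q - 1)))"
    using assms by (intro hilbert_bounded_imp_carleson) auto
qed (use assms carleson_imp_hilbert_bounded in blast)

end
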